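(* Let $A$ generate a strongly continuous semigroup on the Hilbert space $\mathbb{H}$, let $B\in\mathcal{L}(\mathbb{U},\mathcal{D}(A^* )')$ be an admissible control operator, let $C\in\mathcal{L}(\mathbb{H})$ and $z\in\mathbb{H}$. Assume that the pairs $(A,C)$ and $(A^*,B^* )$ are finite-time observable in some time $T_0>0$, and that $\ker A\cap\ker C=\{0\}$ and $\ker A^*\cap\ker B^*=\{0\}$. Let $(\bar x,\bar u,\bar y)$ be the solution triple of the stationary problem for $(A,B,C,z)$ and, for $k$ large, let $(\bar x_k,\bar u_k,\bar y_k)$ be the solution triple of the stationary problem for $(A,B_k,C,z)$, where $B_k=J_kB$. Then, as $k\to+\infty$, $$\bar x_k\to\bar x\ \text{in }\mathbb{H},\qquad\bar u_k\to\bar u\ \text{in }\mathbb{U},\qquad\bar y_k\to\bar y\ \text{in }\mathbb{H}.$$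
   Context: $\mathbb{H}$ and $\mathbb{U}$ are Hilbert spaces, identified with their duals. $A:\mathcal{D}(A)\to\mathbb{H}$ generates a strongly continuous semigroup $(e^{tA})_{t\ge0}$; $A^*$ generates the adjoint semigroup. $\mathcal{D}(A^* )$ carries the graph inner product and $\mathcal{D}(A^* )'$ is its dual with respect to the pivot space $\mathbb{H}$; $e^{tA}$ extends to $\mathcal{D}(A^* )'$. For $B\in\mathcal{L}(\mathbb{U},\mathcal{D}(A^* )')$, $B^*\in\mathcal{L}(\mathcal{D}(A^* ),\mathbb{U})$. $B$ is admissible if for all $T>0$ and $u\in L^2((0,T);\mathbb{U})$ the function $t\mapsto\int_0^te^{(t-s)A}Bu(s)\,ds$ belongs to $C([0,T];\mathbb{H})$. $(A,C)$ is finite-time observable in time $T_0$ if there is $c>0$ with $\int_0^{T_0}\|Ce^{tA}\xi\|_{\mathbb{H}}^2dt\ge c\|e^{T_0A}\xi\|_{\mathbb{H}}^2$ for all $\xi\in\mathbb{H}$; $(A^*,B^* )$ is finite-time observable in time $T_0$ if there is $c>0$ with $\int_0^{T_0}\|B^*e^{tA^*}\xi\|_{\mathbb{U}}^2dt\ge c\|e^{T_0A^*}\xi\|_{\mathbb{H}}^2$ for all $\xi\in\mathbb{H}$, where for $\xi\in\mathbb{H}$ the function $t\mapsto B^*e^{tA^*}\xi\in L^2((0,T_0);\mathbb{U})$ is defined by continuous extension from $\mathcal{D}(A^* )$. For $k\in\mathbb{N}$ large (larger than the growth bound of the semigroup), $J_kx=k\int_0^\infty e^{-ks}e^{sA}x\,ds$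 for $x\in\mathbb{H}$, i.e. $J_k=k(k\,\mathrm{id}-A)^{-1}$, which extends to a bounded operator from $\mathcal{D}(A^* )'$ to $\mathbb{H}$; hence $B_k=J_kB\in\mathcal{L}(\mathbb{U},\mathbb{H})$. The solution triple of the stationary problem for $(A,\mathcal{B},C,z)$ (with $\mathcal{B}=B$ or $\mathcal{B}=B_k$) is the unique $(\bar x,\bar u,\bar y)\in\mathbb{H}\times\mathbb{U}\times\mathcal{D}(A^* )$ such that $(\bar x,\bar u)$ minimizes $\|Cx-z\|_{\mathbb{H}}^2+\|u\|_{\mathbb{U}}^2$ over $(x,u)\in\mathbb{H}\times\mathbb{U}$ with $Ax+\mathcal{B}u=0$ (i.e. $\langle x,A^*\varphi\rangle+\langle u,\mathcal{B}^*\varphi\rangle=0$ for all $\varphi\in\mathcal{D}(A^* )$), and $-A^*\bar y-C^*(C\bar x-z)=0$, $\bar u=-\mathcal{B}^*\bar y$. Under the assumptions these triples exist and are unique (for $B_k$, for all large $k$). *)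

theory Defs
  imports "HOL-Analysis.Analysis"
begin

text \<open>
  Hilbert spaces are real (a complex one is covered via the real part of its inner product) and
  need not be separable. An unbounded operator is a pair (domain, map); the values of the map
  outside the domain are irrelevant.
\<close>

type_synonym 'a unb_op = "'a set \<times> ('a \<Rightarrow> 'a)"

abbreviation op_dom :: "'a unb_op \<Rightarrow> 'a set" where "op_dom A \<equiv> fst A"
abbreviation op_app :: "'a unb_op \<Rightarrow> 'a \<Rightarrow> 'a" where "op_app A \<equiv> snd A"

definition c0_semigroup :: "(real \<Rightarrow> 'h::real_normed_vector \<Rightarrow> 'h) \<Rightarrow> bool" where
  "c0_semigroup S \<longleftrightarrow>
     (\<forall>t\<ge>0. bounded_linear (S t)) \<and>
     (\<forall>x. S 0 x = x) \<and>
     (\<forall>s\<ge>0. \<forall>t\<ge>0. \<forall>x. S (s + t) x = S s (S t x)) \<and>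
     (\<forall>x. ((\<lambda>t. S t x) \<longlongrightarrow> x) (at_right 0))"

definition generates :: "'h::real_normed_vector unb_op \<Rightarrow> (real \<Rightarrow> 'h \<Rightarrow> 'h) \<Rightarrow> bool" where
  "generates A S \<longleftrightarrow>
     c0_semigroup S \<and>
     op_dom A = {x. \<exists>y. ((\<lambda>h. (S h x - x) /\<^sub>R h) \<longlongrightarrow> y) (at_right 0)} \<and>
     (\<forall>x\<in>op_dom A. ((\<lambda>h. (S h x - x) /\<^sub>R h) \<longlongrightarrow> op_app A x) (at_right 0))"

text \<open>The adjoint of a densely defined operator.\<close>

definition adj_op :: "'h::real_inner unb_op \<Rightarrow> 'h unb_op" where
  "adj_op A =
     ({\<phi>. \<exists>w. \<forall>x\<in>op_dom A. op_app A x \<bullet> \<phi> = x \<bullet> w},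
      (\<lambda>\<phi>. THE w. \<forall>x\<in>op_dom A. op_app A x \<bullet> \<phi> = x \<bullet> w))"

text \<open>
  The dual of \<open>D(A\<^sup>*)\<close> with the graph norm. Its elements are functionals on
  \<open>D(A\<^sup>*)\<close>, normalised to be zero outside \<open>D(A\<^sup>*)\<close> so that each one has a single
  representative.
\<close>

definition graph_norm :: "'h::real_inner unb_op \<Rightarrow> 'h \<Rightarrow> real" where
  "graph_norm A x = sqrt ((norm x)\<^sup>2 + (norm (op_app A x))\<^sup>2)"

definition dual_space :: "'h::real_inner unb_op \<Rightarrow> ('h \<Rightarrow> real) set" where
  "dual_space A = {f.
     (\<forall>\<phi>\<in>op_dom (adj_op A). \<forall>\<psi>\<in>op_dom (adj_op A). f (\<phi> + \<psi>) = f \<phi> + f \<psi>) \<and>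
     (\<forall>\<phi>\<in>op_dom (adj_op A). \<forall>r. f (r *\<^sub>R \<phi>) = r * f \<phi>) \<and>
     (\<exists>K. \<forall>\<phi>\<in>op_dom (adj_op A). \<bar>f \<phi>\<bar> \<le> K * graph_norm (adj_op A) \<phi>) \<and>
     (\<forall>\<phi>. \<phi> \<notin> op_dom (adj_op A) \<longrightarrow> f \<phi> = 0)}"

definition dual_norm :: "'h::real_inner unb_op \<Rightarrow> ('h \<Rightarrow> real) \<Rightarrow> real" where
  "dual_norm A f = (SUP \<phi>\<in>{\<phi>\<in>op_dom (adj_op A). graph_norm (adj_op A) \<phi> \<le> 1}. \<bar>f \<phi>\<bar>)"

text \<open>The embedding of the pivot space into the dual.\<close>

definition pivot :: "'h::real_inner unb_op \<Rightarrow> 'h \<Rightarrow> ('h \<Rightarrow> real)" where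
  "pivot A x = (\<lambda>\<phi>. if \<phi> \<in> op_dom (adj_op A) then x \<bullet> \<phi> else 0)"

text \<open>\<open>B \<in> L(U, D(A\<^sup>*)')\<close> and \<open>B\<^sup>* : D(A\<^sup>*) \<rightarrow> U\<close>.\<close>

definition control_op :: "'h::real_inner unb_op \<Rightarrow> ('u::real_inner \<Rightarrow> ('h \<Rightarrow> real)) \<Rightarrow> bool" where
  "control_op A B \<longleftrightarrow>
     (\<forall>u. B u \<in> dual_space A) \<and>
     (\<forall>u v. B (u + v) = (\<lambda>\<phi>. B u \<phi> + B v \<phi>)) \<and>
     (\<forall>r u. B (r *\<^sub>R u) = (\<lambda>\<phi>. r * B u \<phi>)) \<and>
     (\<exists>K. \<forall>u. dual_norm A (B u) \<le> K * norm u)"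

definition control_adj :: "('u::real_inner \<Rightarrow> ('h \<Rightarrow> real)) \<Rightarrow> 'h \<Rightarrow> 'u" where
  "control_adj B \<phi> = (THE v. \<forall>u. v \<bullet> u = B u \<phi>)"

text \<open>
  The bounded extension of \<open>e\<^sup>t\<^sup>A\<close> to the dual space. It is unique on the dual space, because
  the pivot space is dense there.
\<close>

definition semigroup_ext ::
  "'h::real_inner unb_op \<Rightarrow> (real \<Rightarrow> 'h \<Rightarrow> 'h) \<Rightarrow> real \<Rightarrow> ('h \<Rightarrow> real) \<Rightarrow> ('h \<Rightarrow> real)" where
  "semigroup_ext A S t = (SOME E.
     (\<forall>f\<in>dual_space A. E f \<in> dual_space A) \<and>
     (\<forall>f\<in>dual_space A. \<forall>g\<in>dual_space A. E (\<lambda>\<phi>. f \<phi> + g \<phi>) = (\<lambda>\<phi>. E f \<phi> + E g \<phi>)) \<and>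
     (\<forall>f\<in>dual_space A. \<forall>r. E (\<lambda>\<phi>. r * f \<phi>) = (\<lambda>\<phi>. r * E f \<phi>)) \<and>
     (\<exists>K. \<forall>f\<in>dual_space A. dual_norm A (E f) \<le> K * dual_norm A f) \<and>
     (\<forall>x. E (pivot A x) = pivot A (S t x)))"

text \<open>
  The operator \<open>J\<^sub>k\<close> on the pivot space, and its bounded extension from the dual space to the
  pivot space; both are meaningful only for \<open>k\<close> above the growth bound.
\<close>

definition yosida :: "(real \<Rightarrow> 'h::real_inner \<Rightarrow> 'h) \<Rightarrow> nat \<Rightarrow> 'h \<Rightarrow> 'h" where
  "yosida S k x = real k *\<^sub>R integral {0..} (\<lambda>s. exp (- (real k * s)) *\<^sub>R S s x)"

definition yosida_ext ::
  "'h::real_inner unb_op \<Rightarrow> (real \<Rightarrow> 'h \<Rightarrow> 'h) \<Rightarrow> nat \<Rightarrow> ('h \<Rightarrow> real) \<Rightarrow> 'h" where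
  "yosida_ext A S k = (SOME J.
     (\<forall>f\<in>dual_space A. \<forall>g\<in>dual_space A. J (\<lambda>\<phi>. f \<phi> + g \<phi>) = J f + J g) \<and>
     (\<forall>f\<in>dual_space A. \<forall>r. J (\<lambda>\<phi>. r * f \<phi>) = r *\<^sub>R J f) \<and>
     (\<exists>K. \<forall>f\<in>dual_space A. norm (J f) \<le> K * dual_norm A f) \<and>
     (\<forall>x. J (pivot A x) = yosida S k x))"

text \<open>
  \<open>L\<^sup>2((0,T);U)\<close>. Since \<open>U\<close> may be non-separable, measurability means strong measurability, i.e.
  being an a.e. limit of simple functions. The Lebesgue (not the Borel) measure is used
  because members are determined only up to null sets.
\<close>

definition L2_fun :: "real \<Rightarrow> (real \<Rightarrow> 'u::real_normed_vector) \<Rightarrow> bool" where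
  "L2_fun T u \<longleftrightarrow>
     (\<exists>s. (\<forall>i::nat. simple_function lebesgue (s i)) \<and>
          (AE t in lebesgue. t \<in> {0<..<T} \<longrightarrow> (\<lambda>i. s i t) \<longlonglongrightarrow> u t)) \<and>
     (\<integral>\<^sup>+t\<in>{0<..<T}. ennreal ((norm (u t))\<^sup>2) \<partial>lebesgue) < \<infinity>"

text \<open>
  The integral of a function with values in the dual space is taken pointwise on
  \<open>D(A\<^sup>*)\<close>; for Bochner integrable functions this is the Bochner integral.
\<close>

definition dual_integral :: "real \<Rightarrow> (real \<Rightarrow> ('h \<Rightarrow> real)) \<Rightarrow> ('h \<Rightarrow> real)" where
  "dual_integral t g = (\<lambda>\<phi>. LINT s:{0..t}|lebesgue. g s \<phi>)"

definition admissible ::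
  "'h::real_inner unb_op \<Rightarrow> (real \<Rightarrow> 'h \<Rightarrow> 'h) \<Rightarrow> ('u::real_inner \<Rightarrow> ('h \<Rightarrow> real)) \<Rightarrow> bool" where
  "admissible A S B \<longleftrightarrow>
     (\<forall>T>0. \<forall>u. L2_fun T u \<longrightarrow>
        (\<exists>v. continuous_on {0..T} v \<and>
             (\<forall>t\<in>{0..T}. pivot A (v t) =
                dual_integral t (\<lambda>s. semigroup_ext A S (t - s) (B (u s))))))"

definition observable ::
  "(real \<Rightarrow> 'h::real_inner \<Rightarrow> 'h) \<Rightarrow> ('h \<Rightarrow> 'h) \<Rightarrow> real \<Rightarrow> bool" where
  "observable S C T \<longleftrightarrow>
     (\<exists>c>0. \<forall>\<xi>. (LINT t:{0..T}|lebesgue. (norm (C (S t \<xi>)))\<^sup>2) \<ge> c * (norm (S T \<xi>))\<^sup>2)"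

text \<open>
  The function \<open>t \<mapsto> B\<^sup>* e\<^sup>t\<^sup>A\<^sup>* \<xi>\<close> in \<open>L\<^sup>2((0,T);U)\<close>, for arbitrary \<open>\<xi>\<close>, by continuous extension
  from \<open>D(A\<^sup>*)\<close>; it is determined up to null sets.
\<close>

definition dual_output ::
  "'h::real_inner unb_op \<Rightarrow> (real \<Rightarrow> 'h \<Rightarrow> 'h) \<Rightarrow> ('u::real_inner \<Rightarrow> ('h \<Rightarrow> real)) \<Rightarrow>
   real \<Rightarrow> 'h \<Rightarrow> real \<Rightarrow> 'u" where
  "dual_output A S B T \<xi> = (SOME g. L2_fun T g \<and>
     (\<forall>\<phi>. (\<forall>n. \<phi> n \<in> op_dom (adj_op A)) \<longrightarrow> \<phi> \<longlonglongrightarrow> \<xi> \<longrightarrow>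
        (\<lambda>n. \<integral>\<^sup>+t\<in>{0<..<T}.
            ennreal ((norm (control_adj B (adjoint (S t) (\<phi> n)) - g t))\<^sup>2) \<partial>lebesgue)
        \<longlonglongrightarrow> 0))"

definition dual_observable ::
  "'h::real_inner unb_op \<Rightarrow> (real \<Rightarrow> 'h \<Rightarrow> 'h) \<Rightarrow> ('u::real_inner \<Rightarrow> ('h \<Rightarrow> real)) \<Rightarrow> real \<Rightarrow> bool"
  where
  "dual_observable A S B T \<longleftrightarrow>
     (\<exists>c>0. \<forall>\<xi>. (LINT t:{0<..<T}|lebesgue. (norm (dual_output A S B T \<xi> t))\<^sup>2)
        \<ge> c * (norm (adjoint (S T) \<xi>))\<^sup>2)"

text \<open>
  The control operator takes values in the dual space of \<open>A\<close>; a bounded control operator into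
  the pivot space is composed with the embedding first.
\<close>

definition stationary_constraint ::
  "'h::real_inner unb_op \<Rightarrow> ('u::real_inner \<Rightarrow> ('h \<Rightarrow> real)) \<Rightarrow> 'h \<times> 'u \<Rightarrow> bool" where
  "stationary_constraint A B = (\<lambda>(x, u).
     \<forall>\<phi>\<in>op_dom (adj_op A). x \<bullet> op_app (adj_op A) \<phi> + u \<bullet> control_adj B \<phi> = 0)"

definition solution_triple ::
  "'h::real_inner unb_op \<Rightarrow> ('u::real_inner \<Rightarrow> ('h \<Rightarrow> real)) \<Rightarrow> ('h \<Rightarrow> 'h) \<Rightarrow> 'h \<Rightarrow>
   'h \<times> 'u \<times> 'h \<Rightarrow> bool" where
  "solution_triple A B C z = (\<lambda>(x, u, y).
     is_arg_min (\<lambda>(x', u'). (norm (C x' - z))\<^sup>2 + (norm u')\<^sup>2) (stationary_constraint A B) (x, u) \<and>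
     y \<in> op_dom (adj_op A) \<and>
     - op_app (adj_op A) y - adjoint C (C x - z) = 0 \<and>
     u = - control_adj B y)"

end

theory Submission
  imports Defs "HOL-Real_Asymp.Real_Asymp"
begin

text \<open>
  Write \<open>R\<^sub>k\<close> for the adjoint of \<open>J\<^sub>k\<close>, so that \<open>B\<^sub>k\<^sup>* = B\<^sup>* R\<^sub>k\<close>. The pair
  \<open>(J\<^sub>k xbar, ubar)\<close> satisfies the constraint of the \<open>k\<close>-th problem, and testing the difference
  of the constraints with \<open>y\<^sub>k - ybar\<close> bounds \<open>C (x\<^sub>k - xbar)\<close> and \<open>u\<^sub>k - ubar\<close> by the
  consistency errors \<open>xbar - J\<^sub>k xbar\<close> and \<open>B\<^sup>* (R\<^sub>k ybar - ybar)\<close>, which tend to zero. The two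
  observability inequalities, combined with the bound
  \<open>\<integral> \<parallel>B\<^sup>* e\<^sup>t\<^sup>A\<^sup>* \<phi>\<parallel>\<^sup>2 dt \<le> K \<parallel>\<phi>\<parallel>\<^sup>2\<close> that admissibility provides, give estimates
  \<open>\<parallel>x\<parallel> \<le> K (\<parallel>C x\<parallel> + \<parallel>u\<parallel>)\<close> on the constraint and
  \<open>\<parallel>y\<parallel> \<le> K (\<parallel>B\<^sup>* R\<^sub>k y\<parallel> + \<parallel>A\<^sup>* y\<parallel>)\<close>, both uniform in \<open>k\<close>; these control the states
  and the adjoint states.
\<close>


text \<open>Observability bounds only the final state, so it says nothing about x or y until
  \<open>S T x - x\<close> and its adjoint counterpart are controlled. A pair on the constraint is
  an equilibrium of the evolution with constant control; hence \<open>S t x - x\<close> is a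
  convolution with that control, which admissibility bounds. This turns a hypothesis in time into a
  stationary estimate without inverting A. The comparison pair is feasible because the extended J_k
  commutes with A, so that applying J_k to the limit constraint gives the k-th one; xbar itself
  would leave a residual (B_k - B) ubar that lives only in the dual space. Admissibility is
  qualitative, a membership in a space of continuous functions, and has to be turned into an
  inequality first. This is a Banach-Steinhaus argument on L^2, carried out with an explicit signed
  series instead of Baire category, so that single measurable functions suffice and no function
  space has to be completed. Uniformity in k comes from the one bound \<open>L\<close> on all J_k
  with \<open>real k \<ge> \<omega> + 1\<close>.\<close>

section \<open>Orthogonal projection, Riesz representation and Hilbert adjoints\<close>

text \<open>A minimising sequence is Cauchy by the parallelogram law: the midpoint of two of its
  members stays in \<open>K\<close>, hence at distance at least \<open>d\<close> from
  \<open>x\<close>.\<close>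

lemma closed_subspace_nearest:
  fixes K :: "'a::{real_inner, complete_space} set"
  assumes K: "subspace K" "closed K"
  obtains p where "p \<in> K" "\<And>q. q \<in> K \<Longrightarrow> (x - p) \<bullet> q = 0"
proof -
  define d where "d = infdist x K"
  have ne: "K \<noteq> {}" using K(1) subspace_0 by blast
  have dle: "d \<le> norm (x - q)" if "q \<in> K" for q
    using infdist_le[OF that, of x] by (simp add: d_def dist_norm)
  have "\<exists>q\<in>K. norm (x - q) < d + 1 / Suc n" for n :: nat
  proof (rule ccontr)
    assume "\<not> ?thesis"
    then have "d + 1 / Suc n \<le> d"
      unfolding d_def infdist_notempty[OF ne] using ne
      by (intro cINF_greatest) (auto simp: dist_norm d_def infdist_notempty not_less)
    then show False by simp
  qed
  then obtain q where qK: "\<And>n. q n \<in> K" and qd: "\<And>n. norm (x - q n) < d + 1 / Suc n"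
    by metis
  have d0: "d \<ge> 0" by (simp add: d_def infdist_nonneg)
  have est: "(norm (q m - q n))\<^sup>2 \<le> 2 * (d + 1 / Suc m)\<^sup>2 + 2 * (d + 1 / Suc n)\<^sup>2 - 4 * d\<^sup>2" for m n
  proof -
    let ?a = "x - q m" and ?b = "x - q n"
    have "(norm (?a - ?b))\<^sup>2 = 2 * (norm ?a)\<^sup>2 + 2 * (norm ?b)\<^sup>2 - (norm (?a + ?b))\<^sup>2"
      by (simp add: power2_norm_eq_inner inner_simps inner_commute algebra_simps)
    moreover have "(1/2) *\<^sub>R (q m + q n) \<in> K"
      using K(1) qK by (intro subspace_scale subspace_add) auto
    then have "d \<le> norm (x - (1/2) *\<^sub>R (q m + q n))" by (rule dle)
    moreover have "?a + ?b = 2 *\<^sub>R (x - (1/2) *\<^sub>R (q m + q n))"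
      by (simp add: algebra_simps scaleR_2)
    then have "norm (?a + ?b) = 2 * norm (x - (1/2) *\<^sub>R (q m + q n))" by simp
    ultimately have "(norm (?a + ?b))\<^sup>2 \<ge> (2 * d)\<^sup>2"
      using d0 by (intro power_mono) auto
    moreover have "(norm ?a)\<^sup>2 \<le> (d + 1 / Suc m)\<^sup>2" "(norm ?b)\<^sup>2 \<le> (d + 1 / Suc n)\<^sup>2"
      using qd[of m] qd[of n] by (auto intro!: power_mono)
    moreover have "norm (?a - ?b) = norm (q m - q n)" by (simp add: norm_minus_commute)
    ultimately show ?thesis
      using \<open>(norm (?a - ?b))\<^sup>2 = _\<close> by (simp add: power_mult_distrib)
  qed
  have "Cauchy q"
  proof (rule metric_CauchyI)
    fix e :: real assume e: "e > 0"
    have "(\<lambda>n. (d + 1 / real (Suc n))\<^sup>2) \<longlonglongrightarrow> (d + 0)\<^sup>2"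
      by (intro tendsto_intros LIMSEQ_Suc[OF lim_1_over_n])
    then have "\<forall>\<^sub>F n in sequentially. (d + 1 / real (Suc n))\<^sup>2 < d\<^sup>2 + e\<^sup>2 / 4"
      using e by (intro order_tendstoD(2)) auto
    then obtain N where N: "\<And>n. n \<ge> N \<Longrightarrow> (d + 1 / real (Suc n))\<^sup>2 < d\<^sup>2 + e\<^sup>2 / 4"
      by (auto simp: eventually_sequentially)
    show "\<exists>M. \<forall>m\<ge>M. \<forall>n\<ge>M. dist (q m) (q n) < e"
    proof (intro exI allI impI)
      fix m n assume "m \<ge> N" "n \<ge> N"
      then have "(norm (q m - q n))\<^sup>2 < e\<^sup>2"
        using est[of m n] N[of m] N[of n] by simp
      then show "dist (q m) (q n) < e" using e by (simp add: dist_norm power_less_imp_less_base)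
    qed
  qed
  then obtain p where p: "q \<longlonglongrightarrow> p" using Cauchy_convergent convergent_def by blast
  have pK: "p \<in> K" using closed_sequentially[OF K(2)] qK p by blast
  have "(\<lambda>n. norm (x - q n)) \<longlonglongrightarrow> norm (x - p)" by (intro tendsto_intros p)
  moreover have "(\<lambda>n. d + 1 / real (Suc n)) \<longlonglongrightarrow> d + 0"
    by (intro tendsto_intros LIMSEQ_Suc[OF lim_1_over_n])
  ultimately have pd: "norm (x - p) \<le> d"
    using qd by (intro LIMSEQ_le[of _ _ _ d]) (auto intro: less_imp_le)
  show thesis
  proof (rule that[OF pK])
    fix r assume r: "r \<in> K"
    show "(x - p) \<bullet> r = 0"
    proof (rule ccontr)
      assume nz: "(x - p) \<bullet> r \<noteq> 0"
      then have rr: "r \<bullet> r > 0" by auto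
      \<comment> \<open>The minimiser of the quadratic polynomial
        \<open>norm ((x - p) - s *\<^sub>R r)\<close> squared; its value there falls below the
        square of \<open>norm (x - p)\<close> unless the inner product vanishes.\<close>
      define s where "s = ((x - p) \<bullet> r) / (r \<bullet> r)"
      have "p + s *\<^sub>R r \<in> K" using K(1) pK r by (intro subspace_add subspace_scale) auto
      then have "norm (x - p) \<le> norm (x - (p + s *\<^sub>R r))" using pd dle by fastforce
      then have "(norm (x - p))\<^sup>2 \<le> (norm ((x - p) - s *\<^sub>R r))\<^sup>2"
        by (intro power_mono) (auto simp: algebra_simps)
      also have "\<dots> = (norm (x - p))\<^sup>2 - 2 * s * ((x - p) \<bullet> r) + s\<^sup>2 * (r \<bullet> r)"
        unfolding power2_norm_eq_inner
        by (simp only: inner_diff_left[of "x - p"] inner_diff_right[of _ "x - p"] inner_scaleR_left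
            inner_scaleR_right inner_commute[of r "x - p"] power2_eq_square) (simp only: algebra_simps)
      also have "\<dots> = (norm (x - p))\<^sup>2 - ((x - p) \<bullet> r)\<^sup>2 / (r \<bullet> r)"
        using rr by (simp add: s_def power2_eq_square field_simps)
      finally show False using nz rr by (smt (verit) divide_pos_pos zero_less_power2)
    qed
  qed
qed

lemma closure_subspace:
  fixes D :: "'a::real_normed_vector set"
  assumes "subspace D"
  shows "subspace (closure D)"
  unfolding subspace_def
proof (intro conjI allI ballI)
  show "0 \<in> closure D" using assms closure_subset subspace_0 by blast
next
  fix x y assume "x \<in> closure D" "y \<in> closure D"
  then obtain f g where "\<forall>n. f n \<in> D" "f \<longlonglongrightarrow> x" "\<forall>n. g n \<in> D" "g \<longlonglongrightarrow> y"
    unfolding closure_sequential by blast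
  then show "x + y \<in> closure D"
    unfolding closure_sequential using assms
    by (intro exI[of _ "\<lambda>n. f n + g n"]) (auto intro: tendsto_add subspace_add)
next
  fix c x assume "x \<in> closure D"
  then obtain f where "\<forall>n. f n \<in> D" "f \<longlonglongrightarrow> x"
    unfolding closure_sequential by blast
  then show "c *\<^sub>R x \<in> closure D"
    unfolding closure_sequential using assms
    by (intro exI[of _ "\<lambda>n. c *\<^sub>R f n"]) (auto intro: tendsto_intros subspace_scale)
qed

lemma orthogonal_trivial_dense:
  fixes D :: "'a::{real_inner, complete_space} set"
  assumes D: "subspace D" and orth: "\<And>x. (\<And>d. d \<in> D \<Longrightarrow> x \<bullet> d = 0) \<Longrightarrow> x = 0"
  shows "closure D = UNIV"
proof -
  have "x \<in> closure D" for x
  proof -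
    obtain p where p: "p \<in> closure D" "\<And>q. q \<in> closure D \<Longrightarrow> (x - p) \<bullet> q = 0"
      using closed_subspace_nearest[OF closure_subspace[OF D] closed_closure] by metis
    have "x - p = 0" using p(2) closure_subset by (intro orth) blast
    then show ?thesis using p by simp
  qed
  then show ?thesis by blast
qed

lemma riesz_representation:
  fixes f :: "'a::{real_inner, complete_space} \<Rightarrow> real"
  assumes "bounded_linear f"
  shows "\<exists>!v. \<forall>x. f x = v \<bullet> x"
proof -
  interpret bounded_linear f by fact
  have "\<exists>v. \<forall>x. f x = v \<bullet> x"
  proof (cases "\<forall>x. f x = 0")
    case True
    then show ?thesis by (intro exI[of _ 0]) auto
  next
    case False
    then obtain a where a: "f a \<noteq> 0" by blast
    have "subspace {x. f x = 0}" by (auto simp: subspace_def add scaleR zero)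
    moreover have "closed {x. f x = 0}"
      by (intro closed_Collect_eq continuous_intros) (simp add: linear_continuous_on assms)
    ultimately obtain p where p: "f p = 0" "\<And>q. f q = 0 \<Longrightarrow> (a - p) \<bullet> q = 0"
      using closed_subspace_nearest[of "{x. f x = 0}" a] by auto
    \<comment> \<open>\<open>w\<close> is orthogonal to the kernel, and subtracting from
      \<open>x\<close> the multiple of \<open>w\<close> with the same value of \<open>f\<close>
      lands in the kernel.\<close>
    define w where "w = a - p"
    have fw: "f w \<noteq> 0" using a p by (simp add: w_def diff)
    then have ww: "w \<bullet> w \<noteq> 0" using zero by auto
    have "f x = (f w / (w \<bullet> w)) *\<^sub>R w \<bullet> x" for x
    proof -
      have "f (x - (f x / f w) *\<^sub>R w) = 0" using fw by (simp add: diff scaleR)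
      then have "w \<bullet> (x - (f x / f w) *\<^sub>R w) = 0" using p(2) w_def by blast
      then show ?thesis using fw ww by (simp add: inner_diff_right field_simps)
    qed
    then show ?thesis by blast
  qed
  moreover have "v = w" if "\<forall>x. f x = v \<bullet> x" "\<forall>x. f x = w \<bullet> x" for v w
  proof -
    have "(v - w) \<bullet> (v - w) = 0" using that by (simp add: inner_diff_left)
    then show ?thesis by simp
  qed
  ultimately show ?thesis by blast
qed

text \<open>Most vector estimates below are obtained weakly, by testing; this converts them to norm
  estimates, on testing with \<open>v\<close> itself.\<close>

lemma norm_le_of_inner_le:
  fixes v :: "'a::real_inner"
  assumes "\<And>x. v \<bullet> x \<le> c * norm x" and c: "c \<ge> 0"
  shows "norm v \<le> c"
proof (cases "v = 0")
  case True
  with c show ?thesis by simp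
next
  case False
  have "norm v * norm v \<le> c * norm v"
    using assms(1)[of v] by (simp add: power2_norm_eq_inner[symmetric] power2_eq_square)
  with False show ?thesis by simp
qed

text \<open>\<open>adjoint\<close> is a choice, so its defining identity requires an existence
  proof: Riesz supplies one representing vector for each \<open>y\<close>.\<close>

lemma hilbert_adjoint:
  fixes f :: "'a::{real_inner, complete_space} \<Rightarrow> 'b::real_inner"
  assumes "bounded_linear f"
  shows "x \<bullet> adjoint f y = f x \<bullet> y"
proof -
  have "\<exists>v. \<forall>x. f x \<bullet> y = x \<bullet> v" for y
  proof -
    have "bounded_linear (\<lambda>x. f x \<bullet> y)"
      by (intro bounded_linear_compose[OF bounded_linear_inner_left assms])
    then obtain v where "\<forall>x. f x \<bullet> y = v \<bullet> x"
      using riesz_representation by blast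
    then show ?thesis by (intro exI[of _ v]) (simp add: inner_commute)
  qed
  then have "\<exists>g. \<forall>y x. f x \<bullet> y = x \<bullet> g y"
    by (intro choice) blast
  then have "\<exists>g. \<forall>x y. f x \<bullet> y = x \<bullet> g y"
    by blast
  then show ?thesis unfolding adjoint_def by (rule someI2_ex) auto
qed

lemma hilbert_adjoint_left:
  fixes f :: "'a::{real_inner, complete_space} \<Rightarrow> 'b::real_inner"
  assumes "bounded_linear f"
  shows "adjoint f y \<bullet> x = y \<bullet> f x"
  using hilbert_adjoint[OF assms, of x y] by (simp add: inner_commute[of "adjoint f y"] inner_commute[of y])

lemma hilbert_adjoint_norm_le:
  fixes f :: "'a::{real_inner, complete_space} \<Rightarrow> 'b::real_inner"
  assumes f: "bounded_linear f" and M: "\<And>x. norm (f x) \<le> M * norm x" "0 \<le> M"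
  shows "norm (adjoint f y) \<le> M * norm y"
proof (rule norm_le_of_inner_le)
  show "0 \<le> M * norm y" using M by simp
  fix x
  have "adjoint f y \<bullet> x = f x \<bullet> y"
    using hilbert_adjoint_left[OF f, of y x] by (simp add: inner_commute)
  also have "\<dots> \<le> norm (f x) * norm y" by (rule norm_cauchy_schwarz)
  also have "\<dots> \<le> (M * norm x) * norm y" by (intro mult_right_mono M) auto
  finally show "adjoint f y \<bullet> x \<le> M * norm y * norm x" by (simp add: ac_simps)
qed

lemma inner_ext: "(\<And>x. x \<bullet> a = x \<bullet> b) \<Longrightarrow> a = (b::'a::real_inner)"
proof -
  assume *: "\<And>x. x \<bullet> a = x \<bullet> b"
  have "(a - b) \<bullet> (a - b) = 0" using *[of "a - b"] by (simp add: inner_diff_right)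
  then show ?thesis by simp
qed

lemma hilbert_adjoint_linear:
  fixes f :: "'a::{real_inner, complete_space} \<Rightarrow> 'b::real_inner"
  assumes f: "bounded_linear f"
  shows "bounded_linear (adjoint f)"
proof -
  obtain K where K: "\<And>x. norm (f x) \<le> norm x * K" "0 \<le> K"
    using bounded_linear.nonneg_bounded[OF f] by blast
  show ?thesis
  proof (rule bounded_linear_intro)
    show "norm (adjoint f x) \<le> norm x * K" for x
      using hilbert_adjoint_norm_le[OF f, of K x] K by (simp add: mult.commute)
    show "adjoint f (x + y) = adjoint f x + adjoint f y" for x y
      by (rule inner_ext) (simp add: hilbert_adjoint[OF f] inner_add_right)
    show "adjoint f (r *\<^sub>R x) = r *\<^sub>R adjoint f x" for r x
      by (rule inner_ext) (simp add: hilbert_adjoint[OF f])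
  qed
qed

section \<open>Integration in a Hilbert space\<close>

text \<open>The sort \<open>{real_inner, complete_space}\<close> is not below \<open>banach\<close>, so existence results
  for integrals are pulled back along the Riesz isomorphism from the dual, which is.\<close>

definition riesz_map :: "('a::{real_inner, complete_space} \<Rightarrow>\<^sub>L real) \<Rightarrow> 'a" where
  "riesz_map f = (THE v. \<forall>x. f x = v \<bullet> x)"

lemma riesz_map: "blinfun_apply f x = riesz_map f \<bullet> x"
  unfolding riesz_map_def
  by (rule spec[OF theI'[OF riesz_representation[OF blinfun.bounded_linear_right]]])

lemma riesz_map_inner_left [simp]: "riesz_map (blinfun_inner_left v) = v"
proof (rule inner_ext)
  show "x \<bullet> riesz_map (blinfun_inner_left v) = x \<bullet> v" for x
    using riesz_map[of "blinfun_inner_left v" x] by (simp add: inner_commute)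
qed

lemma bounded_linear_riesz_map: "bounded_linear (riesz_map :: ('a::{real_inner, complete_space} \<Rightarrow>\<^sub>L real) \<Rightarrow> 'a)"
proof (rule bounded_linear_intro[where K = 1])
  show "norm (riesz_map f) \<le> norm f * 1" for f :: "'a \<Rightarrow>\<^sub>L real"
    using norm_blinfun[of f]
    by (intro norm_le_of_inner_le) (auto simp: riesz_map[symmetric] intro: order_trans[OF abs_ge_self])
  have rm: "x \<bullet> riesz_map f = blinfun_apply f x" for x and f :: "'a \<Rightarrow>\<^sub>L real"
    by (simp add: riesz_map inner_commute)
  show "riesz_map (f + g) = riesz_map f + riesz_map g" for f g :: "'a \<Rightarrow>\<^sub>L real"
    by (rule inner_ext) (simp add: rm inner_add_right blinfun.add_left)
  show "riesz_map (r *\<^sub>R f) = r *\<^sub>R riesz_map f" for r and f :: "'a \<Rightarrow>\<^sub>L real"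
    by (rule inner_ext) (simp add: rm blinfun.scaleR_left)
qed

lemma integrable_on_inner_left_blinfun:
  fixes f :: "real \<Rightarrow> 'a::{real_inner, complete_space}"
  assumes "(\<lambda>t. blinfun_inner_left (f t)) integrable_on S"
  shows "f integrable_on S"
  using integrable_linear[OF assms bounded_linear_riesz_map] by (simp add: o_def)

text \<open>Pairing with a fixed vector reduces the claim to monotonicity of real integrals.\<close>

lemma has_integral_norm_bound:
  fixes f :: "'b::euclidean_space \<Rightarrow> 'a::real_inner"
  assumes f: "(f has_integral y) S" and g: "(g has_integral c) S"
    and le: "\<And>t. t \<in> S \<Longrightarrow> norm (f t) \<le> g t"
  shows "norm y \<le> c"
proof -
  have "v \<bullet> y \<le> norm v * c" for v
  proof (rule has_integral_le)
    show "((\<lambda>t. v \<bullet> f t) has_integral v \<bullet> y) S"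
      using has_integral_linear[OF f bounded_linear_inner_right] by (simp add: o_def)
    show "((\<lambda>t. norm v * g t) has_integral norm v * c) S"
      using has_integral_mult_right[OF g] .
    show "v \<bullet> f t \<le> norm v * g t" if "t \<in> S" for t
      by (rule order_trans[OF norm_cauchy_schwarz]) (simp add: le that mult_left_mono)
  qed
  moreover have "0 \<le> c"
    by (rule has_integral_nonneg[OF g]) (use le norm_ge_zero order_trans in blast)
  ultimately show ?thesis
    by (intro norm_le_of_inner_le) (simp_all add: inner_commute[of y] mult.commute[of c])
qed

text \<open>Meant for the Laplace integrals of semigroup orbits. Continuity gives integrability on
  compact intervals and the exponential majorant extends it to the half-line; both steps take place
  after embedding into the dual, which does not increase norms.\<close>

lemma exp_bounded_integrable_half_line:
  fixes f :: "real \<Rightarrow> 'a::{real_inner, complete_space}"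
  assumes f: "continuous_on {0..} f" and a: "a > 0"
    and le: "\<And>t. t \<ge> 0 \<Longrightarrow> norm (f t) \<le> c * exp (- a * t)"
  shows "f integrable_on {0..}"
proof (rule integrable_on_inner_left_blinfun)
  show "(\<lambda>t. blinfun_inner_left (f t)) integrable_on {0..}"
  proof (rule integrable_on_all_intervals_integrable_bound)
    fix p q :: real
    have "(\<lambda>t. blinfun_inner_left (f t)) integrable_on {max p 0..q}"
      by (intro integrable_continuous_real bounded_linear.continuous_on[OF bounded_linear_blinfun_inner_left]
          continuous_on_subset[OF f]) auto
    moreover have "{0..} \<inter> cbox p q = {max p 0..q}" by auto
    ultimately show "(\<lambda>t. if t \<in> {0..} then blinfun_inner_left (f t) else 0) integrable_on cbox p q"
      using integrable_restrict_Int[of "{0..}" "\<lambda>t. blinfun_inner_left (f t)" "cbox p q"]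
      by (simp only: Int_commute)
  next
    fix t :: real assume "t \<in> {0..}"
    moreover have "norm (blinfun_inner_left (f t)) \<le> norm (f t)"
      by (intro norm_blinfun_bound) (auto simp: blinfun_inner_left.rep_eq Cauchy_Schwarz_ineq2 mult.commute)
    ultimately show "norm (blinfun_inner_left (f t)) \<le> c * exp (- a * t)"
      using le[of t] by simp
  next
    show "(\<lambda>t. c * exp (- a * t)) integrable_on {0..}"
      using has_integral_exp_minus_to_infinity[OF a, of 0] by (intro integrable_on_mult_right) blast
  qed
qed

section \<open>The gliding hump\<close>

text \<open>Of \<open>a + v\<close> and \<open>a - v\<close> one has norm at least
  \<open>norm v\<close>, since their difference is \<open>2 *\<^sub>R v\<close>. The right sign at
  \<open>n\<close> depends on the earlier signs only, so a recursion can choose it.\<close>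

lemma gliding_hump_signs:
  fixes f :: "nat \<Rightarrow> nat \<Rightarrow> 'b::real_normed_vector"
  shows "\<exists>\<sigma>. (\<forall>j. \<bar>\<sigma> j\<bar> = 1) \<and> (\<forall>n. norm (f n n) \<le> norm (\<Sum>j\<le>n. \<sigma> j *\<^sub>R f n j))"
proof -
  \<comment> \<open>Stage \<open>n\<close> changes only entry \<open>n\<close>, so the entries below
    \<open>n\<close> are final in \<open>sgs n\<close>; the actual sign is read off one stage
    later.\<close>
  define sgs where "sgs = rec_nat (\<lambda>_. 1::real) (\<lambda>n \<sigma>. \<sigma>(n :=
     (if norm (f n n) \<le> norm ((\<Sum>j<n. \<sigma> j *\<^sub>R f n j) + f n n) then 1 else - 1)))"
  define \<sigma> where "\<sigma> n = sgs (Suc n) n" for n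
  have stable: "sgs (m + k) j = sgs m j" if "j < m" for m k j
    using that by (induction k) (auto simp: sgs_def)
  have sg: "sgs n j = \<sigma> j" if "j < n" for n j
    using stable[of j "Suc j" "n - Suc j"] that by (simp add: \<sigma>_def)
  have s: "\<sigma> n = (if norm (f n n) \<le> norm ((\<Sum>j<n. \<sigma> j *\<^sub>R f n j) + f n n) then 1 else - 1)" for n
  proof -
    have "(\<Sum>j<n. sgs n j *\<^sub>R f n j) = (\<Sum>j<n. \<sigma> j *\<^sub>R f n j)" using sg by simp
    then show ?thesis by (simp add: \<sigma>_def sgs_def)
  qed
  have "norm (f n n) \<le> norm (\<Sum>j\<le>n. \<sigma> j *\<^sub>R f n j)" for n
  proof -
    let ?a = "\<Sum>j<n. \<sigma> j *\<^sub>R f n j"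
    have "2 *\<^sub>R f n n = (?a + f n n) - (?a - f n n)" by (simp add: scaleR_2)
    then have "2 * norm (f n n) \<le> norm (?a + f n n) + norm (?a - f n n)"
      by (metis abs_numeral norm_scaleR norm_triangle_ineq4)
    moreover have "(\<Sum>j\<le>n. \<sigma> j *\<^sub>R f n j) = ?a + \<sigma> n *\<^sub>R f n n"
      by (simp flip: lessThan_Suc_atMost)
    ultimately show ?thesis using s[of n] by (auto split: if_splits)
  qed
  moreover have "\<bar>\<sigma> j\<bar> = 1" for j using s[of j] by (auto split: if_splits)
  ultimately show ?thesis by blast
qed

lemma sum_third_powers: "(\<Sum>j\<in>{Suc n..m}. (1/3::real) ^ j) \<le> (1/3) ^ n / 2"
proof (cases "n \<le> m")
  case True
  then have "(\<Sum>j\<in>{Suc n..m}. (1/3::real) ^ j) + (1/3) ^ m / 2 = (1/3) ^ n / 2"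
    by (induction m rule: dec_induct) auto
  moreover have "(1/3::real) ^ m \<ge> 0" by simp
  ultimately show ?thesis by linarith
qed auto

text \<open>Think of \<open>f n j\<close> as the \<open>n\<close>-th functional, of norm
  \<open>c n\<close>, applied to the \<open>j\<close>-th hump, of size (1/3)^j. The signs protect
  the diagonal term, and all later humps together remove at most half of (1/3)^n c n. The fraction
  2/3 in \<open>diag\<close> may be anything strictly between 1/2 and 1: below 1 since a norm need
  not be attained, above 1/2 to beat the tail. What remains is a sixth of (1/3)^n c n, and
  \<open>c n \<ge> 4 ^ n\<close> makes it grow.\<close>

lemma gliding_hump:
  fixes f :: "nat \<Rightarrow> nat \<Rightarrow> 'b::real_normed_vector"
  assumes up: "\<And>n j. norm (f n j) \<le> (1/3) ^ j * c n"
    and diag: "\<And>n. norm (f n n) \<ge> 2/3 * (1/3) ^ n * c n" and c: "\<And>n. c n \<ge> 4 ^ n"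
  shows "\<exists>\<sigma>. (\<forall>j. \<bar>\<sigma> j\<bar> = 1) \<and> (\<forall>n m. n \<le> m \<longrightarrow> (4/3) ^ n / 6 \<le> norm (\<Sum>j\<le>m. \<sigma> j *\<^sub>R f n j))"
proof -
  obtain \<sigma> where \<sigma>: "\<And>j. \<bar>\<sigma> j\<bar> = 1" "\<And>n. norm (f n n) \<le> norm (\<Sum>j\<le>n. \<sigma> j *\<^sub>R f n j)"
    using gliding_hump_signs[of f] by blast
  have "(4/3) ^ n / 6 \<le> norm (\<Sum>j\<le>m. \<sigma> j *\<^sub>R f n j)" if "n \<le> m" for n m
  proof -
    have c0: "0 \<le> c n" using c[of n] by (smt (verit) zero_le_power)
    have "norm (\<Sum>j\<in>{Suc n..m}. \<sigma> j *\<^sub>R f n j) \<le> (\<Sum>j\<in>{Suc n..m}. (1/3) ^ j * c n)"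
      by (rule sum_norm_le) (simp add: \<sigma> up)
    also have "\<dots> \<le> (1/3) ^ n / 2 * c n"
      unfolding sum_distrib_right[symmetric] by (rule mult_right_mono[OF sum_third_powers c0])
    finally have tail: "norm (\<Sum>j\<in>{Suc n..m}. \<sigma> j *\<^sub>R f n j) \<le> (1/3) ^ n / 2 * c n" .
    have "{..m} = {..n} \<union> {Suc n..m}" using that by auto
    then have "(\<Sum>j\<le>m. \<sigma> j *\<^sub>R f n j) = (\<Sum>j\<le>n. \<sigma> j *\<^sub>R f n j) + (\<Sum>j\<in>{Suc n..m}. \<sigma> j *\<^sub>R f n j)"
      by (simp add: sum.union_disjoint)
    then have "2/3 * (1/3) ^ n * c n - (1/3) ^ n / 2 * c n \<le> norm (\<Sum>j\<le>m. \<sigma> j *\<^sub>R f n j)"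
      by (simp only:) (rule order_trans[OF diff_mono[OF order_trans[OF diag \<sigma>(2)] tail] norm_diff_ineq])
    also have "2/3 * (1/3) ^ n * c n - (1/3) ^ n / 2 * c n = (1/3) ^ n * c n / 6" by simp
    finally have "(1/3) ^ n * c n / 6 \<le> norm (\<Sum>j\<le>m. \<sigma> j *\<^sub>R f n j)" .
    moreover have "(1/3) ^ n * c n \<ge> (1/3) ^ n * 4 ^ n" by (intro mult_left_mono c) auto
    moreover have "(1/3) ^ n * 4 ^ n = (4/3::real) ^ n" by (simp add: power_mult_distrib[symmetric])
    ultimately show ?thesis by linarith
  qed
  with \<sigma>(1) show ?thesis by blast
qed

lemma four_thirds_unbounded: "\<exists>n. K < (4/3::real) ^ n / 6"
proof -
  obtain n where "6 * K < (4/3::real) ^ n" using real_arch_pow[of "4/3" "6 * K"] by auto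
  then show ?thesis by (intro exI[of _ n]) linarith
qed

text \<open>Were the norms unbounded, operators of norm above 4^n and nearly norming vectors of size
  (1/3)^n would give an absolutely convergent signed series at whose sum the family is
  unbounded.\<close>

lemma uniform_boundedness:
  fixes T :: "'i \<Rightarrow> 'a::{real_normed_vector, complete_space} \<Rightarrow> 'b::real_normed_vector"
  assumes lin: "\<And>i. i \<in> I \<Longrightarrow> bounded_linear (T i)"
    and ptw: "\<And>x. \<exists>K. \<forall>i\<in>I. norm (T i x) \<le> K"
  obtains K where "K \<ge> 0" "\<And>i x. i \<in> I \<Longrightarrow> norm (T i x) \<le> K * norm x"
proof -
  have "\<exists>N. \<forall>i\<in>I. onorm (T i) \<le> 4 ^ N"
  proof (rule ccontr)
    assume "\<not> ?thesis"
    then obtain i where iI: "\<And>n::nat. i n \<in> I" and big: "\<And>n. onorm (T (i n)) > 4 ^ n"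
      by (metis not_le)
    define c where "c n = onorm (T (i n))" for n
    have c: "c n > 4 ^ n" for n using big by (simp add: c_def)
    then have cpos: "c n > 0" for n by (smt (verit) zero_less_power)
    note blin = lin[OF iI]
    have "\<exists>v. norm v = (1/3) ^ n \<and> norm (T (i n) v) \<ge> 2/3 * (1/3) ^ n * c n" for n
    proof -
      \<comment> \<open>The norm need not be attained; a vector achieving two thirds of it exists
        because it is the least bound.\<close>
      have "\<exists>v. \<not> norm (T (i n) v) \<le> 2/3 * c n * norm v"
      proof (rule ccontr)
        assume "\<not> ?thesis"
        then have "onorm (T (i n)) \<le> 2/3 * c n" using cpos[of n] by (intro onorm_bound) auto
        then show False using cpos[of n] by (simp add: c_def)
      qed
      then obtain v where v: "norm (T (i n) v) > 2/3 * c n * norm v" by (auto simp: not_le)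
      then have v0: "v \<noteq> 0" using linear_0[OF bounded_linear.linear[OF blin, of n]] by auto
      define s where "s = (1/3) ^ n / norm v"
      have s: "s > 0" using v0 by (simp add: s_def)
      have "norm (T (i n) (s *\<^sub>R v)) = s * norm (T (i n) v)"
        using s by (simp add: linear_cmul[OF bounded_linear.linear[OF blin]])
      moreover have "s * norm (T (i n) v) \<ge> s * (2/3 * c n * norm v)"
        using v s by (intro mult_left_mono) auto
      moreover have "s * (2/3 * c n * norm v) = 2/3 * (1/3) ^ n * c n" using v0 by (simp add: s_def)
      moreover have "norm (s *\<^sub>R v) = (1/3) ^ n" using v0 by (simp add: s_def)
      ultimately show ?thesis by metis
    qed
    then obtain v where v: "\<And>n. norm (v n) = (1/3) ^ n" "\<And>n. norm (T (i n) (v n)) \<ge> 2/3 * (1/3) ^ n * c n"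
      by metis
    have "\<exists>\<sigma>. (\<forall>j. \<bar>\<sigma> j\<bar> = 1) \<and> (\<forall>n m. n \<le> m \<longrightarrow> (4/3) ^ n / 6 \<le> norm (\<Sum>j\<le>m. \<sigma> j *\<^sub>R T (i n) (v j)))"
    proof (rule gliding_hump[where c = c])
      show "norm (T (i n) (v j)) \<le> (1/3) ^ j * c n" for n j
        using onorm[OF blin, of n "v j"] by (simp add: v c_def mult.commute)
      show "4 ^ n \<le> c n" for n using c[of n] by simp
    qed (rule v(2))
    then obtain \<sigma> where \<sigma>: "\<And>j. \<bar>\<sigma> j\<bar> = 1"
      "\<And>n m. n \<le> m \<Longrightarrow> (4/3) ^ n / 6 \<le> norm (\<Sum>j\<le>m. \<sigma> j *\<^sub>R T (i n) (v j))" by blast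
    define X where "X m = (\<Sum>j\<le>m. \<sigma> j *\<^sub>R v j)" for m
    have Xd: "norm (X m - X n) \<le> (1/3) ^ n / 2" if "n \<le> m" for m n
    proof -
      have "{..m} = {..n} \<union> {Suc n..m}" using that by auto
      then have "X m - X n = (\<Sum>j\<in>{Suc n..m}. \<sigma> j *\<^sub>R v j)"
        by (simp add: sum.union_disjoint X_def)
      also have "norm \<dots> \<le> (\<Sum>j\<in>{Suc n..m}. (1/3) ^ j)"
        by (rule sum_norm_le) (simp add: v \<sigma>)
      finally show ?thesis using sum_third_powers[of n m] by linarith
    qed
    have "Cauchy X"
    proof (rule metric_CauchyI)
      fix e :: real assume "e > 0"
      then obtain N where N: "(1/3::real) ^ N < e" using real_arch_pow_inv[of e "1/3"] by auto
      have "norm (X m - X N) \<le> (1/3) ^ N / 2" if "m \<ge> N" for m by (rule Xd[OF that])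
      then show "\<exists>M. \<forall>m\<ge>M. \<forall>n\<ge>M. dist (X m) (X n) < e"
        using N by (intro exI[of _ N]) (smt (verit) dist_norm dist_triangle2 field_sum_of_halves)
    qed
    then obtain x where x: "X \<longlonglongrightarrow> x" using Cauchy_convergent convergent_def by blast
    obtain K where K: "\<And>j. j \<in> I \<Longrightarrow> norm (T j x) \<le> K" using ptw by blast
    have "(4/3) ^ n / 6 \<le> K" for n
    proof -
      have "(\<lambda>m. norm (T (i n) (X m))) \<longlonglongrightarrow> norm (T (i n) x)"
        by (intro tendsto_norm bounded_linear.tendsto[OF blin x])
      moreover have "(4/3) ^ n / 6 \<le> norm (T (i n) (X m))" if "m \<ge> n" for m
        using \<sigma>(2)[OF that] bounded_linear.linear[OF blin, of n]
        by (simp add: X_def linear_sum linear_cmul)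
      ultimately have "(4/3) ^ n / 6 \<le> norm (T (i n) x)"
        by (intro LIMSEQ_le_const) auto
      then show ?thesis using K[OF iI, of n] by linarith
    qed
    then show False using four_thirds_unbounded[of K] by (auto simp: not_less[symmetric])
  qed
  then obtain N where N: "\<And>i. i \<in> I \<Longrightarrow> onorm (T i) \<le> 4 ^ N" by blast
  show thesis
  proof (rule that[of "4 ^ N"])
    show "norm (T i x) \<le> 4 ^ N * norm x" if "i \<in> I" for i x
      using onorm[OF lin[OF that], of x] mult_right_mono[OF N[OF that], of "norm x"] by auto
  qed auto
qed


section \<open>Strongly continuous semigroups and their generators\<close>

lemma c0_semigroup_near_0:
  assumes "c0_semigroup S" "e > 0"
  obtains d where "d > 0" "\<And>h. 0 \<le> h \<Longrightarrow> h < d \<Longrightarrow> norm (S h x - x) < e"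
proof -
  have "((\<lambda>t. S t x) \<longlongrightarrow> x) (at_right 0)" and S0: "S 0 x = x"
    using assms by (auto simp: c0_semigroup_def)
  from this(1) have "\<forall>\<^sub>F h in at_right 0. dist (S h x) x < e" using assms(2) by (rule tendstoD)
  then obtain d where d: "d > 0" "\<And>h. h > 0 \<Longrightarrow> h < d \<Longrightarrow> dist (S h x) x < e"
    by (auto simp: eventually_at_right_field)
  show thesis
    by (rule that[OF d(1)]) (metis S0 assms(2) d(2) diff_self dist_norm norm_zero order_le_less)
qed

text \<open>Near 0 the orbits are bounded by continuity, so Banach-Steinhaus gives a uniform bound
  on some interval \<open>{0..d}\<close>. A time \<open>t\<close> is then reached by
  \<open>nat \<lfloor>t / d\<rfloor>\<close> steps of length \<open>d\<close> and a remainder, which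
  costs a power of \<open>K\<close>.\<close>

lemma c0_semigroup_bound:
  fixes S :: "real \<Rightarrow> 'h::{real_normed_vector, complete_space} \<Rightarrow> 'h"
  assumes S: "c0_semigroup S"
  obtains M \<omega> where "M \<ge> 1" "\<omega> \<ge> 0" "\<And>t x. t \<ge> 0 \<Longrightarrow> norm (S t x) \<le> M * exp (\<omega> * t) * norm x"
proof -
  have lin: "bounded_linear (S t)" if "t \<ge> 0" for t using S that by (auto simp: c0_semigroup_def)
  have add: "S (s + t) x = S s (S t x)" if "s \<ge> 0" "t \<ge> 0" for s t x
    using S that by (auto simp: c0_semigroup_def)
  have "\<exists>d>0. \<exists>K. \<forall>t\<in>{0..d}. \<forall>x. norm (S t x) \<le> K * norm x"
  proof (rule ccontr)
    assume "\<not> ?thesis"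
    then have "\<exists>t\<in>{0..1 / real (Suc n)}. \<exists>x. \<not> norm (S t x) \<le> real n * norm x" for n :: nat
      by (metis of_nat_0_less_iff zero_less_Suc zero_less_divide_1_iff)
    then obtain t where t: "\<And>n. t n \<in> {0..1 / real (Suc n)}"
      and big: "\<And>n. \<exists>x. \<not> norm (S (t n) x) \<le> real n * norm x" by metis
    have t0: "t n \<ge> 0" for n using t[of n] by simp
    have ptw: "\<exists>K. \<forall>n\<in>UNIV. norm (S (t n) x) \<le> K" for x
    proof -
      have "(\<lambda>n. S (t n) x) \<longlonglongrightarrow> x"
      proof (rule tendstoI)
        fix e :: real assume "e > 0"
        then obtain d where d: "d > 0" "\<And>h. 0 \<le> h \<Longrightarrow> h < d \<Longrightarrow> norm (S h x - x) < e"
          using c0_semigroup_near_0[OF S] by metis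
        have "\<forall>\<^sub>F n in sequentially. 1 / real (Suc n) < d"
          using order_tendstoD(2)[OF LIMSEQ_Suc[OF lim_1_over_n] d(1)] by simp
        then show "\<forall>\<^sub>F n in sequentially. dist (S (t n) x) x < e"
        proof eventually_elim
          case (elim n)
          then show ?case using t[of n] d(2)[of "t n"] by (simp add: dist_norm)
        qed
      qed
      then have "Bseq (\<lambda>n. S (t n) x)" by (intro convergent_imp_Bseq convergentI)
      then show ?thesis by (auto simp: Bseq_def)
    qed
    obtain K where K: "\<And>n x. norm (S (t n) x) \<le> K * norm x"
      using uniform_boundedness[of UNIV "\<lambda>n. S (t n)", OF lin[OF t0] ptw] by (metis UNIV_I)
    obtain n :: nat where "K \<le> real n" using real_arch_simple by blast
    then have "norm (S (t n) x) \<le> real n * norm x" for x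
      using K[of n x] mult_right_mono[of K "real n" "norm x"] by simp
    then show False using big[of n] by blast
  qed
  then obtain d K0 where d: "d > 0" and K0: "\<And>t x. t \<in> {0..d} \<Longrightarrow> norm (S t x) \<le> K0 * norm x"
    by blast
  \<comment> \<open>At least 1, so that \<open>ln K / d\<close> is a nonnegative rate and the number
    of steps may be rounded up to \<open>t / d\<close> in the exponent.\<close>
  define K where "K = max 1 K0"
  have K: "norm (S t x) \<le> K * norm x" if "t \<in> {0..d}" for t x
    using K0[OF that, of x] mult_right_mono[of K0 K "norm x"] by (simp add: K_def)
  have K1: "K \<ge> 1" by (simp add: K_def)
  have pow: "norm (S (real n * d) x) \<le> K ^ n * norm x" for n x
  proof (induction n arbitrary: x)
    case 0
    then show ?case using S by (simp add: c0_semigroup_def)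
  next
    case (Suc n)
    have "S (real (Suc n) * d) x = S (real n * d) (S d x)"
      using add[of "real n * d" d x] d by (simp add: algebra_simps)
    moreover have "norm (S (real n * d) (S d x)) \<le> K ^ n * norm (S d x)" by (rule Suc.IH)
    moreover have "K ^ n * norm (S d x) \<le> K ^ n * (K * norm x)"
      using K[of d x] d K1 by (intro mult_left_mono) auto
    ultimately show ?case by (simp add: algebra_simps)
  qed
  show thesis
  proof (rule that[of K "ln K / d"])
    fix t :: real and x assume t: "t \<ge> 0"
    define n where "n = nat \<lfloor>t / d\<rfloor>"
    define r where "r = t - real n * d"
    have n: "real n = \<lfloor>t / d\<rfloor>" using t d by (simp add: n_def)
    then have "real n \<le> t / d" "t / d < real n + 1" by linarith+
    then have r: "r \<in> {0..d}" using d by (auto simp: r_def field_simps)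
    have "norm (S t x) = norm (S (real n * d) (S r x))"
      using add[of "real n * d" r x] d r by (simp add: r_def)
    also have "\<dots> \<le> K ^ n * norm (S r x)" by (rule pow)
    also have "\<dots> \<le> K ^ n * (K * norm x)" using K[OF r] K1 by (intro mult_left_mono) auto
    also have "K ^ n = exp (ln K * real n)" using K1 by (simp add: exp_of_nat_mult mult.commute[of "ln K"])
    also have "exp (ln K * real n) * (K * norm x) \<le> exp (ln K * (t / d)) * (K * norm x)"
      using mult_left_mono[OF \<open>real n \<le> t / d\<close>, of "ln K"] K1 by (intro mult_right_mono) auto
    finally show "norm (S t x) \<le> K * exp (ln K / d * t) * norm x" by (simp add: algebra_simps)
  qed (use K1 d in auto)
qed

text \<open>The growth constants are fixed here so that all later bounds are built from them;
  \<open>\<omega>\<close> also says what a large index is, namely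
  \<open>real k \<ge> \<omega> + 1\<close>.\<close>

locale c0_generator =
  fixes A :: "'h::{real_inner, complete_space} unb_op" and S :: "real \<Rightarrow> 'h \<Rightarrow> 'h"
    and M \<omega> :: real
  assumes gen: "generates A S"
    and M: "M \<ge> 1" and \<omega>: "\<omega> \<ge> 0"
    and S_bound: "\<And>t x. t \<ge> 0 \<Longrightarrow> norm (S t x) \<le> M * exp (\<omega> * t) * norm x"
begin

lemma S_c0: "c0_semigroup S" using gen by (simp add: generates_def)
lemma S_linear: "t \<ge> 0 \<Longrightarrow> bounded_linear (S t)" using S_c0 by (simp add: c0_semigroup_def)
lemma S_0 [simp]: "S 0 x = x" using S_c0 by (simp add: c0_semigroup_def)
lemma S_add: "s \<ge> 0 \<Longrightarrow> t \<ge> 0 \<Longrightarrow> S (s + t) x = S s (S t x)"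
  using S_c0 by (simp add: c0_semigroup_def)
lemma S_swap: "s \<ge> 0 \<Longrightarrow> t \<ge> 0 \<Longrightarrow> S s (S t x) = S t (S s x)"
  using S_add[of s t x] S_add[of t s x] by (simp add: add.commute)

lemma S_bound_upto:
  assumes "0 \<le> t" "t \<le> T"
  shows "norm (S t x) \<le> M * exp (\<omega> * T) * norm x"
proof -
  have "M * exp (\<omega> * t) * norm x \<le> M * exp (\<omega> * T) * norm x"
    using M \<omega> assms by (intro mult_right_mono mult_left_mono) (auto intro: mult_left_mono)
  then show ?thesis using S_bound[OF assms(1), of x] by linarith
qed

text \<open>For two times the operator of the smaller one factors out of the difference, leaving
  continuity at 0 and a local bound; comparing in this order treats left and right limits
  alike.\<close>

lemma S_continuous: "continuous_on {0..} (\<lambda>t. S t x)"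
proof (rule continuous_on_iff[THEN iffD2], intro ballI allI impI)
  fix t e :: real assume t: "t \<in> {0..}" and e: "e > 0"
  define K where "K = M * exp (\<omega> * (t + 1))"
  have K: "K > 0" using M by (simp add: K_def)
  obtain d where d: "d > 0" "\<And>h. 0 \<le> h \<Longrightarrow> h < d \<Longrightarrow> norm (S h x - x) < e / K"
    using c0_semigroup_near_0[OF S_c0, of "e / K" x] e K by auto
  have *: "dist (S s x) (S r x) < e" if "0 \<le> s" "s \<le> r" "r - s < d" "s \<le> t + 1" for r s
  proof -
    have "S r x - S s x = S s (S (r - s) x - x)"
      using S_add[of s "r - s" x] that by (simp add: linear_diff[OF bounded_linear.linear[OF S_linear]])
    also have "norm \<dots> \<le> K * norm (S (r - s) x - x)"
      unfolding K_def by (rule S_bound_upto) (use that in auto)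
    also have "\<dots> < K * (e / K)" using d(2)[of "r - s"] that K by (intro mult_strict_left_mono) auto
    finally show ?thesis using K by (simp add: dist_norm norm_minus_commute)
  qed
  show "\<exists>d>0. \<forall>s\<in>{0..}. dist s t < d \<longrightarrow> dist (S s x) (S t x) < e"
  proof (intro exI[of _ "min d 1"] conjI ballI impI)
    fix s :: real assume s: "s \<in> {0..}" "dist s t < min d 1"
    show "dist (S s x) (S t x) < e"
    proof (cases "s \<le> t")
      case True
      then show ?thesis using *[of s t] s by (auto simp: dist_real_def)
    next
      case False
      then have "dist (S t x) (S s x) < e" using *[of t s] s t by (auto simp: dist_real_def)
      then show ?thesis by (simp add: dist_commute)
    qed
  qed (use d in auto)
qed

section \<open>The operators J_k as Laplace transforms of the semigroup\<close>

lemma yosida_has_integral: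
  assumes "real k > \<omega>"
  shows "((\<lambda>s. exp (- (real k * s)) *\<^sub>R S s x) has_integral (yosida S k x /\<^sub>R real k)) {0..}"
proof -
  have "(\<lambda>s. exp (- (real k * s)) *\<^sub>R S s x) integrable_on {0..}"
  proof (rule exp_bounded_integrable_half_line)
    show "continuous_on {0..} (\<lambda>s. exp (- (real k * s)) *\<^sub>R S s x)"
      by (intro continuous_intros S_continuous)
    show "real k - \<omega> > 0" using assms by simp
    fix t :: real assume "t \<ge> 0"
    then have "exp (- (real k * t)) * norm (S t x) \<le> exp (- (real k * t)) * (M * exp (\<omega> * t) * norm x)"
      by (intro mult_left_mono S_bound) auto
    also have "\<dots> = M * norm x * exp (- (real k - \<omega>) * t)" by (simp add: algebra_simps flip: exp_add)
    finally show "norm (exp (- (real k * t)) *\<^sub>R S t x) \<le> M * norm x * exp (- (real k - \<omega>) * t)"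
      by simp
  qed
  then show ?thesis using assms \<omega> by (simp add: yosida_def has_integral_integral[symmetric])
qed

lemma yosida_unique:
  assumes "real k > \<omega>" "((\<lambda>s. exp (- (real k * s)) *\<^sub>R S s x) has_integral y) {0..}"
  shows "yosida S k x = real k *\<^sub>R y"
  using assms \<omega> has_integral_unique[OF yosida_has_integral[OF assms(1)] assms(2)] by auto

lemma yosida_norm_raw:
  assumes k: "real k > \<omega>"
  shows "norm (yosida S k x) \<le> M * norm x * (real k / (real k - \<omega>))"
proof -
  have "norm (yosida S k x /\<^sub>R real k) \<le> M * norm x * (exp (- (real k - \<omega>) * 0) / (real k - \<omega>))"
  proof (rule has_integral_norm_bound[OF yosida_has_integral[OF k]
      has_integral_mult_right[OF has_integral_exp_minus_to_infinity]])
    fix t :: real assume "t \<in> {0..}"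
    then have "exp (- (real k * t)) * norm (S t x) \<le> exp (- (real k * t)) * (M * exp (\<omega> * t) * norm x)"
      by (intro mult_left_mono S_bound) auto
    also have "\<dots> = M * norm x * exp (- (real k - \<omega>) * t)" by (simp add: algebra_simps flip: exp_add)
    finally show "norm (exp (- (real k * t)) *\<^sub>R S t x) \<le> M * norm x * exp (- (real k - \<omega>) * t)"
      by simp
  qed (use k in simp)
  then show ?thesis using k \<omega> by (simp add: field_simps)
qed

text \<open>Bounds every J_k of index at least \<open>\<omega> + 1\<close> simultaneously: there
  \<open>real k / (real k - \<omega>)\<close> is at most \<open>1 + \<omega>\<close>.\<close>

definition L where "L = M * (1 + \<omega>)"

lemma L_ge_1: "L \<ge> 1"
  using M \<omega> mult_mono[of 1 M 1 "1 + \<omega>"] by (simp add: L_def)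

lemma yosida_norm:
  assumes k: "real k \<ge> \<omega> + 1"
  shows "norm (yosida S k x) \<le> L * norm x"
proof -
  have "0 \<le> \<omega> * (real k - \<omega> - 1)" using k \<omega> by simp
  then have "real k / (real k - \<omega>) \<le> 1 + \<omega>" using k by (simp add: field_simps)
  then have "M * norm x * (real k / (real k - \<omega>)) \<le> M * norm x * (1 + \<omega>)"
    using M by (intro mult_left_mono) auto
  then show ?thesis using yosida_norm_raw[of k x] k by (simp add: L_def algebra_simps)
qed

lemma yosida_linear:
  assumes k: "real k \<ge> \<omega> + 1"
  shows "bounded_linear (yosida S k)"
proof (rule bounded_linear_intro)
  have k': "real k > \<omega>" "real k > 0" using k \<omega> by linarith+
  show "norm (yosida S k x) \<le> norm x * L" for x using yosida_norm[OF k] by (simp add: mult.commute)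
  show "yosida S k (x + y) = yosida S k x + yosida S k y" for x y
  proof -
    have "((\<lambda>s. exp (- (real k * s)) *\<^sub>R S s (x + y)) has_integral
        (yosida S k x /\<^sub>R real k + yosida S k y /\<^sub>R real k)) {0..}"
      by (rule has_integral_eq[OF _ has_integral_add[OF yosida_has_integral yosida_has_integral]])
        (use k' in \<open>auto simp: linear_add[OF bounded_linear.linear[OF S_linear]] scaleR_add_right\<close>)
    from yosida_unique[OF k'(1) this] show ?thesis using k' by (simp add: scaleR_add_right)
  qed
  show "yosida S k (r *\<^sub>R x) = r *\<^sub>R yosida S k x" for r x
  proof -
    have "((\<lambda>s. exp (- (real k * s)) *\<^sub>R S s (r *\<^sub>R x)) has_integral
        (r *\<^sub>R (yosida S k x /\<^sub>R real k))) {0..}"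
      by (rule has_integral_eq[OF _ has_integral_cmul[OF yosida_has_integral]])
        (use k' in \<open>auto simp: linear_cmul[OF bounded_linear.linear[OF S_linear]]\<close>)
    from yosida_unique[OF k'(1) this] show ?thesis using k' by simp
  qed
qed

lemma yosida_S:
  assumes k: "real k \<ge> \<omega> + 1" and t: "t \<ge> 0"
  shows "S t (yosida S k x) = yosida S k (S t x)"
proof -
  have k': "real k > \<omega>" "real k > 0" using k \<omega> by linarith+
  have "((\<lambda>s. exp (- (real k * s)) *\<^sub>R S s (S t x)) has_integral S t (yosida S k x /\<^sub>R real k)) {0..}"
    by (rule has_integral_eq[OF _ has_integral_linear[OF yosida_has_integral[OF k'(1)] S_linear[OF t]]])
      (use t in \<open>auto simp: linear_cmul[OF bounded_linear.linear[OF S_linear]] S_swap[of _ t]\<close>)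
  from yosida_unique[OF k'(1) this] show ?thesis
    using k' t by (simp add: linear_cmul[OF bounded_linear.linear[OF S_linear]])
qed

text \<open>Translation and splitting are done on compact intervals, so the half-line integral is
  turned into a limit. The endpoint \<open>real n + h\<close> is the one that a shift by
  \<open>h\<close> produces in \<open>S_yosida_inner\<close>.\<close>

lemma yosida_inner_tendsto:
  assumes k: "real k \<ge> \<omega> + 1" and h: "h \<ge> 0"
  shows "(\<lambda>n. integral {0..real n + h} (\<lambda>s. exp (- (real k * s)) * (S s x \<bullet> \<phi>)))
    \<longlonglongrightarrow> (yosida S k x \<bullet> \<phi>) / real k"
proof -
  let ?f = "\<lambda>s. exp (- (real k * s)) * (S s x \<bullet> \<phi>)"
  have k': "real k > \<omega>" "real k > 0" using k \<omega> by linarith+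
  have f: "(?f has_integral ((yosida S k x \<bullet> \<phi>) / real k)) {0..}"
    using has_integral_linear[OF yosida_has_integral[OF k'(1), of x] bounded_linear_inner_left[of \<phi>]]
    by (simp add: o_def divide_inverse_commute)
  have cont: "continuous_on {0..} ?f" by (intro continuous_intros S_continuous)
  have bound: "\<bar>?f t\<bar> \<le> M * norm x * norm \<phi> * exp (- (real k - \<omega>) * t)" if "t \<ge> 0" for t
  proof -
    have "\<bar>?f t\<bar> \<le> exp (- (real k * t)) * (norm (S t x) * norm \<phi>)"
      by (simp add: abs_mult Cauchy_Schwarz_ineq2)
    also have "\<dots> \<le> exp (- (real k * t)) * ((M * exp (\<omega> * t) * norm x) * norm \<phi>)"
      using that by (intro mult_left_mono mult_right_mono S_bound) auto
    also have "\<dots> = M * norm x * norm \<phi> * exp (- (real k - \<omega>) * t)" by (simp add: algebra_simps flip: exp_add)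
    finally show ?thesis .
  qed
  define c where "c = M * norm x * norm \<phi>"
  have "\<bar>(yosida S k x \<bullet> \<phi>) / real k - integral {0..real n + h} ?f\<bar> \<le>
      c * (exp (- (real k - \<omega>) * (real n + h)) / (real k - \<omega>))" for n
  proof -
    have "?f integrable_on {0..real n + h}"
      by (intro integrable_continuous_real continuous_on_subset[OF cont]) auto
    moreover have "{0..} - {0..real n + h} = {real n + h<..}" using h by auto
    ultimately have "(?f has_integral ((yosida S k x \<bullet> \<phi>) / real k - integral {0..real n + h} ?f)) {real n + h<..}"
      using has_integral_setdiff[OF f integrable_integral, of "{0..real n + h}"] by auto
    moreover have "{t \<in> {real n + h..} - {real n + h<..}. ?f t \<noteq> 0} \<subseteq> {real n + h}" by auto
    ultimately have "(?f has_integral ((yosida S k x \<bullet> \<phi>) / real k - integral {0..real n + h} ?f)) {real n + h..}"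
      by (subst has_integral_spike_set_eq[of _ "{real n + h<..}"])
        (auto intro: negligible_subset[of "{real n + h}"])
    then have "norm ((yosida S k x \<bullet> \<phi>) / real k - integral {0..real n + h} ?f) \<le>
      c * (exp (- (real k - \<omega>) * (real n + h)) / (real k - \<omega>))"
      by (rule has_integral_norm_bound[OF _ has_integral_mult_right[OF has_integral_exp_minus_to_infinity]])
        (use k' h bound in \<open>auto simp: c_def\<close>)
    then show ?thesis by simp
  qed
  then have est: "norm (integral {0..real n + h} ?f - (yosida S k x \<bullet> \<phi>) / real k) \<le>
      c * (exp (- (real k - \<omega>) * (real n + h)) / (real k - \<omega>))" for n
    by (simp add: abs_minus_commute)
  have "(\<lambda>n. c * (exp (- (real k - \<omega>) * (real n + h)) / (real k - \<omega>))) \<longlonglongrightarrow> 0"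
    using k'(1) by real_asymp
  then show ?thesis
    by (rule Lim_null_comparison[THEN LIM_zero_cancel, rotated]) (use est in auto)
qed

text \<open>The explicit formula below makes \<open>h \<mapsto> S h (yosida S k x)\<close> differentiable, by the
  fundamental theorem of calculus.\<close>

lemma S_yosida_inner:
  assumes k: "real k \<ge> \<omega> + 1" and h: "h \<ge> 0"
  shows "S h (yosida S k x) \<bullet> \<phi> = exp (real k * h) *
    (yosida S k x \<bullet> \<phi> - real k * integral {0..h} (\<lambda>s. exp (- (real k * s)) * (S s x \<bullet> \<phi>)))"
proof -
  let ?f = "\<lambda>x s. exp (- (real k * s)) * (S s x \<bullet> \<phi>)"
  have k0: "real k > 0" using k \<omega> by linarith
  have cont: "continuous_on {0..} (?f x)" for x by (intro continuous_intros S_continuous)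
  have int: "?f x integrable_on {a..b}" if "a \<ge> 0" for x a b
    by (intro integrable_continuous_real continuous_on_subset[OF cont]) (use that in auto)
  have "integral {0..real n} (?f (S h x)) =
      exp (real k * h) * (integral {0..real n + h} (?f x) - integral {0..h} (?f x))" for n
  proof -
    \<comment> \<open>By the semigroup law the integrand is a translate, up to the factor
      \<open>exp (real k * h)\<close> that the weight picks up under translation.\<close>
    have "integral {0..real n} (?f (S h x)) = integral {0..real n} (\<lambda>s. exp (real k * h) * ?f x (s + h))"
      by (rule integral_cong)
        (use h in \<open>auto simp: S_add algebra_simps simp flip: exp_add\<close>)
    also have "\<dots> = exp (real k * h) * integral {0..real n} (\<lambda>s. ?f x (s + h))" by simp
    also have "integral {0..real n} (\<lambda>s. ?f x (s + h)) = integral {h..real n + h} (?f x)"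
      using integral_shift_real_ivl[of h h "real n + h" "?f x"] by simp
    also have "\<dots> = integral {0..real n + h} (?f x) - integral {0..h} (?f x)"
      using Henstock_Kurzweil_Integration.integral_combine[of 0 h "real n + h" "?f x"] h int[of 0] by simp
    finally show ?thesis .
  qed
  moreover have "(\<lambda>n. exp (real k * h) * (integral {0..real n + h} (?f x) - integral {0..h} (?f x)))
      \<longlonglongrightarrow> exp (real k * h) * ((yosida S k x \<bullet> \<phi>) / real k - integral {0..h} (?f x))"
    by (intro tendsto_intros yosida_inner_tendsto k h)
  moreover have "(\<lambda>n. integral {0..real n} (?f (S h x))) \<longlonglongrightarrow> (yosida S k (S h x) \<bullet> \<phi>) / real k"
    using yosida_inner_tendsto[OF k, of 0 "S h x" \<phi>] by simp
  ultimately have "(yosida S k (S h x) \<bullet> \<phi>) / real k =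
      exp (real k * h) * ((yosida S k x \<bullet> \<phi>) / real k - integral {0..h} (?f x))"
    by (simp add: LIMSEQ_unique)
  then show ?thesis using k0 by (simp add: yosida_S[OF k h] field_simps)
qed

text \<open>\<open>S_yosida_inner\<close> is a weak identity, whereas the generator is defined by a
  norm limit. The remainder estimate is uniform in the test vector, which upgrades weak to
  strong.\<close>

lemma S_yosida_quotient:
  assumes k: "real k \<ge> \<omega> + 1"
  shows "((\<lambda>h. (S h (yosida S k x) - yosida S k x) /\<^sub>R h) \<longlongrightarrow> real k *\<^sub>R (yosida S k x - x)) (at_right 0)"
proof -
  let ?J = "yosida S k x"
  \<comment> \<open>What is left when the integral over \<open>{0..h}\<close> in
    \<open>S_yosida_inner\<close> is replaced by its first-order value
    \<open>h * (x \<bullet> \<phi>)\<close>.\<close>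
  define r where "r h = S h ?J - exp (real k * h) *\<^sub>R (?J - (real k * h) *\<^sub>R x)" for h
  have k0: "real k > 0" using k \<omega> by linarith
  have rh: "norm (r h) \<le> exp (real k * h) * real k * h * e"
    if h: "h \<ge> 0" and e: "\<And>s. 0 \<le> s \<Longrightarrow> s \<le> h \<Longrightarrow> norm (exp (- (real k * s)) *\<^sub>R S s x - x) \<le> e" for h e
  proof (rule norm_le_of_inner_le)
    have e0: "e \<ge> 0" using e[of 0] h by simp
    then show "0 \<le> exp (real k * h) * real k * h * e" using h by simp
    fix \<phi>
    let ?f = "\<lambda>s. exp (- (real k * s)) * (S s x \<bullet> \<phi>)"
    have int: "?f integrable_on {0..h}"
      by (intro integrable_continuous_real continuous_on_subset[OF S_continuous] continuous_intros) auto
    have "integral {0..h} (\<lambda>s. x \<bullet> \<phi> - ?f s) \<le> integral {0..h} (\<lambda>s. e * norm \<phi>)"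
    proof (rule integral_le)
      show "x \<bullet> \<phi> - ?f s \<le> e * norm \<phi>" if "s \<in> {0..h}" for s
      proof -
        have "x \<bullet> \<phi> - ?f s = (x - exp (- (real k * s)) *\<^sub>R S s x) \<bullet> \<phi>" by (simp add: inner_diff_left)
        also have "\<dots> \<le> norm (x - exp (- (real k * s)) *\<^sub>R S s x) * norm \<phi>" by (rule norm_cauchy_schwarz)
        also have "\<dots> \<le> e * norm \<phi>"
          using e[of s] that by (intro mult_right_mono) (auto simp: norm_minus_commute)
        finally show ?thesis .
      qed
    qed (use int in \<open>auto intro: integrable_diff\<close>)
    then have "h * (x \<bullet> \<phi>) - integral {0..h} ?f \<le> h * (e * norm \<phi>)"
      using Henstock_Kurzweil_Integration.integral_diff[OF integrable_const_ivl int, of "x \<bullet> \<phi>"] h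
      by (simp add: mult.left_commute)
    then have "exp (real k * h) * real k * (h * (x \<bullet> \<phi>) - integral {0..h} ?f) \<le>
        exp (real k * h) * real k * (h * (e * norm \<phi>))"
      by (intro mult_left_mono) auto
    moreover have "r h \<bullet> \<phi> = exp (real k * h) * real k * (h * (x \<bullet> \<phi>) - integral {0..h} ?f)"
      by (simp add: r_def inner_diff_left S_yosida_inner[OF k h] algebra_simps)
    ultimately show "r h \<bullet> \<phi> \<le> exp (real k * h) * real k * h * e * norm \<phi>" by (simp add: algebra_simps)
  qed
  have r0: "((\<lambda>h. r h /\<^sub>R h) \<longlongrightarrow> 0) (at_right 0)"
  proof (rule tendstoI)
    fix e :: real assume e: "e > 0"
    \<comment> \<open>Chosen to leave \<open>e / 2\<close> after \<open>h < 1\<close> has been used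
      to bound the exponential by \<open>exp (real k)\<close>.\<close>
    define e' where "e' = e / (2 * exp (real k) * real k)"
    have e': "e' > 0" using e k0 by (simp add: e'_def)
    have "continuous_on {0..} (\<lambda>s. exp (- (real k * s)) *\<^sub>R S s x)"
      by (intro continuous_intros S_continuous)
    then obtain d where d: "d > 0" "\<And>s. s \<ge> 0 \<Longrightarrow> s < d \<Longrightarrow> norm (exp (- (real k * s)) *\<^sub>R S s x - x) < e'"
      using e' unfolding continuous_on_iff
      by (drule_tac x = 0 in bspec) (auto simp: dist_norm)
    have "norm (r h /\<^sub>R h) < e" if "h > 0" "h < min d 1" for h
    proof -
      have "norm (r h) \<le> exp (real k * h) * real k * h * e'"
        using d(2) that by (intro rh) (auto intro: less_imp_le)
      then have "norm (r h /\<^sub>R h) \<le> exp (real k * h) * real k * e'"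
        using that by (simp add: field_simps)
      also have "\<dots> \<le> exp (real k) * real k * e'"
        using that k0 e' by (intro mult_right_mono) auto
      also have "\<dots> = e / 2" using k0 by (simp add: e'_def)
      finally show ?thesis using e by simp
    qed
    then show "\<forall>\<^sub>F h in at_right 0. dist (r h /\<^sub>R h) 0 < e"
      using d(1) by (auto simp: eventually_at_right_field intro!: exI[of _ "min d 1"])
  qed
  have "((\<lambda>h. ((exp (real k * h) - 1) / h) *\<^sub>R ?J - (real k * exp (real k * h)) *\<^sub>R x + r h /\<^sub>R h)
     \<longlongrightarrow> real k *\<^sub>R ?J - (real k * exp (real k * 0)) *\<^sub>R x + 0) (at_right 0)"
  proof (intro tendsto_add tendsto_diff tendsto_scaleR tendsto_const r0)
    show "((\<lambda>h. (exp (real k * h) - 1) / h) \<longlongrightarrow> real k) (at_right 0)" by real_asymp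
    show "((\<lambda>h. real k * exp (real k * h)) \<longlongrightarrow> real k * exp (real k * 0)) (at_right 0)" by real_asymp
  qed
  then have "((\<lambda>h. ((exp (real k * h) - 1) / h) *\<^sub>R ?J - (real k * exp (real k * h)) *\<^sub>R x + r h /\<^sub>R h)
     \<longlongrightarrow> real k *\<^sub>R (?J - x)) (at_right 0)" by (simp add: scaleR_diff_right)
  then show ?thesis
  proof (rule Lim_transform_eventually)
    have "((exp (real k * h) - 1) / h) *\<^sub>R ?J - (real k * exp (real k * h)) *\<^sub>R x + r h /\<^sub>R h
        = (S h ?J - ?J) /\<^sub>R h" if "h > 0" for h
      using that by (simp add: r_def algebra_simps divide_inverse)
    then show "\<forall>\<^sub>F h in at_right 0. ((exp (real k * h) - 1) / h) *\<^sub>R ?J - (real k * exp (real k * h)) *\<^sub>R x + r h /\<^sub>R h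
        = (S h ?J - ?J) /\<^sub>R h"
      by (auto simp: eventually_at_right_field intro!: exI[of _ 1])
  qed
qed

lemma dom_iff: "x \<in> op_dom A \<longleftrightarrow> (\<exists>y. ((\<lambda>h. (S h x - x) /\<^sub>R h) \<longlongrightarrow> y) (at_right 0))"
  using gen by (auto simp: generates_def)

lemma A_limit: "x \<in> op_dom A \<Longrightarrow> ((\<lambda>h. (S h x - x) /\<^sub>R h) \<longlongrightarrow> op_app A x) (at_right 0)"
  using gen by (auto simp: generates_def)

lemma A_eqI:
  assumes "((\<lambda>h. (S h x - x) /\<^sub>R h) \<longlongrightarrow> y) (at_right 0)"
  shows "x \<in> op_dom A" "op_app A x = y"
proof -
  show "x \<in> op_dom A" using assms dom_iff by blast
  then show "op_app A x = y" using tendsto_unique[OF _ A_limit assms] by simp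
qed

lemma yosida_dom: "real k \<ge> \<omega> + 1 \<Longrightarrow> yosida S k x \<in> op_dom A"
  and A_yosida: "real k \<ge> \<omega> + 1 \<Longrightarrow> op_app A (yosida S k x) = real k *\<^sub>R (yosida S k x - x)"
  using A_eqI[OF S_yosida_quotient] by auto

text \<open>\<open>F\<close> passes through the difference quotients. It is applied to J_k, to
  \<open>S t\<close>, and to the zero map, which yields \<open>op_app A 0 = 0\<close>.\<close>

lemma A_image_bounded_linear:
  assumes F: "bounded_linear F" and comm: "\<And>t x. t \<ge> 0 \<Longrightarrow> S t (F x) = F (S t x)"
    and x: "x \<in> op_dom A"
  shows "F x \<in> op_dom A" "op_app A (F x) = F (op_app A x)"
proof -
  have "((\<lambda>h. F ((S h x - x) /\<^sub>R h)) \<longlongrightarrow> F (op_app A x)) (at_right 0)"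
    by (rule bounded_linear.tendsto[OF F A_limit[OF x]])
  then have "((\<lambda>h. (S h (F x) - F x) /\<^sub>R h) \<longlongrightarrow> F (op_app A x)) (at_right 0)"
  proof (rule Lim_transform_eventually)
    have "F ((S h x - x) /\<^sub>R h) = (S h (F x) - F x) /\<^sub>R h" if "h > 0" for h
      using that bounded_linear.linear[OF F] by (simp add: linear_cmul linear_diff comm)
    then show "\<forall>\<^sub>F h in at_right 0. F ((S h x - x) /\<^sub>R h) = (S h (F x) - F x) /\<^sub>R h"
      by (auto simp: eventually_at_right_field intro!: exI[of _ 1])
  qed
  from A_eqI[OF this] show "F x \<in> op_dom A" "op_app A (F x) = F (op_app A x)" by auto
qed

lemma yosida_A:
  assumes "real k \<ge> \<omega> + 1" "x \<in> op_dom A"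
  shows "yosida S k (op_app A x) = real k *\<^sub>R (yosida S k x - x)"
  using A_image_bounded_linear(2)[OF yosida_linear[OF assms(1)] yosida_S[OF assms(1)] assms(2)]
  by (simp add: A_yosida assms)

text \<open>The weights \<open>real k * exp (- (real k * s))\<close> form an approximate identity at
  0. Instead of splitting the integral at \<open>d\<close>, the deviation is majorised on the whole
  half-line: beyond \<open>d\<close> the factor \<open>s / d\<close> is at least 1, and
  \<open>s * exp (\<omega> * s)\<close> is at most a difference of two exponentials. Their Laplace
  transforms, times \<open>real k\<close>, both tend to 1, so the excess over \<open>e / 2\<close>
  vanishes.\<close>

lemma yosida_tendsto: "(\<lambda>k. yosida S k x) \<longlonglongrightarrow> x"
proof (rule tendstoI)
  fix e :: real assume e: "e > 0"
  obtain d where d: "d > 0" "\<And>h. 0 \<le> h \<Longrightarrow> h < d \<Longrightarrow> norm (S h x - x) < e / 2"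
    using c0_semigroup_near_0[OF S_c0, of "e / 2" x] e by auto
  define c where "c = (M + 1) * norm x / d"
  have c0: "c \<ge> 0" using M d by (simp add: c_def)
  have S_est: "norm (S s x - x) \<le> e / 2 + c * (exp ((\<omega> + 1) * s) - exp (\<omega> * s))" if s: "s \<ge> 0" for s
  proof -
    have ex: "s * exp (\<omega> * s) \<le> exp ((\<omega> + 1) * s) - exp (\<omega> * s)"
    proof -
      have "(1 + s) * exp (\<omega> * s) \<le> exp s * exp (\<omega> * s)"
        by (intro mult_right_mono exp_ge_add_one_self) auto
      then show ?thesis by (simp add: algebra_simps flip: exp_add)
    qed
    then have pos: "0 \<le> c * (exp ((\<omega> + 1) * s) - exp (\<omega> * s))"
      using c0 mult_nonneg_nonneg[OF s exp_ge_zero, of "\<omega> * s"] by (intro mult_nonneg_nonneg) linarith+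
    show ?thesis
    proof (cases "s < d")
      case True
      then show ?thesis using d(2)[of s] s pos by linarith
    next
      case False
      have "norm (S s x - x) \<le> norm (S s x) + norm x" by (rule norm_triangle_ineq4)
      also have "\<dots> \<le> M * exp (\<omega> * s) * norm x + exp (\<omega> * s) * norm x"
        using S_bound[OF s, of x] \<omega> s mult_right_mono[of 1 "exp (\<omega> * s)" "norm x"] by simp
      also have "\<dots> = (M + 1) * norm x * exp (\<omega> * s) * 1" by (simp add: algebra_simps)
      also have "\<dots> \<le> (M + 1) * norm x * exp (\<omega> * s) * (s / d)"
        using False d M by (intro mult_left_mono) auto
      also have "\<dots> = c * (s * exp (\<omega> * s))" by (simp add: c_def)
      also have "\<dots> \<le> c * (exp ((\<omega> + 1) * s) - exp (\<omega> * s))" by (intro mult_left_mono ex c0)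
      finally show ?thesis using e by linarith
    qed
  qed
  have est: "norm (yosida S k x - x) \<le>
      e / 2 + c * (real k / (real k - (\<omega> + 1)) - real k / (real k - \<omega>))"
    if k: "real k > \<omega> + 1" for k
  proof -
    have k': "real k > \<omega>" "real k > 0" using k \<omega> by linarith+
    have E: "((\<lambda>s. exp (- (real k - b) * s)) has_integral 1 / (real k - b)) {0..}" if "b < real k" for b
      using has_integral_exp_minus_to_infinity[of "real k - b" 0] that by simp
    have "((\<lambda>s. exp (- (real k * s))) has_integral (1 / real k)) {0..}" using E[of 0] k' by simp
    from has_integral_linear[OF this bounded_linear_scaleR_left[of x]]
    have "((\<lambda>s. exp (- (real k * s)) *\<^sub>R x) has_integral ((1 / real k) *\<^sub>R x)) {0..}"
      by (simp add: o_def)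
    from has_integral_diff[OF yosida_has_integral[OF k'(1)] this]
    have "((\<lambda>s. exp (- (real k * s)) *\<^sub>R (S s x - x)) has_integral (yosida S k x - x) /\<^sub>R real k) {0..}"
      by (simp add: scaleR_diff_right divide_inverse)
    moreover have "((\<lambda>s. e / 2 * exp (- (real k - 0) * s) +
        c * (exp (- (real k - (\<omega> + 1)) * s) - exp (- (real k - \<omega>) * s))) has_integral
        e / 2 * (1 / (real k - 0)) + c * (1 / (real k - (\<omega> + 1)) - 1 / (real k - \<omega>))) {0..}"
      by (intro has_integral_add has_integral_mult_right has_integral_diff E) (use k k' in auto)
    ultimately have "norm ((yosida S k x - x) /\<^sub>R real k) \<le>
      e / 2 * (1 / (real k - 0)) + c * (1 / (real k - (\<omega> + 1)) - 1 / (real k - \<omega>))"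
    proof (rule has_integral_norm_bound)
      fix s :: real assume s: "s \<in> {0..}"
      have "norm (exp (- (real k * s)) *\<^sub>R (S s x - x)) = exp (- (real k * s)) * norm (S s x - x)" by simp
      also have "\<dots> \<le> exp (- (real k * s)) * (e / 2 + c * (exp ((\<omega> + 1) * s) - exp (\<omega> * s)))"
        using s by (intro mult_left_mono S_est) auto
      also have "\<dots> = e / 2 * exp (- (real k - 0) * s) +
        c * (exp (- (real k - (\<omega> + 1)) * s) - exp (- (real k - \<omega>) * s))"
        by (simp add: algebra_simps flip: exp_add)
      finally show "norm (exp (- (real k * s)) *\<^sub>R (S s x - x)) \<le> e / 2 * exp (- (real k - 0) * s) +
        c * (exp (- (real k - (\<omega> + 1)) * s) - exp (- (real k - \<omega>) * s))" .
    qed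
    then have "real k * norm ((yosida S k x - x) /\<^sub>R real k) \<le>
      real k * (e / 2 * (1 / (real k - 0)) + c * (1 / (real k - (\<omega> + 1)) - 1 / (real k - \<omega>)))"
      using k' by (intro mult_left_mono) auto
    moreover have "real k * norm ((yosida S k x - x) /\<^sub>R real k) = norm (yosida S k x - x)"
      using k' by (simp only: norm_scaleR) simp
    moreover have "real k * (e / 2 * (1 / (real k - 0)) + c * (1 / (real k - (\<omega> + 1)) - 1 / (real k - \<omega>))) =
      e / 2 + c * (real k / (real k - (\<omega> + 1)) - real k / (real k - \<omega>))"
      using k' by (simp add: distrib_left right_diff_distrib mult.commute[of _ c])
    ultimately show ?thesis by (simp only:)
  qed
  have "(\<lambda>k. e / 2 + c * (real k / (real k - (\<omega> + 1)) - real k / (real k - \<omega>))) \<longlonglongrightarrow> e / 2 + c * (1 - 1)"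
    by (intro tendsto_intros) real_asymp+
  then have "\<forall>\<^sub>F k in sequentially. e / 2 + c * (real k / (real k - (\<omega> + 1)) - real k / (real k - \<omega>)) < e"
    by (rule order_tendstoD(2)) (use e in simp)
  moreover have "\<forall>\<^sub>F k in sequentially. real k > \<omega> + 1"
    by real_asymp
  ultimately show "\<forall>\<^sub>F k in sequentially. dist (yosida S k x) x < e"
    by eventually_elim (use est in \<open>auto simp: dist_norm intro: le_less_trans\<close>)
qed

end


section \<open>The adjoint semigroup\<close>

lemma norm_triangle3_diff:
  fixes a b c :: "'a::real_normed_vector"
  shows "norm (a + b - c) \<le> norm a + norm b + norm c"
  using norm_triangle_ineq4[of "a + b" c] norm_triangle_ineq[of a b] by linarith

context c0_generator
begin

abbreviation D where "D \<equiv> op_dom (adj_op A)"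
abbreviation As where "As \<equiv> op_app (adj_op A)"
abbreviation R where "R k \<equiv> adjoint (yosida S k)"
abbreviation P where "P t \<equiv> adjoint (S t)"

lemma eventually_index: "\<forall>\<^sub>F k in sequentially. real k \<ge> \<omega> + 1"
  by real_asymp

lemma obtain_index: obtains k where "real k \<ge> \<omega> + 1"
  using real_arch_simple by blast

text \<open>Density of the domain in weak form, because J_k maps into it and tends to the identity.
  It makes the description in \<open>adj_op\<close> unique.\<close>

lemma dom_A_separates:
  assumes "\<And>x. x \<in> op_dom A \<Longrightarrow> x \<bullet> v = x \<bullet> w"
  shows "v = w"
proof (rule inner_ext)
  fix x
  have ev: "\<forall>\<^sub>F k in sequentially. yosida S k x \<bullet> v = yosida S k x \<bullet> w"
    using eventually_index by eventually_elim (simp add: assms yosida_dom)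
  have lim: "(\<lambda>k. yosida S k x \<bullet> v) \<longlonglongrightarrow> x \<bullet> v" for v
    by (intro tendsto_intros yosida_tendsto)
  show "x \<bullet> v = x \<bullet> w"
    by (rule LIMSEQ_unique[OF Lim_transform_eventually[OF lim ev] lim])
qed

lemma adj_opI:
  assumes "\<And>x. x \<in> op_dom A \<Longrightarrow> op_app A x \<bullet> \<phi> = x \<bullet> w"
  shows "\<phi> \<in> D" "As \<phi> = w"
proof -
  show "\<phi> \<in> D" using assms by (auto simp: adj_op_def)
  show "As \<phi> = w" unfolding adj_op_def snd_conv
    by (rule the_equality) (use assms dom_A_separates in auto)
qed

lemma adj_opD:
  assumes "\<phi> \<in> D" "x \<in> op_dom A"
  shows "op_app A x \<bullet> \<phi> = x \<bullet> As \<phi>"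
proof -
  obtain w where w: "\<And>x. x \<in> op_dom A \<Longrightarrow> op_app A x \<bullet> \<phi> = x \<bullet> w"
    using assms(1) by (auto simp: adj_op_def)
  with adj_opI(2)[OF w] assms(2) show ?thesis by simp
qed

lemma D_add: "\<phi> \<in> D \<Longrightarrow> \<psi> \<in> D \<Longrightarrow> \<phi> + \<psi> \<in> D \<and> As (\<phi> + \<psi>) = As \<phi> + As \<psi>"
  using adj_opI[of "\<phi> + \<psi>" "As \<phi> + As \<psi>"] by (simp add: inner_add_right adj_opD)

lemma D_scale: "\<phi> \<in> D \<Longrightarrow> r *\<^sub>R \<phi> \<in> D \<and> As (r *\<^sub>R \<phi>) = r *\<^sub>R As \<phi>"
  using adj_opI[of "r *\<^sub>R \<phi>" "r *\<^sub>R As \<phi>"] by (simp add: adj_opD)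

lemma D_diff: "\<phi> \<in> D \<Longrightarrow> \<psi> \<in> D \<Longrightarrow> \<phi> - \<psi> \<in> D \<and> As (\<phi> - \<psi>) = As \<phi> - As \<psi>"
  using D_add[of \<phi> "(-1) *\<^sub>R \<psi>"] D_scale[of \<psi> "-1"] by simp

lemma D_0: "0 \<in> D"
  by (rule adj_opI(1)[of 0 0]) simp

lemma D_subspace: "subspace D"
  by (auto simp: subspace_def D_add D_scale D_0)

lemma R_inner: "real k \<ge> \<omega> + 1 \<Longrightarrow> x \<bullet> R k \<phi> = yosida S k x \<bullet> \<phi>"
  by (rule hilbert_adjoint[OF yosida_linear])

lemma R_linear: "real k \<ge> \<omega> + 1 \<Longrightarrow> bounded_linear (R k)"
  by (rule hilbert_adjoint_linear[OF yosida_linear])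

lemma R_norm: "real k \<ge> \<omega> + 1 \<Longrightarrow> norm (R k \<phi>) \<le> L * norm \<phi>"
  using L_ge_1 by (intro hilbert_adjoint_norm_le yosida_linear yosida_norm) auto

text \<open>The resolvent identity of the adjoint generator, transposed from
  \<open>yosida_A\<close>; continuity of the adjoint semigroup does not enter.\<close>

lemma R_D: "R k \<phi> \<in> D" and As_R: "As (R k \<phi>) = real k *\<^sub>R (R k \<phi> - \<phi>)"
  if k: "real k \<ge> \<omega> + 1"
proof -
  have "op_app A x \<bullet> R k \<phi> = x \<bullet> (real k *\<^sub>R (R k \<phi> - \<phi>))" if "x \<in> op_dom A" for x
    by (simp add: R_inner[OF k] yosida_A[OF k that] inner_diff_left inner_diff_right)
  from adj_opI[OF this] show "R k \<phi> \<in> D" "As (R k \<phi>) = real k *\<^sub>R (R k \<phi> - \<phi>)" by auto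
qed

lemma R_As:
  assumes k: "real k \<ge> \<omega> + 1" and \<phi>: "\<phi> \<in> D"
  shows "R k (As \<phi>) = As (R k \<phi>)"
proof (rule inner_ext)
  show "x \<bullet> R k (As \<phi>) = x \<bullet> As (R k \<phi>)" for x
    using adj_opD[OF \<phi> yosida_dom[OF k, of x]]
    by (simp add: R_inner[OF k] As_R[OF k] A_yosida[OF k] inner_diff_left inner_diff_right)
qed

text \<open>A vector orthogonal to \<open>D\<close> is orthogonal to the range of
  \<open>R k\<close>, so J_k kills it; then \<open>A_yosida\<close> leaves only a nonzero multiple
  of the vector, equal to \<open>op_app A 0 = 0\<close>.\<close>

lemma D_dense: "closure D = UNIV"
proof (rule orthogonal_trivial_dense[OF D_subspace])
  fix x assume x: "\<And>d. d \<in> D \<Longrightarrow> x \<bullet> d = 0"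
  obtain k where k: "real k \<ge> \<omega> + 1" using obtain_index .
  have "yosida S k x \<bullet> yosida S k x = 0"
    using x[OF R_D[OF k]] by (simp add: R_inner[OF k])
  then have "yosida S k x = 0" by simp
  moreover have "real k > 0" using k \<omega> by linarith
  moreover have "op_app A 0 = 0"
    using A_image_bounded_linear(2)[OF bounded_linear_zero _ yosida_dom[OF k, of x]]
    by (simp add: linear_0[OF bounded_linear.linear[OF S_linear]])
  ultimately show "x = 0" using A_yosida[OF k, of x] by simp
qed

lemma D_approx:
  assumes "e > 0"
  obtains \<psi> where "\<psi> \<in> D" "norm (\<phi> - \<psi>) < e"
  using D_dense closure_approachable[of \<phi> D] assms by (metis UNIV_I dist_commute dist_norm)

text \<open>On \<open>D\<close> the error is \<open>R k (As \<psi>)\<close> divided by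
  \<open>k\<close>; density and the uniform bound \<open>L\<close> do the rest.\<close>

lemma R_tendsto: "(\<lambda>k. R k \<phi>) \<longlonglongrightarrow> \<phi>"
proof (rule tendstoI)
  fix e :: real assume e: "e > 0"
  obtain \<psi> where \<psi>: "\<psi> \<in> D" "norm (\<phi> - \<psi>) < e / (2 * (L + 1))"
    using D_approx[of "e / (2 * (L + 1))" \<phi>] e L_ge_1 by auto
  have "(\<lambda>k. L * norm (As \<psi>) / real k) \<longlonglongrightarrow> 0" by real_asymp
  then have "\<forall>\<^sub>F k in sequentially. L * norm (As \<psi>) / real k < e / 2"
    by (rule order_tendstoD(2)) (use e in simp)
  then show "\<forall>\<^sub>F k in sequentially. dist (R k \<phi>) \<phi> < e"
    using eventually_index
  proof eventually_elim
    case (elim k)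
    have k0: "real k > 0" using elim \<omega> by linarith
    have lin: "linear (R k)" using R_linear[OF elim(2)] by (rule bounded_linear.linear)
    have "R k \<psi> - \<psi> = R k (As \<psi>) /\<^sub>R real k"
      using k0 by (simp add: R_As[OF elim(2) \<psi>(1)] As_R[OF elim(2)])
    then have "norm (R k \<psi> - \<psi>) \<le> L * norm (As \<psi>) / real k"
      using R_norm[OF elim(2), of "As \<psi>"] k0 by (simp add: field_simps)
    then have 1: "norm (R k \<psi> - \<psi>) < e / 2" using elim by linarith
    have split: "R k \<phi> - \<phi> = R k (\<phi> - \<psi>) + (R k \<psi> - \<psi>) - (\<phi> - \<psi>)"
      by (simp add: linear_diff[OF lin])
    have "norm (R k \<phi> - \<phi>) \<le> norm (R k (\<phi> - \<psi>)) + norm (R k \<psi> - \<psi>) + norm (\<phi> - \<psi>)"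
      unfolding split by (rule norm_triangle3_diff)
    also have "\<dots> \<le> (L + 1) * norm (\<phi> - \<psi>) + norm (R k \<psi> - \<psi>)"
      using R_norm[OF elim(2), of "\<phi> - \<psi>"] by (simp add: algebra_simps)
    also have "(L + 1) * norm (\<phi> - \<psi>) < (L + 1) * (e / (2 * (L + 1)))"
      using \<psi> L_ge_1 by (intro mult_strict_left_mono) auto
    also have "\<dots> = e / 2" using L_ge_1 by (simp add: field_simps)
    finally show ?case using 1 by (simp add: dist_norm)
  qed
qed

lemma P_inner: "t \<ge> 0 \<Longrightarrow> x \<bullet> P t \<phi> = S t x \<bullet> \<phi>"
  by (rule hilbert_adjoint[OF S_linear])

lemma P_linear: "t \<ge> 0 \<Longrightarrow> bounded_linear (P t)"
  by (rule hilbert_adjoint_linear[OF S_linear])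

lemma P_bound_upto: "0 \<le> t \<Longrightarrow> t \<le> T \<Longrightarrow> norm (P t \<phi>) \<le> M * exp (\<omega> * T) * norm \<phi>"
  using M by (intro hilbert_adjoint_norm_le S_linear S_bound_upto) auto

lemma P_R: "t \<ge> 0 \<Longrightarrow> real k \<ge> \<omega> + 1 \<Longrightarrow> P t (R k \<phi>) = R k (P t \<phi>)"
  by (rule inner_ext) (simp add: P_inner R_inner yosida_S)

lemma P_D: "P t \<phi> \<in> D" and As_P: "As (P t \<phi>) = P t (As \<phi>)" if t: "t \<ge> 0" and \<phi>: "\<phi> \<in> D"
proof -
  have "op_app A x \<bullet> P t \<phi> = x \<bullet> P t (As \<phi>)" if x: "x \<in> op_dom A" for x
    using A_image_bounded_linear[OF S_linear[OF t] S_swap[OF _ t] x] adj_opD[OF \<phi>, of "S t x"] t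
    by (simp add: P_inner)
  from adj_opI[OF this] show "P t \<phi> \<in> D" "As (P t \<phi>) = P t (As \<phi>)" by auto
qed

section \<open>Weak integral formula for the semigroup and strong continuity of its adjoint\<close>

lemma S_inner_continuous: "a \<ge> 0 \<Longrightarrow> continuous_on {a..b} (\<lambda>s. S s x \<bullet> w)"
  by (intro continuous_intros continuous_on_subset[OF S_continuous]) auto

lemma S_inner_integrable: "a \<ge> 0 \<Longrightarrow> (\<lambda>s. S s x \<bullet> w) integrable_on {a..b}"
  by (intro integrable_continuous_real S_inner_continuous)

lemma S_inner_integral_bound:
  assumes "0 \<le> a" "a \<le> b"
  shows "\<bar>integral {a..b} (\<lambda>s. S s x \<bullet> w)\<bar> \<le> M * exp (\<omega> * b) * norm x * norm w * (b - a)"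
proof -
  have "norm (integral {a..b} (\<lambda>s. S s x \<bullet> w)) \<le> M * exp (\<omega> * b) * norm x * norm w * (b - a)"
  proof (rule integral_bound)
    fix s assume "s \<in> {a..b}"
    then have "norm (S s x) * norm w \<le> M * exp (\<omega> * b) * norm x * norm w"
      using assms by (intro mult_right_mono S_bound_upto) auto
    then show "norm (S s x \<bullet> w) \<le> M * exp (\<omega> * b) * norm x * norm w"
      using Cauchy_Schwarz_ineq2[of "S s x" w] by simp
  qed (use assms S_inner_continuous in auto)
  then show ?thesis by simp
qed

text \<open>The derivative of the orbit is put on the test vector, so that \<open>x\<close> may be
  arbitrary. On the range of J_k the orbit has an explicitly differentiable formula; the general
  case follows as \<open>k\<close> grows.\<close>

lemma S_inner_integral:
  assumes \<phi>: "\<phi> \<in> D" and t: "t \<ge> 0"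
  shows "S t x \<bullet> \<phi> - x \<bullet> \<phi> = integral {0..t} (\<lambda>s. S s x \<bullet> As \<phi>)"
proof -
  have yos: "S t (yosida S k x) \<bullet> \<phi> - yosida S k x \<bullet> \<phi> = integral {0..t} (\<lambda>s. S s (yosida S k x) \<bullet> As \<phi>)"
    if k: "real k \<ge> \<omega> + 1" for k
  proof -
    let ?J = "yosida S k x" and ?f = "\<lambda>s. exp (- (real k * s)) * (S s x \<bullet> \<phi>)"
    \<comment> \<open>By \<open>S_yosida_inner\<close> this is
      \<open>S h ?J \<bullet> \<phi>\<close>, in a form to which the fundamental theorem of calculus
      applies.\<close>
    let ?F = "\<lambda>h. exp (real k * h) * (?J \<bullet> \<phi> - real k * integral {0..h} ?f)"
    have "((\<lambda>s. S s ?J \<bullet> As \<phi>) has_integral (?F t - ?F 0)) {0..t}"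
    proof (rule fundamental_theorem_of_calculus[OF t])
      fix h assume h: "h \<in> {0..t}"
      have "((\<lambda>h. integral {0..h} ?f) has_real_derivative ?f h) (at h within {0..t})"
        by (rule integral_has_real_derivative[OF _ h]) (auto intro!: continuous_intros S_inner_continuous)
      then have "(?F has_real_derivative real k * ?F h + exp (real k * h) * (- (real k * ?f h))) (at h within {0..t})"
        by (auto intro!: derivative_eq_intros simp: algebra_simps)
      moreover have "real k * ?F h + exp (real k * h) * (- (real k * ?f h)) = S h ?J \<bullet> As \<phi>"
      proof -
        have "exp (h * real k) * exp (- (h * real k)) = 1" by (simp flip: exp_add)
        moreover have "?F h = S h ?J \<bullet> \<phi>" using S_yosida_inner[OF k, of h x \<phi>] h by simp
        moreover have "S h ?J \<bullet> As \<phi> = real k * (S h ?J \<bullet> \<phi> - S h x \<bullet> \<phi>)"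
          using h adj_opD[OF \<phi> yosida_dom[OF k, of "S h x"]]
          by (simp add: yosida_S[OF k] A_yosida[OF k] inner_diff_left)
        ultimately show ?thesis by (simp add: algebra_simps)
      qed
      ultimately show "(?F has_vector_derivative S h ?J \<bullet> As \<phi>) (at h within {0..t})"
        by (simp add: has_real_derivative_iff_has_vector_derivative)
    qed
    moreover have "?F t = S t ?J \<bullet> \<phi>" using S_yosida_inner[OF k t, of x \<phi>] by simp
    ultimately show ?thesis by (simp add: integral_unique)
  qed
  have lim2: "(\<lambda>k. integral {0..t} (\<lambda>s. S s (yosida S k x) \<bullet> As \<phi>)) \<longlonglongrightarrow> integral {0..t} (\<lambda>s. S s x \<bullet> As \<phi>)"
  proof (rule LIM_zero_cancel, rule Lim_null_comparison)
    have "norm (integral {0..t} (\<lambda>s. S s (yosida S k x) \<bullet> As \<phi>) - integral {0..t} (\<lambda>s. S s x \<bullet> As \<phi>))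
      \<le> M * exp (\<omega> * t) * norm (yosida S k x - x) * norm (As \<phi>) * t" for k
    proof -
      have "integral {0..t} (\<lambda>s. S s (yosida S k x) \<bullet> As \<phi>) - integral {0..t} (\<lambda>s. S s x \<bullet> As \<phi>)
        = integral {0..t} (\<lambda>s. S s (yosida S k x) \<bullet> As \<phi> - S s x \<bullet> As \<phi>)"
        by (rule Henstock_Kurzweil_Integration.integral_diff[symmetric]) (auto intro: S_inner_integrable)
      also have "\<dots> = integral {0..t} (\<lambda>s. S s (yosida S k x - x) \<bullet> As \<phi>)"
        by (rule integral_cong)
          (auto simp: linear_diff[OF bounded_linear.linear[OF S_linear]] inner_diff_left)
      finally show ?thesis using S_inner_integral_bound[of 0 t "yosida S k x - x" "As \<phi>"] t by simp
    qed
    then show "\<forall>\<^sub>F k in sequentially. norm (integral {0..t} (\<lambda>s. S s (yosida S k x) \<bullet> As \<phi>) - integral {0..t} (\<lambda>s. S s x \<bullet> As \<phi>))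
      \<le> M * exp (\<omega> * t) * norm (yosida S k x - x) * norm (As \<phi>) * t" by simp
    have "(\<lambda>k. M * exp (\<omega> * t) * norm (yosida S k x - x) * norm (As \<phi>) * t) \<longlonglongrightarrow>
        M * exp (\<omega> * t) * norm (x - x) * norm (As \<phi>) * t"
      by (intro tendsto_intros yosida_tendsto)
    then show "(\<lambda>k. M * exp (\<omega> * t) * norm (yosida S k x - x) * norm (As \<phi>) * t) \<longlonglongrightarrow> 0" by simp
  qed
  have lim1: "(\<lambda>k. S t (yosida S k x) \<bullet> \<phi> - yosida S k x \<bullet> \<phi>) \<longlonglongrightarrow> S t x \<bullet> \<phi> - x \<bullet> \<phi>"
    by (intro tendsto_intros yosida_tendsto bounded_linear.tendsto[OF S_linear[OF t]])
  have ev: "\<forall>\<^sub>F k in sequentially. S t (yosida S k x) \<bullet> \<phi> - yosida S k x \<bullet> \<phi> =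
      integral {0..t} (\<lambda>s. S s (yosida S k x) \<bullet> As \<phi>)"
    using eventually_index by eventually_elim (rule yos)
  show ?thesis by (rule LIMSEQ_unique[OF Lim_transform_eventually[OF lim1 ev] lim2])
qed

lemma P_Lipschitz:
  assumes \<phi>: "\<phi> \<in> D" and "0 \<le> s" "s \<le> t" "t \<le> T"
  shows "norm (P t \<phi> - P s \<phi>) \<le> M * exp (\<omega> * T) * norm (As \<phi>) * (t - s)"
proof (rule norm_le_of_inner_le)
  fix x
  have "(P t \<phi> - P s \<phi>) \<bullet> x = (S t x \<bullet> \<phi> - x \<bullet> \<phi>) - (S s x \<bullet> \<phi> - x \<bullet> \<phi>)"
    using assms P_inner[of t x \<phi>] P_inner[of s x \<phi>] by (simp add: inner_diff_left inner_commute[of x])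
  also have "\<dots> = integral {0..t} (\<lambda>s. S s x \<bullet> As \<phi>) - integral {0..s} (\<lambda>s. S s x \<bullet> As \<phi>)"
    using assms by (simp add: S_inner_integral)
  also have "\<dots> = integral {s..t} (\<lambda>s. S s x \<bullet> As \<phi>)"
    using Henstock_Kurzweil_Integration.integral_combine[of 0 s t "\<lambda>s. S s x \<bullet> As \<phi>"] assms
    by (simp add: S_inner_integrable)
  also have "\<dots> \<le> M * exp (\<omega> * t) * norm x * norm (As \<phi>) * (t - s)"
    using S_inner_integral_bound[of s t x "As \<phi>"] assms by linarith
  also have "\<dots> \<le> M * exp (\<omega> * T) * norm x * norm (As \<phi>) * (t - s)"
    using assms M \<omega> by (intro mult_right_mono mult_left_mono) (auto intro!: mult_left_mono)
  finally show "(P t \<phi> - P s \<phi>) \<bullet> x \<le> M * exp (\<omega> * T) * norm (As \<phi>) * (t - s) * norm x"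
    by (simp add: algebra_simps)
qed (use assms M in auto)

text \<open>Orbits starting in \<open>D\<close> are Lipschitz, \<open>D\<close> is dense, and the
  operators are bounded on \<open>{0..T}\<close>: a three-epsilon argument.\<close>

lemma P_continuous: "continuous_on {0..T} (\<lambda>t. P t \<phi>)"
proof (rule continuous_on_iff[THEN iffD2], intro ballI allI impI)
  fix t e :: real assume t: "t \<in> {0..T}" and e: "e > 0"
  define K where "K = M * exp (\<omega> * T)"
  have K: "K > 0" using M by (simp add: K_def)
  obtain \<psi> where \<psi>: "\<psi> \<in> D" "norm (\<phi> - \<psi>) < e / (3 * K)"
    using D_approx[of "e / (3 * K)" \<phi>] e K by auto
  \<comment> \<open>The \<open>+ 1\<close> keeps the denominator positive when
    \<open>As \<psi>\<close> vanishes.\<close>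
  define d where "d = e / (3 * K * (norm (As \<psi>) + 1))"
  have d: "d > 0" using e K by (auto simp: d_def intro!: divide_pos_pos mult_pos_pos add_nonneg_pos)
  have close: "norm (P r \<phi> - P r \<psi>) < e / 3" if "r \<in> {0..T}" for r
  proof -
    have "P r \<phi> - P r \<psi> = P r (\<phi> - \<psi>)"
      using that by (simp add: linear_diff[OF bounded_linear.linear[OF P_linear]])
    also have "norm \<dots> \<le> K * norm (\<phi> - \<psi>)"
      unfolding K_def using that by (intro P_bound_upto) auto
    also have "\<dots> < K * (e / (3 * K))" using \<psi> K by (intro mult_strict_left_mono) auto
    finally show ?thesis using K by simp
  qed
  have mid: "norm (P r \<psi> - P s \<psi>) < e / 3" if "s \<le> r" "s \<in> {0..T}" "r \<in> {0..T}" "r - s < d" for r s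
  proof -
    have "norm (P r \<psi> - P s \<psi>) \<le> K * norm (As \<psi>) * (r - s)"
      unfolding K_def using that by (intro P_Lipschitz \<psi>) auto
    also have "\<dots> \<le> K * (norm (As \<psi>) + 1) * (r - s)"
      using that K by (intro mult_right_mono mult_left_mono) auto
    also have "\<dots> < K * (norm (As \<psi>) + 1) * d"
      using that K by (intro mult_strict_left_mono mult_pos_pos add_nonneg_pos) auto
    also have "\<dots> = e / 3"
      using K norm_ge_zero[of "As \<psi>"] by (simp add: d_def divide_simps add_nonneg_eq_0_iff)
    finally show ?thesis .
  qed
  show "\<exists>d>0. \<forall>s\<in>{0..T}. dist s t < d \<longrightarrow> dist (P s \<phi>) (P t \<phi>) < e"
  proof (intro exI[of _ d] conjI ballI impI d)
    fix s assume s: "s \<in> {0..T}" "dist s t < d"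
    have "norm (P s \<psi> - P t \<psi>) < e / 3"
    proof (cases "s \<le> t")
      case True
      then show ?thesis using mid[of s t] s t by (simp add: dist_real_def norm_minus_commute)
    next
      case False
      then show ?thesis using mid[of t s] s t by (simp add: dist_real_def)
    qed
    moreover have split: "P s \<phi> - P t \<phi> = (P s \<phi> - P s \<psi>) + (P s \<psi> - P t \<psi>) - (P t \<phi> - P t \<psi>)" by simp
    have "norm (P s \<phi> - P t \<phi>) \<le> norm (P s \<phi> - P s \<psi>) + norm (P s \<psi> - P t \<psi>) + norm (P t \<phi> - P t \<psi>)"
      unfolding split by (rule norm_triangle3_diff)
    ultimately show "dist (P s \<phi>) (P t \<phi>) < e"
      using close[OF s(1)] close[OF t] by (simp add: dist_norm)
  qed
qed

end


section \<open>The dual of the domain of the adjoint\<close>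

context c0_generator
begin

abbreviation gn where "gn \<equiv> graph_norm (adj_op A)"

lemma gn_nonneg: "0 \<le> gn \<phi>"
  by (simp add: graph_norm_def)

lemma norm_le_gn: "norm \<phi> \<le> gn \<phi>"
  and norm_As_le_gn: "norm (As \<phi>) \<le> gn \<phi>"
  and gn_le: "gn \<phi> \<le> norm \<phi> + norm (As \<phi>)"
  unfolding graph_norm_def
  by (auto intro: real_le_rsqrt sqrt_sum_squares_le_sum)

lemma gn_scale: "\<phi> \<in> D \<Longrightarrow> gn (r *\<^sub>R \<phi>) = \<bar>r\<bar> * gn \<phi>"
  by (simp add: graph_norm_def D_scale power_mult_distrib real_sqrt_mult flip: distrib_left)

lemma dual_spaceD:
  assumes "f \<in> dual_space A"
  shows "\<phi> \<in> D \<Longrightarrow> \<psi> \<in> D \<Longrightarrow> f (\<phi> + \<psi>) = f \<phi> + f \<psi>"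
    and "\<phi> \<in> D \<Longrightarrow> f (r *\<^sub>R \<phi>) = r * f \<phi>"
    and "\<exists>K. \<forall>\<phi>\<in>D. \<bar>f \<phi>\<bar> \<le> K * gn \<phi>"
    and "\<phi> \<notin> D \<Longrightarrow> f \<phi> = 0"
  using assms by (auto simp: dual_space_def)

text \<open>\<open>dual_norm\<close> is a supremum of reals, which bounds its members only once the
  set is known to be bounded above; membership in \<open>dual_space\<close> provides that.\<close>

lemma dual_norm_bound:
  assumes f: "f \<in> dual_space A" and \<phi>: "\<phi> \<in> D"
  shows "\<bar>f \<phi>\<bar> \<le> dual_norm A f * gn \<phi>"
proof (cases "gn \<phi> = 0")
  case True
  then have "\<phi> = 0" using norm_le_gn[of \<phi>] by simp
  then have "f \<phi> = 0" using dual_spaceD(2)[OF f \<phi>, of 0] by simp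
  then show ?thesis using True by simp
next
  case False
  then have pos: "gn \<phi> > 0" using gn_nonneg[of \<phi>] by simp
  obtain K where K: "\<And>\<phi>. \<phi> \<in> D \<Longrightarrow> \<bar>f \<phi>\<bar> \<le> K * gn \<phi>" using dual_spaceD(3)[OF f] by blast
  have "\<bar>f ((1 / gn \<phi>) *\<^sub>R \<phi>)\<bar> \<le> dual_norm A f"
    unfolding dual_norm_def
  proof (rule cSUP_upper)
    show "(1 / gn \<phi>) *\<^sub>R \<phi> \<in> {\<phi> \<in> D. gn \<phi> \<le> 1}"
      using pos \<phi> by (simp add: D_scale gn_scale)
    show "bdd_above ((\<lambda>\<phi>. \<bar>f \<phi>\<bar>) ` {\<phi> \<in> D. gn \<phi> \<le> 1})"
    proof (rule bdd_aboveI2)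
      fix \<psi> assume \<psi>: "\<psi> \<in> {\<phi> \<in> D. gn \<phi> \<le> 1}"
      have "\<bar>f \<psi>\<bar> \<le> K * gn \<psi>" using K \<psi> by blast
      also have "\<dots> \<le> \<bar>K\<bar> * 1" using \<psi> gn_nonneg by (intro mult_mono) auto
      finally show "\<bar>f \<psi>\<bar> \<le> \<bar>K\<bar>" by simp
    qed
  qed
  then have "\<bar>f \<phi>\<bar> / gn \<phi> \<le> dual_norm A f"
    using pos by (simp add: dual_spaceD(2)[OF f \<phi>] abs_mult)
  then show ?thesis using pos by (simp add: field_simps)
qed

lemma dual_norm_le:
  assumes "\<And>\<phi>. \<phi> \<in> D \<Longrightarrow> \<bar>f \<phi>\<bar> \<le> K * gn \<phi>" "K \<ge> 0"
  shows "dual_norm A f \<le> K"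
  unfolding dual_norm_def
proof (rule cSUP_least)
  have "0 \<in> D" "gn 0 = 0" using D_0 gn_scale[OF D_0, of 0] by auto
  then show "{\<phi> \<in> D. gn \<phi> \<le> 1} \<noteq> {}" by (auto intro!: exI[of _ 0])
  fix \<phi> assume \<phi>: "\<phi> \<in> {\<phi> \<in> D. gn \<phi> \<le> 1}"
  then have "\<bar>f \<phi>\<bar> \<le> K * gn \<phi>" using assms by blast
  also have "\<dots> \<le> K * 1" using \<phi> assms(2) by (intro mult_left_mono) auto
  finally show "\<bar>f \<phi>\<bar> \<le> K" by simp
qed

lemma dual_norm_nonneg: "f \<in> dual_space A \<Longrightarrow> 0 \<le> dual_norm A f"
proof (rule ccontr)
  assume f: "f \<in> dual_space A" and "\<not> 0 \<le> dual_norm A f"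
  have "0 \<in> {\<phi> \<in> D. gn \<phi> \<le> 1}" using D_0 gn_scale[OF D_0, of 0] by auto
  moreover have "bdd_above ((\<lambda>\<phi>. \<bar>f \<phi>\<bar>) ` {\<phi> \<in> D. gn \<phi> \<le> 1})"
  proof (rule bdd_aboveI2)
    fix \<psi> assume \<psi>: "\<psi> \<in> {\<phi> \<in> D. gn \<phi> \<le> 1}"
    have "\<bar>f \<psi>\<bar> \<le> dual_norm A f * gn \<psi>" using dual_norm_bound[OF f] \<psi> by blast
    also have "\<dots> \<le> \<bar>dual_norm A f\<bar> * 1" using \<psi> gn_nonneg by (intro mult_mono) auto
    finally show "\<bar>f \<psi>\<bar> \<le> \<bar>dual_norm A f\<bar>" by simp
  qed
  ultimately have "\<bar>f 0\<bar> \<le> dual_norm A f" unfolding dual_norm_def by (rule cSUP_upper)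
  then show False using \<open>\<not> 0 \<le> dual_norm A f\<close> by simp
qed

text \<open>The constant grows with \<open>k\<close>. It serves at a fixed index, to extend J_k to
  the dual space, and never enters the uniform estimates.\<close>

lemma gn_R:
  assumes k: "real k \<ge> \<omega> + 1"
  shows "gn (R k \<phi>) \<le> (L + real k * (L + 1)) * norm \<phi>"
proof -
  have "norm (R k \<phi> - \<phi>) \<le> (L + 1) * norm \<phi>"
    using norm_triangle_ineq4[of "R k \<phi>" \<phi>] R_norm[OF k, of \<phi>] by (simp add: algebra_simps)
  then have "norm (As (R k \<phi>)) \<le> real k * ((L + 1) * norm \<phi>)"
    by (simp add: As_R[OF k] mult_left_mono)
  then show ?thesis using gn_le[of "R k \<phi>"] R_norm[OF k, of \<phi>] by (simp add: algebra_simps)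
qed

lemma R_inverse:
  assumes k: "real k \<ge> \<omega> + 1" and \<phi>: "\<phi> \<in> D"
  shows "R k (\<phi> - As \<phi> /\<^sub>R real k) = \<phi>"
proof -
  have "real k > 0" using k \<omega> by linarith
  then show ?thesis
    using bounded_linear.linear[OF R_linear[OF k]]
    by (simp add: linear_diff linear_cmul R_As[OF k \<phi>] As_R[OF k])
qed

lemma dual_comp_R_linear:
  assumes k: "real k \<ge> \<omega> + 1" and f: "f \<in> dual_space A"
  shows "bounded_linear (\<lambda>\<phi>. f (R k \<phi>))"
proof (rule bounded_linear_intro)
  have lin: "linear (R k)" by (rule bounded_linear.linear[OF R_linear[OF k]])
  show "f (R k (\<phi> + \<psi>)) = f (R k \<phi>) + f (R k \<psi>)" for \<phi> \<psi>
    by (simp add: linear_add[OF lin] dual_spaceD(1)[OF f R_D[OF k] R_D[OF k]])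
  show "f (R k (r *\<^sub>R \<phi>)) = r *\<^sub>R f (R k \<phi>)" for r \<phi>
    by (simp add: linear_cmul[OF lin] dual_spaceD(2)[OF f R_D[OF k]])
  fix \<phi>
  have "\<bar>f (R k \<phi>)\<bar> \<le> dual_norm A f * gn (R k \<phi>)" by (rule dual_norm_bound[OF f R_D[OF k]])
  also have "\<dots> \<le> dual_norm A f * ((L + real k * (L + 1)) * norm \<phi>)"
    by (intro mult_left_mono gn_R[OF k] dual_norm_nonneg f)
  finally show "norm (f (R k \<phi>)) \<le> norm \<phi> * (dual_norm A f * (L + real k * (L + 1)))"
    by (simp add: algebra_simps)
qed

text \<open>Every functional comes from the pivot space through the extension of the identity minus
  A / k: \<open>q\<close> is the Riesz vector of \<open>f\<close> composed with
  \<open>R k\<close>.\<close>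

lemma dual_space_representation:
  assumes k: "real k \<ge> \<omega> + 1" and f: "f \<in> dual_space A"
  obtains q where "\<And>\<phi>. \<phi> \<in> D \<Longrightarrow> f \<phi> = q \<bullet> (\<phi> - As \<phi> /\<^sub>R real k)"
proof -
  obtain q where "\<And>\<phi>. f (R k \<phi>) = q \<bullet> \<phi>"
    using riesz_representation[OF dual_comp_R_linear[OF k f]] by blast
  then show thesis using R_inverse[OF k] that by metis
qed

lemma pivot_apply [simp]: "\<phi> \<in> D \<Longrightarrow> pivot A x \<phi> = x \<bullet> \<phi>"
  by (simp add: pivot_def)

lemma pivot_in_dual: "pivot A x \<in> dual_space A"
proof -
  have "\<exists>K. \<forall>\<phi>\<in>D. \<bar>x \<bullet> \<phi>\<bar> \<le> K * gn \<phi>"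
    by (intro exI[of _ "norm x"] ballI order_trans[OF Cauchy_Schwarz_ineq2] mult_left_mono norm_le_gn) auto
  then show ?thesis
    by (auto simp: dual_space_def pivot_def D_add D_scale inner_add_right)
qed

lemma dual_space_diff:
  assumes f: "f \<in> dual_space A" and g: "g \<in> dual_space A"
  shows "(\<lambda>\<phi>. f \<phi> - g \<phi>) \<in> dual_space A"
proof -
  have "\<exists>K. \<forall>\<phi>\<in>D. \<bar>f \<phi> - g \<phi>\<bar> \<le> K * gn \<phi>"
  proof (intro exI[of _ "dual_norm A f + dual_norm A g"] ballI)
    fix \<phi> assume "\<phi> \<in> D"
    then show "\<bar>f \<phi> - g \<phi>\<bar> \<le> (dual_norm A f + dual_norm A g) * gn \<phi>"
      using dual_norm_bound[OF f, of \<phi>] dual_norm_bound[OF g, of \<phi>] by (simp add: algebra_simps)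
  qed
  then show ?thesis
    using dual_spaceD[OF f] dual_spaceD[OF g] by (auto simp: dual_space_def algebra_simps)
qed

text \<open>Replacing the representing vector \<open>q\<close> by a nearby \<open>y\<close> in the
  domain of A lets A be moved off the test vector, and the functional becomes a pivot.\<close>

lemma pivot_dense:
  assumes f: "f \<in> dual_space A" and e: "e > 0"
  obtains x where "dual_norm A (\<lambda>\<phi>. f \<phi> - pivot A x \<phi>) \<le> e"
proof -
  obtain k where k: "real k \<ge> \<omega> + 1" using obtain_index .
  then have k1: "real k \<ge> 1" using \<omega> by simp
  obtain q where q: "\<And>\<phi>. \<phi> \<in> D \<Longrightarrow> f \<phi> = q \<bullet> (\<phi> - As \<phi> /\<^sub>R real k)"
    using dual_space_representation[OF k f] by blast
  have "\<forall>\<^sub>F m in sequentially. dist (yosida S m q) q < e / 2"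
    using e by (intro tendstoD[OF yosida_tendsto]) auto
  then have "\<forall>\<^sub>F m in sequentially. dist (yosida S m q) q < e / 2 \<and> real m \<ge> \<omega> + 1"
    using eventually_index by eventually_elim simp
  then obtain m where m: "dist (yosida S m q) q < e / 2" "real m \<ge> \<omega> + 1"
    by (auto simp: eventually_sequentially)
  define y where "y = yosida S m q"
  have y: "y \<in> op_dom A" unfolding y_def by (rule yosida_dom[OF m(2)])
  show thesis
  proof (rule that[of "y - op_app A y /\<^sub>R real k"], rule dual_norm_le)
    fix \<phi> assume \<phi>: "\<phi> \<in> D"
    have "f \<phi> - pivot A (y - op_app A y /\<^sub>R real k) \<phi> = (q - y) \<bullet> (\<phi> - As \<phi> /\<^sub>R real k)"
      using \<phi> by (simp add: q adj_opD[OF \<phi> y] inner_diff_left inner_diff_right right_diff_distrib)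
    also have "\<bar>\<dots>\<bar> \<le> norm (q - y) * norm (\<phi> - As \<phi> /\<^sub>R real k)" by (rule Cauchy_Schwarz_ineq2)
    also have "\<dots> \<le> e / 2 * (2 * gn \<phi>)"
    proof (intro mult_mono)
      show "norm (q - y) \<le> e / 2" using m by (simp add: y_def dist_norm norm_minus_commute)
      have "norm (As \<phi> /\<^sub>R real k) \<le> norm (As \<phi>)"
        using k1 mult_right_mono[of "inverse (real k)" 1 "norm (As \<phi>)"] by (simp add: inverse_le_1_iff)
      then show "norm (\<phi> - As \<phi> /\<^sub>R real k) \<le> 2 * gn \<phi>"
        using norm_triangle_ineq4[of \<phi> "As \<phi> /\<^sub>R real k"] norm_le_gn[of \<phi>] norm_As_le_gn[of \<phi>]
        by linarith
    qed (use e in auto)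
    finally show "\<bar>f \<phi> - pivot A (y - op_app A y /\<^sub>R real k) \<phi>\<bar> \<le> e * gn \<phi>" by simp
  qed (use e in auto)
qed

text \<open>Extensions to the dual space are given by choice; this identifies whichever one was
  chosen, since a bounded additive functional is determined on the dense pivot space.\<close>

lemma dual_functional_unique:
  assumes add: "\<And>f g. f \<in> dual_space A \<Longrightarrow> g \<in> dual_space A \<Longrightarrow> \<Lambda> (\<lambda>\<phi>. f \<phi> + g \<phi>) = \<Lambda> f + \<Lambda> g"
    and bound: "\<And>f. f \<in> dual_space A \<Longrightarrow> \<bar>\<Lambda> f\<bar> \<le> K * dual_norm A f"
    and piv: "\<And>x. \<Lambda> (pivot A x) = x \<bullet> \<psi>" and \<psi>: "\<psi> \<in> D" and f: "f \<in> dual_space A"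
  shows "\<Lambda> f = f \<psi>"
proof -
  have "\<bar>\<Lambda> f - f \<psi>\<bar> \<le> 0 + e" if e: "e > 0" for e
  proof -
    \<comment> \<open>Collects the bounds of both functionals; the \<open>+ 1\<close> makes it
      positive.\<close>
    define c where "c = \<bar>K\<bar> + gn \<psi> + 1"
    have c: "c > 0" using gn_nonneg[of \<psi>] by (simp add: c_def)
    obtain x where x: "dual_norm A (\<lambda>\<phi>. f \<phi> - pivot A x \<phi>) \<le> e / c"
      using pivot_dense[OF f, of "e / c"] e c by auto
    define g where "g = (\<lambda>\<phi>. f \<phi> - pivot A x \<phi>)"
    have g: "g \<in> dual_space A" unfolding g_def by (intro dual_space_diff f pivot_in_dual)
    have fg: "f = (\<lambda>\<phi>. g \<phi> + pivot A x \<phi>)" by (simp add: g_def)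
    have "\<Lambda> f = \<Lambda> g + x \<bullet> \<psi>" by (subst fg) (simp add: add[OF g pivot_in_dual] piv)
    moreover have "f \<psi> = g \<psi> + x \<bullet> \<psi>" by (subst fg) (simp add: \<psi>)
    ultimately have "\<bar>\<Lambda> f - f \<psi>\<bar> \<le> \<bar>\<Lambda> g\<bar> + \<bar>g \<psi>\<bar>" by simp
    also have "\<dots> \<le> K * dual_norm A g + dual_norm A g * gn \<psi>"
      by (intro add_mono bound dual_norm_bound g \<psi>)
    also have "\<dots> \<le> \<bar>K\<bar> * dual_norm A g + dual_norm A g * gn \<psi> + dual_norm A g"
      using dual_norm_nonneg[OF g] mult_right_mono[OF abs_ge_self[of K] dual_norm_nonneg[OF g]] by linarith
    also have "\<dots> = c * dual_norm A g" by (simp add: c_def algebra_simps)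
    also have "\<dots> \<le> c * (e / c)" using x c by (intro mult_left_mono) (auto simp: g_def)
    finally show ?thesis using c by simp
  qed
  then have "\<bar>\<Lambda> f - f \<psi>\<bar> \<le> 0" by (rule field_le_epsilon)
  then show ?thesis by simp
qed

text \<open>The Riesz vectors of \<open>f\<close> composed with \<open>R k\<close> form a map
  satisfying the specification, so the choice is not vacuous; \<open>dual_functional_unique\<close>
  then transfers the formula to the chosen map.\<close>

lemma yosida_ext_inner:
  assumes k: "real k \<ge> \<omega> + 1" and f: "f \<in> dual_space A"
  shows "yosida_ext A S k f \<bullet> \<phi> = f (R k \<phi>)"
proof -
  define spec where "spec J \<longleftrightarrow> (\<forall>f\<in>dual_space A. \<forall>g\<in>dual_space A. J (\<lambda>\<phi>. f \<phi> + g \<phi>) = J f + J g) \<and>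
     (\<forall>f\<in>dual_space A. \<forall>r. J (\<lambda>\<phi>. r * f \<phi>) = r *\<^sub>R J f) \<and>
     (\<exists>K. \<forall>f\<in>dual_space A. norm (J f) \<le> K * dual_norm A f) \<and>
     (\<forall>x. J (pivot A x) = yosida S k x)" for J
  obtain J where J: "\<And>f \<phi>. f \<in> dual_space A \<Longrightarrow> f (R k \<phi>) = J f \<bullet> \<phi>"
    using riesz_representation[OF dual_comp_R_linear[OF k]] by metis
  have J': "\<phi> \<bullet> J f = f (R k \<phi>)" if "f \<in> dual_space A" for f \<phi>
    using J[OF that] by (simp add: inner_commute)
  have "spec J"
    unfolding spec_def
  proof (intro conjI ballI allI)
    fix f g assume f: "f \<in> dual_space A" and g: "g \<in> dual_space A"
    \<comment> \<open>A sum is written as an iterated difference, with 0 as \<open>g\<close> minus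
      \<open>g\<close>, so that \<open>dual_space_diff\<close> suffices.\<close>
    have "(\<lambda>\<phi>. f \<phi> - (0 - g \<phi>)) \<in> dual_space A"
      using dual_space_diff[OF f dual_space_diff[OF dual_space_diff[OF g g] g]] by simp
    then have fg: "(\<lambda>\<phi>. f \<phi> + g \<phi>) \<in> dual_space A" by simp
    show "J (\<lambda>\<phi>. f \<phi> + g \<phi>) = J f + J g"
      by (rule inner_ext) (simp add: J' f g fg inner_add_right)
  next
    fix f and r :: real assume f: "f \<in> dual_space A"
    have "\<exists>K. \<forall>\<phi>\<in>D. \<bar>r * f \<phi>\<bar> \<le> K * gn \<phi>"
      using dual_norm_bound[OF f]
      by (intro exI[of _ "\<bar>r\<bar> * dual_norm A f"]) (auto simp: abs_mult mult.assoc intro!: mult_left_mono)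
    then have rf: "(\<lambda>\<phi>. r * f \<phi>) \<in> dual_space A"
      using dual_spaceD[OF f] by (auto simp: dual_space_def algebra_simps)
    show "J (\<lambda>\<phi>. r * f \<phi>) = r *\<^sub>R J f"
      by (rule inner_ext) (simp add: J' f rf)
  next
    show "\<exists>K. \<forall>f\<in>dual_space A. norm (J f) \<le> K * dual_norm A f"
    proof (intro exI[of _ "L + real k * (L + 1)"] ballI)
      fix f assume f: "f \<in> dual_space A"
      show "norm (J f) \<le> (L + real k * (L + 1)) * dual_norm A f"
      proof (rule norm_le_of_inner_le)
        fix \<phi>
        have "J f \<bullet> \<phi> \<le> dual_norm A f * gn (R k \<phi>)"
          using dual_norm_bound[OF f R_D[OF k], of \<phi>] by (simp add: J[OF f])
        also have "\<dots> \<le> dual_norm A f * ((L + real k * (L + 1)) * norm \<phi>)"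
          by (intro mult_left_mono gn_R[OF k] dual_norm_nonneg f)
        finally show "J f \<bullet> \<phi> \<le> (L + real k * (L + 1)) * dual_norm A f * norm \<phi>"
          by (simp add: algebra_simps)
      qed (use dual_norm_nonneg[OF f] L_ge_1 in simp)
    qed
  next
    show "J (pivot A x) = yosida S k x" for x
    proof (rule inner_ext)
      show "\<phi> \<bullet> J (pivot A x) = \<phi> \<bullet> yosida S k x" for \<phi>
        using R_inner[OF k, of x \<phi>] by (simp add: J' pivot_in_dual R_D[OF k] inner_commute)
    qed
  qed
  then have "spec (SOME J. spec J)" by (rule someI[of spec])
  then have "spec (yosida_ext A S k)" unfolding yosida_ext_def spec_def .
  note this[unfolded spec_def]
  then obtain K where add: "\<And>f g. f \<in> dual_space A \<Longrightarrow> g \<in> dual_space A \<Longrightarrow>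
        yosida_ext A S k (\<lambda>\<phi>. f \<phi> + g \<phi>) = yosida_ext A S k f + yosida_ext A S k g"
    and K: "\<And>f. f \<in> dual_space A \<Longrightarrow> norm (yosida_ext A S k f) \<le> K * dual_norm A f"
    and piv: "\<And>x. yosida_ext A S k (pivot A x) = yosida S k x" by blast
  show ?thesis
  proof (rule dual_functional_unique[where K = "K * norm \<phi>", OF _ _ _ R_D[OF k] f])
    fix f assume f: "f \<in> dual_space A"
    have "\<bar>yosida_ext A S k f \<bullet> \<phi>\<bar> \<le> norm (yosida_ext A S k f) * norm \<phi>" by (rule Cauchy_Schwarz_ineq2)
    also have "\<dots> \<le> (K * dual_norm A f) * norm \<phi>" by (intro mult_right_mono K f) auto
    finally show "\<bar>yosida_ext A S k f \<bullet> \<phi>\<bar> \<le> K * norm \<phi> * dual_norm A f" by (simp add: algebra_simps)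
  qed (simp_all add: add piv inner_add_left R_inner[OF k])
qed

lemma gn_P:
  assumes t: "t \<ge> 0" and \<phi>: "\<phi> \<in> D"
  shows "gn (P t \<phi>) \<le> M * exp (\<omega> * t) * (2 * gn \<phi>)"
proof -
  have K: "0 \<le> M * exp (\<omega> * t)" using M by simp
  have "gn (P t \<phi>) \<le> M * exp (\<omega> * t) * (norm \<phi> + norm (As \<phi>))"
    using gn_le[of "P t \<phi>"] P_bound_upto[OF t order_refl, of \<phi>] P_bound_upto[OF t order_refl, of "As \<phi>"]
    by (simp add: As_P[OF t \<phi>] algebra_simps)
  also have "\<dots> \<le> M * exp (\<omega> * t) * (2 * gn \<phi>)"
    using norm_le_gn[of \<phi>] norm_As_le_gn[of \<phi>] by (intro mult_left_mono K) linarith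
  finally show ?thesis .
qed

text \<open>Same scheme as \<open>yosida_ext_inner\<close>, with composition with
  \<open>P t\<close>, cut off outside \<open>D\<close>, as the witness.\<close>

lemma semigroup_ext_apply:
  assumes t: "t \<ge> 0" and f: "f \<in> dual_space A" and \<phi>: "\<phi> \<in> D"
  shows "semigroup_ext A S t f \<phi> = f (P t \<phi>)"
proof -
  define spec where "spec E \<longleftrightarrow> (\<forall>f\<in>dual_space A. E f \<in> dual_space A) \<and>
     (\<forall>f\<in>dual_space A. \<forall>g\<in>dual_space A. E (\<lambda>\<phi>. f \<phi> + g \<phi>) = (\<lambda>\<phi>. E f \<phi> + E g \<phi>)) \<and>
     (\<forall>f\<in>dual_space A. \<forall>r. E (\<lambda>\<phi>. r * f \<phi>) = (\<lambda>\<phi>. r * E f \<phi>)) \<and>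
     (\<exists>K. \<forall>f\<in>dual_space A. dual_norm A (E f) \<le> K * dual_norm A f) \<and>
     (\<forall>x. E (pivot A x) = pivot A (S t x))" for E
  define E where "E f = (\<lambda>\<phi>. if \<phi> \<in> D then f (P t \<phi>) else 0)" for f :: "'h \<Rightarrow> real"
  define K where "K = 2 * (M * exp (\<omega> * t))"
  have K0: "K \<ge> 0" using M by (simp add: K_def)
  have Eb: "\<bar>E f \<phi>\<bar> \<le> K * dual_norm A f * gn \<phi>" if f: "f \<in> dual_space A" and \<phi>: "\<phi> \<in> D" for f \<phi>
  proof -
    have "\<bar>E f \<phi>\<bar> \<le> dual_norm A f * gn (P t \<phi>)"
      using dual_norm_bound[OF f P_D[OF t \<phi>]] \<phi> by (simp add: E_def)
    also have "\<dots> \<le> dual_norm A f * (M * exp (\<omega> * t) * (2 * gn \<phi>))"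
      by (intro mult_left_mono gn_P dual_norm_nonneg f t \<phi>)
    finally show ?thesis by (simp add: K_def algebra_simps)
  qed
  have lin: "linear (P t)" by (rule bounded_linear.linear[OF P_linear[OF t]])
  have "spec E"
    unfolding spec_def
  proof (intro conjI ballI allI)
    fix f assume f: "f \<in> dual_space A"
    have "\<exists>K. \<forall>\<phi>\<in>D. \<bar>E f \<phi>\<bar> \<le> K * gn \<phi>" using Eb[OF f] by blast
    then show "E f \<in> dual_space A"
      using dual_spaceD(1,2)[OF f P_D[OF t]] P_D[OF t] D_add D_scale linear_add[OF lin] linear_cmul[OF lin]
      by (simp add: dual_space_def) (auto simp: E_def)
  next
    show "\<exists>K. \<forall>f\<in>dual_space A. dual_norm A (E f) \<le> K * dual_norm A f"
      using Eb K0 dual_norm_nonneg by (intro exI[of _ K] ballI dual_norm_le) auto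
  next
    show "E (pivot A x) = pivot A (S t x)" for x
      using P_D[OF t] by (auto simp: E_def pivot_def P_inner[OF t])
  qed (auto simp: E_def)
  then have "spec (SOME E. spec E)" by (rule someI[of spec])
  then have "spec (semigroup_ext A S t)" unfolding semigroup_ext_def spec_def .
  note this[unfolded spec_def]
  then obtain K where "\<forall>f\<in>dual_space A. semigroup_ext A S t f \<in> dual_space A"
    and add: "\<And>f g. f \<in> dual_space A \<Longrightarrow> g \<in> dual_space A \<Longrightarrow>
        semigroup_ext A S t (\<lambda>\<phi>. f \<phi> + g \<phi>) = (\<lambda>\<phi>. semigroup_ext A S t f \<phi> + semigroup_ext A S t g \<phi>)"
    and K: "\<And>f. f \<in> dual_space A \<Longrightarrow> dual_norm A (semigroup_ext A S t f) \<le> K * dual_norm A f"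
    and piv: "\<And>x. semigroup_ext A S t (pivot A x) = pivot A (S t x)" by blast
  note mem = bspec[OF this(1)]
  show ?thesis
  proof (rule dual_functional_unique[where K = "K * gn \<phi>", OF _ _ _ P_D[OF t \<phi>] f])
    fix f assume f: "f \<in> dual_space A"
    have "\<bar>semigroup_ext A S t f \<phi>\<bar> \<le> dual_norm A (semigroup_ext A S t f) * gn \<phi>"
      by (rule dual_norm_bound[OF mem[OF f] \<phi>])
    also have "\<dots> \<le> (K * dual_norm A f) * gn \<phi>" by (intro mult_right_mono K f gn_nonneg)
    finally show "\<bar>semigroup_ext A S t f \<phi>\<bar> \<le> K * gn \<phi> * dual_norm A f" by (simp add: algebra_simps)
  qed (simp_all add: add piv \<phi> P_inner[OF t])
qed

end

section \<open>The control operator and its adjoint\<close>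

locale control_system = c0_generator A S M \<omega>
  for A :: "'h::{real_inner, complete_space} unb_op" and S and M \<omega> :: real +
  fixes B :: "'u::{real_inner, complete_space} \<Rightarrow> 'h \<Rightarrow> real"
  assumes control: "control_op A B"
begin

abbreviation Bs where "Bs \<equiv> control_adj B"

lemma B_dual: "B u \<in> dual_space A"
  using control by (simp add: control_op_def)

lemma control_bound:
  obtains K where "K \<ge> 0" "\<And>u \<phi>. \<phi> \<in> D \<Longrightarrow> \<bar>B u \<phi>\<bar> \<le> K * norm u * gn \<phi>"
proof -
  obtain K where K: "\<And>u. dual_norm A (B u) \<le> K * norm u" using control by (auto simp: control_op_def)
  show thesis
  proof (rule that[of "\<bar>K\<bar>"])
    fix u \<phi> assume \<phi>: "\<phi> \<in> D"
    have "\<bar>B u \<phi>\<bar> \<le> dual_norm A (B u) * gn \<phi>" by (rule dual_norm_bound[OF B_dual \<phi>])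
    also have "\<dots> \<le> (\<bar>K\<bar> * norm u) * gn \<phi>"
      using K[of u] mult_right_mono[OF abs_ge_self[of K] norm_ge_zero[of u]]
      by (intro mult_right_mono gn_nonneg) linarith
    finally show "\<bar>B u \<phi>\<bar> \<le> \<bar>K\<bar> * norm u * gn \<phi>" .
  qed simp
qed

lemma Bs_inner:
  assumes \<phi>: "\<phi> \<in> D"
  shows "Bs \<phi> \<bullet> u = B u \<phi>"
proof -
  obtain K where K: "K \<ge> 0" "\<And>u \<phi>. \<phi> \<in> D \<Longrightarrow> \<bar>B u \<phi>\<bar> \<le> K * norm u * gn \<phi>"
    using control_bound by blast
  have "bounded_linear (\<lambda>u. B u \<phi>)"
    by (rule bounded_linear_intro[where K = "K * gn \<phi>"])
      (use control K(2)[OF \<phi>] in \<open>auto simp: control_op_def algebra_simps\<close>)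
  from theI'[OF riesz_representation[OF this]]
  have "\<forall>u. B u \<phi> = (THE v. \<forall>u. B u \<phi> = v \<bullet> u) \<bullet> u" .
  moreover have "(\<lambda>v. \<forall>u. B u \<phi> = v \<bullet> u) = (\<lambda>v. \<forall>u. v \<bullet> u = B u \<phi>)" by (auto simp: eq_commute)
  ultimately show ?thesis unfolding control_adj_def by metis
qed

lemma inner_Bs: "\<phi> \<in> D \<Longrightarrow> u \<bullet> Bs \<phi> = B u \<phi>"
  using Bs_inner by (simp add: inner_commute)

lemma Bs_add: "\<phi> \<in> D \<Longrightarrow> \<psi> \<in> D \<Longrightarrow> Bs (\<phi> + \<psi>) = Bs \<phi> + Bs \<psi>"
  by (rule inner_ext) (simp add: inner_Bs D_add inner_add_right dual_spaceD(1)[OF B_dual])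

lemma Bs_scale: "\<phi> \<in> D \<Longrightarrow> Bs (r *\<^sub>R \<phi>) = r *\<^sub>R Bs \<phi>"
  by (rule inner_ext) (simp add: inner_Bs D_scale dual_spaceD(2)[OF B_dual])

lemma Bs_diff: "\<phi> \<in> D \<Longrightarrow> \<psi> \<in> D \<Longrightarrow> Bs (\<phi> - \<psi>) = Bs \<phi> - Bs \<psi>"
  using Bs_add[of \<phi> "(-1) *\<^sub>R \<psi>"] Bs_scale[of \<psi> "-1"] D_scale[of \<psi> "-1"] by simp

lemma Bs_bound:
  obtains K where "K \<ge> 0" "\<And>\<phi>. \<phi> \<in> D \<Longrightarrow> norm (Bs \<phi>) \<le> K * (norm \<phi> + norm (As \<phi>))"
proof -
  obtain K where K: "K \<ge> 0" "\<And>u \<phi>. \<phi> \<in> D \<Longrightarrow> \<bar>B u \<phi>\<bar> \<le> K * norm u * gn \<phi>"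
    using control_bound by blast
  show thesis
  proof (rule that[OF K(1)])
    fix \<phi> assume \<phi>: "\<phi> \<in> D"
    have "norm (Bs \<phi>) \<le> K * gn \<phi>"
    proof (rule norm_le_of_inner_le)
      show "Bs \<phi> \<bullet> u \<le> K * gn \<phi> * norm u" for u
        using K(2)[OF \<phi>, of u] by (simp add: Bs_inner[OF \<phi>] algebra_simps)
    qed (use K gn_nonneg in simp)
    also have "\<dots> \<le> K * (norm \<phi> + norm (As \<phi>))" by (intro mult_left_mono gn_le K)
    finally show "norm (Bs \<phi>) \<le> K * (norm \<phi> + norm (As \<phi>))" .
  qed
qed

text \<open>\<open>Bs\<close> is continuous in the graph norm, hence the two limits. The predicate
  \<open>Q\<close> accommodates families that lie in \<open>D\<close> only for large indices or for
  nonnegative times.\<close>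

lemma Bs_tendsto:
  assumes \<phi>n: "\<And>n. \<phi>n n \<in> D \<or> \<not> Q n" "eventually Q F" and \<phi>: "\<phi> \<in> D"
    and lim: "(\<phi>n \<longlongrightarrow> \<phi>) F" "((\<lambda>n. As (\<phi>n n)) \<longlongrightarrow> As \<phi>) F"
  shows "((\<lambda>n. Bs (\<phi>n n)) \<longlongrightarrow> Bs \<phi>) F"
proof -
  obtain K where K: "K \<ge> 0" "\<And>\<phi>. \<phi> \<in> D \<Longrightarrow> norm (Bs \<phi>) \<le> K * (norm \<phi> + norm (As \<phi>))"
    using Bs_bound by blast
  have "((\<lambda>n. K * (norm (\<phi>n n - \<phi>) + norm (As (\<phi>n n) - As \<phi>))) \<longlongrightarrow>
      K * (norm (\<phi> - \<phi>) + norm (As \<phi> - As \<phi>))) F" by (intro tendsto_intros lim)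
  then have "((\<lambda>n. K * (norm (\<phi>n n - \<phi>) + norm (As (\<phi>n n) - As \<phi>))) \<longlongrightarrow> 0) F" by simp
  moreover have "\<forall>\<^sub>F n in F. norm (Bs (\<phi>n n) - Bs \<phi>) \<le> K * (norm (\<phi>n n - \<phi>) + norm (As (\<phi>n n) - As \<phi>))"
    using \<phi>n(2)
  proof eventually_elim
    case (elim n)
    then have "\<phi>n n \<in> D" using \<phi>n(1)[of n] by blast
    then show ?case using K(2)[of "\<phi>n n - \<phi>"] \<phi> by (simp add: Bs_diff D_diff)
  qed
  ultimately show ?thesis by (rule Lim_null_comparison[THEN LIM_zero_cancel, rotated])
qed

lemma Bs_P_continuous:
  assumes \<phi>: "\<phi> \<in> D"
  shows "continuous_on {0..T} (\<lambda>t. Bs (P t \<phi>))"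
  unfolding continuous_on_def
proof
  fix t assume t: "t \<in> {0..T}"
  show "((\<lambda>t. Bs (P t \<phi>)) \<longlongrightarrow> Bs (P t \<phi>)) (at t within {0..T})"
  proof (rule Bs_tendsto[where Q = "\<lambda>t. t \<ge> 0"])
    show ev: "\<forall>\<^sub>F s in at t within {0..T}. 0 \<le> s" by (auto simp: eventually_at_filter)
    show "((\<lambda>s. P s \<phi>) \<longlongrightarrow> P t \<phi>) (at t within {0..T})"
      using P_continuous t by (auto simp: continuous_on_def)
    have "((\<lambda>s. P s (As \<phi>)) \<longlongrightarrow> As (P t \<phi>)) (at t within {0..T})"
      using P_continuous[of T "As \<phi>"] t by (auto simp: continuous_on_def As_P \<phi>)
    then show "((\<lambda>s. As (P s \<phi>)) \<longlongrightarrow> As (P t \<phi>)) (at t within {0..T})"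
      by (rule Lim_transform_eventually) (use ev in eventually_elim, simp add: As_P \<phi>)
  qed (use P_D \<phi> t in auto)
qed

text \<open>\<open>Bs\<close> need not be bounded on the pivot space, so it cannot simply be moved
  through the integral. Representing \<open>B v\<close> by a vector \<open>q\<close> turns the claim
  into \<open>S_inner_integral\<close> for \<open>\<eta>\<close>, which lies in \<open>D\<close>
  because \<open>As \<phi>\<close> does.\<close>

lemma Bs_P_integral:
  assumes \<phi>: "\<phi> \<in> D" and As\<phi>: "As \<phi> \<in> D" and t: "t \<ge> 0"
  shows "v \<bullet> (Bs (P t \<phi>) - Bs \<phi>) = integral {0..t} (\<lambda>s. v \<bullet> Bs (P s (As \<phi>)))"
proof -
  obtain k where k: "real k \<ge> \<omega> + 1" using obtain_index .
  obtain q where q: "\<And>\<phi>. \<phi> \<in> D \<Longrightarrow> B v \<phi> = q \<bullet> (\<phi> - As \<phi> /\<^sub>R real k)"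
    using dual_space_representation[OF k B_dual] by blast
  define \<eta> where "\<eta> = \<phi> - As \<phi> /\<^sub>R real k"
  have \<eta>: "\<eta> \<in> D" and As\<eta>: "As \<eta> = As \<phi> - As (As \<phi>) /\<^sub>R real k"
    using D_diff[OF \<phi> conjunct1[OF D_scale[OF As\<phi>]]] D_scale[OF As\<phi>] by (auto simp: \<eta>_def)
  have Pq: "B v (P s \<psi>) = S s q \<bullet> (\<psi> - As \<psi> /\<^sub>R real k)" if s: "s \<ge> 0" and \<psi>: "\<psi> \<in> D" for s \<psi>
  proof -
    have "B v (P s \<psi>) = q \<bullet> (P s \<psi> - P s (As \<psi>) /\<^sub>R real k)"
      by (simp add: q P_D[OF s \<psi>] As_P[OF s \<psi>])
    then show ?thesis by (simp add: inner_diff_right P_inner[OF s])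
  qed
  have "v \<bullet> (Bs (P t \<phi>) - Bs \<phi>) = S t q \<bullet> \<eta> - q \<bullet> \<eta>"
    by (simp add: inner_diff_right[of v] inner_Bs P_D[OF t \<phi>] \<phi> Pq[OF t \<phi>] q \<eta>_def)
  also have "\<dots> = integral {0..t} (\<lambda>s. S s q \<bullet> As \<eta>)" by (rule S_inner_integral[OF \<eta> t])
  also have "\<dots> = integral {0..t} (\<lambda>s. v \<bullet> Bs (P s (As \<phi>)))"
    by (rule integral_cong) (auto simp: inner_Bs P_D As\<phi> Pq As\<eta>)
  finally show ?thesis .
qed

lemma Bs_yosida:
  assumes k: "real k \<ge> \<omega> + 1" and \<phi>: "\<phi> \<in> D"
  shows "control_adj (\<lambda>v. pivot A (yosida_ext A S k (B v))) \<phi> = Bs (R k \<phi>)"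
proof -
  have "pivot A (yosida_ext A S k (B v)) \<phi> = B v (R k \<phi>)" for v
    by (simp add: \<phi> yosida_ext_inner[OF k B_dual])
  then show ?thesis by (simp add: control_adj_def)
qed

end


section \<open>Square-integrable functions\<close>

text \<open>Sampling on a grid finer than the modulus of uniform continuity; this connects
  continuous functions with the simple functions in \<open>L2_fun\<close>.\<close>

lemma continuous_simple_approx:
  fixes g :: "real \<Rightarrow> 'a::real_normed_vector"
  assumes g: "continuous_on {0..T} g" and e: "e > 0"
  obtains s where "simple_function lebesgue s" "\<And>t. t \<in> {0<..<T} \<Longrightarrow> norm (s t - g t) < e"
proof -
  have "uniformly_continuous_on {0..T} g" by (rule compact_uniformly_continuous[OF g]) simp
  then obtain d where d: "d > 0"
    "\<And>s t. s \<in> {0..T} \<Longrightarrow> t \<in> {0..T} \<Longrightarrow> dist s t < d \<Longrightarrow> dist (g s) (g t) < e"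
    using e unfolding uniformly_continuous_on_def by metis
  \<comment> \<open>Clipping the time to \<open>{0..T}\<close> gives the grid index finitely many
    values on the whole line, as a simple function must have.\<close>
  define n where "n t = \<lfloor>max 0 (min T t) / d\<rfloor>" for t
  have "n \<in> measurable lebesgue (count_space UNIV)"
    unfolding n_def by (intro measurable_completion) measurable
  then have "n -` {k} \<in> sets lebesgue" for k
    using measurable_sets[of n lebesgue "count_space UNIV" "{k}"] by simp
  moreover have "n ` space lebesgue \<subseteq> {0..\<lfloor>max 0 T / d\<rfloor>}"
    using d(1) by (auto simp: n_def intro!: floor_mono divide_right_mono)
  then have "finite (n ` space lebesgue)" by (rule finite_subset) simp
  ultimately have "simple_function lebesgue n"
    by (auto simp: simple_function_def)
  then have "simple_function lebesgue ((\<lambda>k. g (d * real_of_int k)) \<circ> n)" by (rule simple_function_compose)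
  moreover have "norm (((\<lambda>k. g (d * real_of_int k)) \<circ> n) t - g t) < e" if t: "t \<in> {0<..<T}" for t
  proof -
    have nt: "n t = \<lfloor>t / d\<rfloor>" using t by (simp add: n_def)
    have "of_int (n t) \<le> t / d" "t / d < of_int (n t) + 1" by (simp_all add: nt)
    then have "d * of_int (n t) \<le> t" "t < d * of_int (n t) + d" using d(1) by (auto simp: field_simps)
    moreover have "0 \<le> d * of_int (n t)" using t d(1) by (simp add: nt)
    ultimately show ?thesis using t d(2)[of "d * of_int (n t)" t] by (simp add: dist_norm)
  qed
  ultimately show thesis by (rule that)
qed

text \<open>The \<open>m\<close>-th simple function is within 1 / (m + 1) of \<open>X m\<close> at
  every time of the interval, so its limit is that of \<open>X\<close> wherever the latter
  exists.\<close>

lemma L2_fun_limit: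
  fixes u :: "real \<Rightarrow> 'a::real_normed_vector"
  assumes X: "\<And>m. continuous_on {0..T} (X m)"
    and lim: "AE t in lebesgue. t \<in> {0<..<T} \<longrightarrow> (\<lambda>m. X m t) \<longlonglongrightarrow> u t"
    and fin: "(\<integral>\<^sup>+t\<in>{0<..<T}. ennreal ((norm (u t))\<^sup>2) \<partial>lebesgue) < \<infinity>"
  shows "L2_fun T u"
proof -
  have "\<exists>s. simple_function lebesgue s \<and> (\<forall>t\<in>{0<..<T}. norm (s t - X m t) < 1 / real (Suc m))" for m
    by (rule continuous_simple_approx[OF X[of m], of "1 / real (Suc m)"]) auto
  then have "\<exists>s. \<forall>m. simple_function lebesgue (s m) \<and>
      (\<forall>t\<in>{0<..<T}. norm (s m t - X m t) < 1 / real (Suc m))"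
    by (intro choice allI)
  then obtain s where s: "\<And>m. simple_function lebesgue (s m)"
    "\<And>m t. t \<in> {0<..<T} \<Longrightarrow> norm (s m t - X m t) < 1 / real (Suc m)" by blast
  have "AE t in lebesgue. t \<in> {0<..<T} \<longrightarrow> (\<lambda>m. s m t) \<longlonglongrightarrow> u t"
    using lim
  proof eventually_elim
    case (elim t)
    show ?case
    proof
      assume t: "t \<in> {0<..<T}"
      have "(\<lambda>m. s m t - X m t) \<longlonglongrightarrow> 0"
        by (rule Lim_null_comparison[OF always_eventually LIMSEQ_Suc[OF lim_1_over_n]])
          (intro allI less_imp_le s(2) t)
      from tendsto_add[OF this] elim t have "(\<lambda>m. (s m t - X m t) + X m t) \<longlonglongrightarrow> 0 + u t" by blast
      then show "(\<lambda>m. s m t) \<longlonglongrightarrow> u t" by simp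
    qed
  qed
  then show ?thesis unfolding L2_fun_def using s(1) fin by blast
qed

lemma integral_Cauchy_Schwarz:
  fixes g h :: "real \<Rightarrow> 'a::real_inner"
  assumes g: "continuous_on {a..b} g" and h: "continuous_on {a..b} h"
  shows "\<bar>integral {a..b} (\<lambda>t. g t \<bullet> h t)\<bar> \<le>
    sqrt (integral {a..b} (\<lambda>t. (norm (g t))\<^sup>2)) * sqrt (integral {a..b} (\<lambda>t. (norm (h t))\<^sup>2))"
proof -
  let ?I = "integral {a..b} (\<lambda>t. g t \<bullet> h t)"
  let ?G = "integral {a..b} (\<lambda>t. (norm (g t))\<^sup>2)" and ?H = "integral {a..b} (\<lambda>t. (norm (h t))\<^sup>2)"
  have int: "(\<lambda>t. g t \<bullet> h t) integrable_on {a..b}" "(\<lambda>t. (norm (g t))\<^sup>2) integrable_on {a..b}"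
    "(\<lambda>t. (norm (h t))\<^sup>2) integrable_on {a..b}"
    by (intro integrable_continuous_real continuous_intros g h)+
  have quad: "0 \<le> ?G - 2 * s * ?I + s\<^sup>2 * ?H" for s
  proof -
    have "((\<lambda>t. (norm (g t))\<^sup>2 - 2 * s * (g t \<bullet> h t) + s\<^sup>2 * (norm (h t))\<^sup>2) has_integral
        ?G - 2 * s * ?I + s\<^sup>2 * ?H) {a..b}"
      by (intro has_integral_add has_integral_diff has_integral_mult_right integrable_integral int)
    then show ?thesis
    proof (rule has_integral_nonneg)
      fix t
      have "(norm (g t))\<^sup>2 - 2 * s * (g t \<bullet> h t) + s\<^sup>2 * (norm (h t))\<^sup>2 = (norm (g t - s *\<^sub>R h t))\<^sup>2"
        unfolding power2_norm_eq_inner inner_diff_left inner_diff_right inner_scaleR_left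
          inner_scaleR_right inner_commute[of "h t" "g t"]
        by algebra
      then show "0 \<le> (norm (g t))\<^sup>2 - 2 * s * (g t \<bullet> h t) + s\<^sup>2 * (norm (h t))\<^sup>2" by simp
    qed
  qed
  have G0: "?G \<ge> 0" and H0: "?H \<ge> 0" by (auto intro!: Henstock_Kurzweil_Integration.integral_nonneg int)
  have "?I\<^sup>2 \<le> ?G * ?H"
  proof (cases "?H = 0")
    case True
    have "?I = 0"
    proof (rule ccontr)
      assume I: "?I \<noteq> 0"
      \<comment> \<open>With \<open>?H = 0\<close> the quadratic is affine in \<open>s\<close>, and
        this \<open>s\<close> gives it the value -1.\<close>
      have "2 * ((?G + 1) / (2 * ?I)) * ?I = ?G + 1" using I by simp
      then show False using quad[of "(?G + 1) / (2 * ?I)"] True by simp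
    qed
    then show ?thesis using True by simp
  next
    case False
    then have "0 < ?H" using H0 by simp
    then have "?I\<^sup>2 / ?H \<le> ?G" using quad[of "?I / ?H"] by (simp add: power2_eq_square field_simps)
    then show ?thesis using \<open>0 < ?H\<close> by (simp add: field_simps)
  qed
  then have "sqrt (?I\<^sup>2) \<le> sqrt (?G * ?H)" by (rule real_sqrt_le_mono)
  then show ?thesis by (simp add: real_sqrt_mult)
qed

lemma LINT_continuous:
  fixes f :: "real \<Rightarrow> real"
  assumes "continuous_on {a..b} f"
  shows "set_integrable lebesgue {a..b} f" "(LINT t:{a..b}|lebesgue. f t) = integral {a..b} f"
  using absolutely_integrable_continuous_real[OF assms]
  by (auto intro: set_lebesgue_integral_eq_integral)

lemma nn_integral_continuous:
  fixes f :: "real \<Rightarrow> real"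
  assumes f: "continuous_on {a..b} f" and nonneg: "\<And>t. t \<in> {a..b} \<Longrightarrow> f t \<ge> 0"
  shows "(\<integral>\<^sup>+t\<in>{a..b}. ennreal (f t) \<partial>lebesgue) = ennreal (integral {a..b} f)"
proof -
  have "(\<integral>\<^sup>+t\<in>{a..b}. ennreal (f t) \<partial>lebesgue) = (\<integral>\<^sup>+t. ennreal (indicator {a..b} t *\<^sub>R f t) \<partial>lebesgue)"
    by (intro nn_integral_cong) (auto split: split_indicator)
  also have "\<dots> = ennreal (LINT t|lebesgue. indicator {a..b} t *\<^sub>R f t)"
    using LINT_continuous(1)[OF f] nonneg
    by (intro nn_integral_eq_integral) (auto simp: set_integrable_def split: split_indicator)
  finally show ?thesis using LINT_continuous(2)[OF f] by (simp add: set_lebesgue_integral_def)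
qed

lemma convergent_partial_sums:
  fixes a :: "nat \<Rightarrow> 'a::{real_normed_vector, complete_space}"
  assumes le: "\<And>j. norm (a j) \<le> p j" and p: "summable p"
  shows "convergent (\<lambda>m. \<Sum>j\<le>m. a j)"
proof -
  let ?X = "\<lambda>m. \<Sum>j\<le>m. a j" and ?Q = "\<lambda>m. \<Sum>j\<le>m. p j"
  have "convergent ?Q" using p by (simp add: summable_iff_convergent')
  then have Q: "Cauchy ?Q" by (rule convergent_Cauchy)
  have le1: "dist (?X m) (?X n) \<le> dist (?Q m) (?Q n)" if "n \<le> m" for m n
  proof -
    have "{..m} = {..n} \<union> {Suc n..m}" using that by auto
    then have "?X m - ?X n = (\<Sum>j\<in>{Suc n..m}. a j)" "?Q m - ?Q n = (\<Sum>j\<in>{Suc n..m}. p j)"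
      by (simp_all add: sum.union_disjoint)
    moreover have "norm (\<Sum>j\<in>{Suc n..m}. a j) \<le> (\<Sum>j\<in>{Suc n..m}. p j)"
      by (rule sum_norm_le) (rule le)
    ultimately show ?thesis by (simp add: dist_norm)
  qed
  have le2: "dist (?X m) (?X n) \<le> dist (?Q m) (?Q n)" for m n
    using le1[of n m] le1[of m n] by (cases rule: le_cases[of n m]) (simp_all add: dist_commute)
  have "Cauchy ?X"
  proof (rule metric_CauchyI)
    fix e :: real assume "e > 0"
    then obtain K where "\<And>m n. m \<ge> K \<Longrightarrow> n \<ge> K \<Longrightarrow> dist (?Q m) (?Q n) < e"
      using Q unfolding Cauchy_def by blast
    then show "\<exists>M. \<forall>m\<ge>M. \<forall>n\<ge>M. dist (?X m) (?X n) < e"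
      by (intro exI[of _ K] allI impI le_less_trans[OF le2])
  qed
  then show ?thesis by (rule Cauchy_convergent)
qed

text \<open>Scaling the \<open>j\<close>-th normalised hump by \<open>(1/3)\<^sup>j\<close> and splitting \<open>(1/3)\<^sup>j = (2/3)\<^sup>j (1/2)\<^sup>j\<close> in the
  Cauchy-Schwarz inequality dominates all partial sums of the hump by one integrable function.\<close>

lemma L2_gliding_hump:
  fixes g :: "nat \<Rightarrow> real \<Rightarrow> 'a::{real_inner, complete_space}"
  assumes g: "\<And>n. continuous_on {0..T} (g n)"
    and big: "\<And>n. sqrt (integral {0..T} (\<lambda>t. (norm (g n t))\<^sup>2)) \<ge> 4 ^ n"
  obtains u where "L2_fun T u" "\<And>n. (4/3) ^ n / 6 \<le> \<bar>LINT t:{0..T}|lebesgue. u t \<bullet> g n t\<bar>"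
proof -
  define N where "N n = sqrt (integral {0..T} (\<lambda>t. (norm (g n t))\<^sup>2))" for n
  have N4: "N n \<ge> 4 ^ n" for n using big by (simp add: N_def)
  then have N0: "N n > 0" for n by (rule less_le_trans[rotated]) simp
  have N2: "integral {0..T} (\<lambda>t. (norm (g n t))\<^sup>2) = (N n)\<^sup>2" for n
  proof -
    have "integral {0..T} (\<lambda>t. (norm (g n t))\<^sup>2) \<ge> 0"
      by (rule Henstock_Kurzweil_Integration.integral_nonneg)
        (auto intro!: integrable_continuous_real continuous_intros g)
    then show ?thesis by (simp add: N_def)
  qed
  \<comment> \<open>The \<open>j\<close>-th hump, scaled to L^2 norm (1/3)^j.\<close>
  define b where "b j t = ((1/3) ^ j / N j) *\<^sub>R g j t" for j t
  have b: "continuous_on {0..T} (b j)" for j unfolding b_def by (intro continuous_intros g)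
  define f where "f n j = integral {0..T} (\<lambda>t. b j t \<bullet> g n t)" for n j
  have "\<exists>\<sigma>. (\<forall>j. \<bar>\<sigma> j\<bar> = 1) \<and> (\<forall>n m. n \<le> m \<longrightarrow> (4/3) ^ n / 6 \<le> norm (\<Sum>j\<le>m. \<sigma> j *\<^sub>R f n j))"
  proof (rule gliding_hump[where c = N])
    have f_eq: "f n j = (1/3) ^ j / N j * integral {0..T} (\<lambda>t. g j t \<bullet> g n t)" for n j
      by (simp add: f_def b_def)
    show "norm (f n j) \<le> (1/3) ^ j * N n" for n j
    proof -
      have "\<bar>integral {0..T} (\<lambda>t. g j t \<bullet> g n t)\<bar> \<le> N j * N n"
        unfolding N_def by (rule integral_Cauchy_Schwarz[OF g g])
      then have "(1/3) ^ j / N j * \<bar>integral {0..T} (\<lambda>t. g j t \<bullet> g n t)\<bar> \<le> (1/3) ^ j / N j * (N j * N n)"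
        using N0[of j] by (intro mult_left_mono) auto
      then show ?thesis using N0[of j] by (simp add: f_eq abs_mult)
    qed
    show "2 / 3 * (1/3) ^ n * N n \<le> norm (f n n)" for n
    proof -
      have "integral {0..T} (\<lambda>t. g n t \<bullet> g n t) = N n * N n"
        using N2[of n] unfolding power2_norm_eq_inner by (simp only: power2_eq_square)
      then have "f n n = (1/3) ^ n * N n"
        using N0[of n] by (simp add: f_eq)
      then show ?thesis using N0[of n] by (simp add: abs_mult)
    qed
  qed (rule N4)
  then obtain \<sigma> where \<sigma>: "\<And>j. \<bar>\<sigma> j\<bar> = 1"
    "\<And>n m. n \<le> m \<Longrightarrow> (4/3) ^ n / 6 \<le> \<bar>\<Sum>j\<le>m. \<sigma> j * f n j\<bar>" by auto
  define X where "X m t = (\<Sum>j\<le>m. \<sigma> j *\<^sub>R b j t)" for m t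
  have X: "continuous_on {0..T} (X m)" for m unfolding X_def by (intro continuous_intros b)
  define h where "h j t = (norm (g j t) / N j)\<^sup>2" for j t
  have h0: "h j t \<ge> 0" for j t by (simp add: h_def)
  have h: "continuous_on {0..T} (h j)" for j
    unfolding h_def by (intro continuous_intros g) (use N0[of j] in auto)
  have int_h: "integral {0..T} (h j) = 1" for j
  proof -
    have "integral {0..T} (h j) = integral {0..T} (\<lambda>t. (norm (g j t))\<^sup>2) / (N j)\<^sup>2"
      by (simp add: h_def[abs_def] power_divide)
    then show ?thesis using N0[of j] by (simp add: N2)
  qed
  \<comment> \<open>These have integral (1/4)^j, so their series has finite integral and converges
    almost everywhere; \<open>G\<close> is the set where it does, and its sum \<open>w\<close> is
    the source of all majorants.\<close>
  define v where "v j t = indicator {0..T} t * ((1/4) ^ j * h j t)" for j t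
  have v0: "v j t \<ge> 0" for j t by (simp add: v_def h0)
  have hq: "continuous_on {0..T} (\<lambda>t. (1/4) ^ j * h j t)" for j by (intro continuous_intros h)
  have v_int: "integrable lebesgue (v j)" "(LINT t|lebesgue. v j t) = (1/4) ^ j" for j
  proof -
    show "integrable lebesgue (v j)"
      using LINT_continuous(1)[OF hq[of j]] by (simp add: set_integrable_def v_def[abs_def])
    have "(LINT t|lebesgue. v j t) = (LINT t:{0..T}|lebesgue. (1/4) ^ j * h j t)"
      by (simp only: set_lebesgue_integral_def v_def real_scaleR_def)
    also have "\<dots> = (1/4) ^ j" by (simp only: LINT_continuous(2)[OF hq]) (simp add: int_h)
    finally show "(LINT t|lebesgue. v j t) = (1/4) ^ j" .
  qed
  note v_meas [measurable] = borel_measurable_integrable[OF v_int(1)]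
  have AE_fin: "AE t in lebesgue. (\<Sum>j. ennreal (v j t)) \<noteq> \<infinity>"
  proof -
    have "(\<integral>\<^sup>+t. (\<Sum>j. ennreal (v j t)) \<partial>lebesgue) = (\<Sum>j. \<integral>\<^sup>+t. ennreal (v j t) \<partial>lebesgue)"
      by (rule nn_integral_suminf) measurable
    also have "\<dots> = (\<Sum>j. ennreal ((1/4) ^ j))"
      by (simp add: nn_integral_eq_integral[OF v_int(1)] v0 v_int(2))
    also have "\<dots> = ennreal (\<Sum>j. (1/4) ^ j)"
      by (rule suminf_ennreal2) (auto intro: summable_geometric)
    finally have "AE t in lebesgue. (\<Sum>j. ennreal (v j t)) \<noteq> \<infinity>"
      by (intro nn_integral_PInf_AE) auto
    then show ?thesis by simp
  qed
  define G where "G = {t. (\<Sum>j. ennreal (v j t)) \<noteq> \<infinity>}"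
  have "{t \<in> space lebesgue. (\<Sum>j. ennreal (v j t)) \<noteq> \<infinity>} \<in> sets lebesgue" by measurable
  then have G_meas: "G \<in> sets lebesgue" by (simp add: G_def)
  have AE_G: "AE t in lebesgue. t \<in> G" using AE_fin by (simp add: G_def)
  have G_sum: "summable (\<lambda>j. v j t)" if "t \<in> G" for t
    using that by (intro summable_suminf_not_top v0) (simp add: G_def)
  define w where "w t = (\<Sum>j. v j t)" for t
  have w_int: "integrable lebesgue w"
    unfolding w_def
  proof (rule integrable_suminf)
    show "AE t in lebesgue. summable (\<lambda>j. norm (v j t))"
      using AE_G by eventually_elim (use G_sum v0 in simp)
    show "summable (\<lambda>j. LINT t|lebesgue. norm (v j t))"
      by (simp add: v0 v_int(2) summable_geometric)
  qed (rule v_int(1))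
  define r where "r j t = norm (g j t) / N j" for j t
  have v_r: "v j t = ((1/2) ^ j * r j t)\<^sup>2" if "t \<in> {0..T}" for j t
    using that by (simp add: v_def h_def r_def power_mult_distrib power2_eq_square flip: power_mult_distrib)
  have b_r: "norm (b j t) = (2/3) ^ j * ((1/2) ^ j * r j t)" for j t
  proof -
    have "(1/3::real) ^ j = (2/3) ^ j * (1/2) ^ j" by (simp flip: power_mult_distrib)
    then show ?thesis using N0[of j] by (simp add: b_def r_def abs_mult)
  qed
  have geo: "((2/3::real) ^ j)\<^sup>2 = (4/9) ^ j" for j
    by (simp add: power2_eq_square flip: power_mult_distrib)
  have X_bound: "(norm (X m t))\<^sup>2 \<le> 2 * w t" if t: "t \<in> {0..T}" "t \<in> G" for m t
  proof -
    have "norm (X m t) \<le> (\<Sum>j\<le>m. (2/3) ^ j * ((1/2) ^ j * r j t))"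
      unfolding X_def by (rule sum_norm_le) (simp add: \<sigma> b_r)
    then have "(norm (X m t))\<^sup>2 \<le> (\<Sum>j\<le>m. (2/3) ^ j * ((1/2) ^ j * r j t))\<^sup>2"
      by (intro power_mono) auto
    also have "\<dots> \<le> (\<Sum>j\<le>m. ((2/3) ^ j)\<^sup>2) * (\<Sum>j\<le>m. ((1/2) ^ j * r j t)\<^sup>2)"
      by (rule Cauchy_Schwarz_ineq_sum)
    also have "\<dots> = (\<Sum>j\<le>m. (4/9) ^ j) * (\<Sum>j\<le>m. v j t)"
      using t(1) by (simp only: geo v_r)
    also have "\<dots> \<le> 2 * w t"
    proof (rule mult_mono)
      have "(\<Sum>j\<le>m. (4/9::real) ^ j) \<le> (\<Sum>j. (4/9) ^ j)"
        by (rule sum_le_suminf) (auto intro: summable_geometric)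
      also have "\<dots> = 9 / 5" by (subst suminf_geometric) auto
      finally show "(\<Sum>j\<le>m. (4/9::real) ^ j) \<le> 2" by simp
      show "(\<Sum>j\<le>m. v j t) \<le> w t"
        unfolding w_def by (rule sum_le_suminf) (auto intro: G_sum t v0)
    qed (auto intro!: sum_nonneg v0)
    finally show ?thesis .
  qed
  \<comment> \<open>Cutting the partial sums off outside \<open>G\<close> makes the limit exist at
    every time of \<open>{0..T}\<close>, with value 0 off \<open>G\<close>.\<close>
  define u where "u t = lim (\<lambda>m. indicator G t *\<^sub>R X m t)" for t
  have u_lim: "(\<lambda>m. indicator G t *\<^sub>R X m t) \<longlonglongrightarrow> u t" if t: "t \<in> {0..T}" for t
  proof (cases "t \<in> G")
    case True
    have "convergent (\<lambda>m. X m t)"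
      unfolding X_def
    proof (rule convergent_partial_sums)
      show "norm (\<sigma> j *\<^sub>R b j t) \<le> (4/9) ^ j + v j t" for j
      proof -
        have "norm (\<sigma> j *\<^sub>R b j t) = (2/3) ^ j * ((1/2) ^ j * r j t)" by (simp add: \<sigma> b_r)
        also have "\<dots> \<le> ((2/3) ^ j)\<^sup>2 + ((1/2) ^ j * r j t)\<^sup>2"
        proof -
          have "x * y \<le> x\<^sup>2 + y\<^sup>2" for x y :: real
            using sum_squares_bound[of x y] zero_le_power2[of x] zero_le_power2[of y]
            by linarith
          then show ?thesis .
        qed
        finally show ?thesis by (simp only: geo v_r[OF t])
      qed
      show "summable (\<lambda>j. (4/9) ^ j + v j t)"
        by (intro summable_add G_sum True summable_geometric) auto
    qed
    then show ?thesis using True by (simp add: u_def convergent_LIMSEQ_iff)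
  qed (simp add: u_def)
  have u_lim_G: "(\<lambda>m. X m t) \<longlonglongrightarrow> u t" if "t \<in> {0..T}" "t \<in> G" for t
    using u_lim[OF that(1)] that(2) by simp
  have "L2_fun T u"
  proof (rule L2_fun_limit[OF X])
    show "AE t in lebesgue. t \<in> {0<..<T} \<longrightarrow> (\<lambda>m. X m t) \<longlonglongrightarrow> u t"
      using AE_G by eventually_elim (auto intro: u_lim_G)
    have "(\<integral>\<^sup>+t\<in>{0<..<T}. ennreal ((norm (u t))\<^sup>2) \<partial>lebesgue) \<le> (\<integral>\<^sup>+t. ennreal (2 * w t) \<partial>lebesgue)"
    proof (rule nn_integral_mono_AE)
      show "AE t in lebesgue. ennreal ((norm (u t))\<^sup>2) * indicator {0<..<T} t \<le> ennreal (2 * w t)"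
        using AE_G
      proof eventually_elim
        case (elim t)
        show ?case
        proof (cases "t \<in> {0<..<T}")
          case True
          then have t: "t \<in> {0..T}" by auto
          have "(\<lambda>m. (norm (X m t))\<^sup>2) \<longlonglongrightarrow> (norm (u t))\<^sup>2"
            by (intro tendsto_intros u_lim_G t elim)
          then have "(norm (u t))\<^sup>2 \<le> 2 * w t"
            by (rule LIMSEQ_le_const2) (use X_bound[OF t elim] in auto)
          then show ?thesis using True by (simp add: ennreal_leI)
        qed simp
      qed
    qed
    also have "\<dots> = ennreal (LINT t|lebesgue. 2 * w t)"
    proof (rule nn_integral_eq_integral)
      show "AE t in lebesgue. 0 \<le> 2 * w t"
        using AE_G by eventually_elim (auto simp: w_def intro: suminf_nonneg G_sum v0)
    qed (use w_int in simp)
    finally show "(\<integral>\<^sup>+t\<in>{0<..<T}. ennreal ((norm (u t))\<^sup>2) \<partial>lebesgue) < \<infinity>"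
      using le_less_trans by fastforce
  qed
  moreover have "(4/3) ^ n / 6 \<le> \<bar>LINT t:{0..T}|lebesgue. u t \<bullet> g n t\<bar>" for n
  proof -
    define s where "s m t = indicator {0..T} t * ((indicator G t *\<^sub>R X m t) \<bullet> g n t)" for m t
    have Xg: "continuous_on {0..T} (\<lambda>t. X m t \<bullet> g n t)" for m by (intro continuous_intros X g)
    have Xg_meas: "(\<lambda>t. indicator {0..T} t * (X m t \<bullet> g n t)) \<in> borel_measurable lebesgue" for m
      using LINT_continuous(1)[OF Xg[of m]] by (auto simp: set_integrable_def dest: borel_measurable_integrable)
    have s_eq: "s m t = indicator G t * (indicator {0..T} t * (X m t \<bullet> g n t))" for m t
      by (simp add: s_def)
    have s_meas: "s m \<in> borel_measurable lebesgue" for m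
      unfolding s_eq[abs_def]
      by (intro borel_measurable_times borel_measurable_indicator G_meas Xg_meas)
    have s_lim: "(\<lambda>m. s m t) \<longlonglongrightarrow> indicator {0..T} t * (u t \<bullet> g n t)" for t
    proof (cases "t \<in> {0..T}")
      case True
      then show ?thesis unfolding s_def by (intro tendsto_intros u_lim)
    qed (simp add: s_def)
    have u_meas: "(\<lambda>t. indicator {0..T} t * (u t \<bullet> g n t)) \<in> borel_measurable lebesgue"
      by (rule borel_measurable_LIMSEQ_real[OF _ s_meas]) (rule s_lim)
    have gg: "continuous_on {0..T} (\<lambda>t. (norm (g n t))\<^sup>2)" by (intro continuous_intros g)
    have dom_int: "integrable lebesgue (\<lambda>t. 2 * w t + indicator {0..T} t * (norm (g n t))\<^sup>2)"
      using LINT_continuous(1)[OF gg] w_int by (auto simp: set_integrable_def)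
    have dom: "AE t in lebesgue. norm (s m t) \<le> 2 * w t + indicator {0..T} t * (norm (g n t))\<^sup>2" for m
      using AE_G
    proof eventually_elim
      case (elim t)
      show ?case
      proof (cases "t \<in> {0..T}")
        case True
        have "\<bar>X m t \<bullet> g n t\<bar> \<le> norm (X m t) * norm (g n t)" by (rule Cauchy_Schwarz_ineq2)
        also have "\<dots> \<le> (norm (X m t))\<^sup>2 + (norm (g n t))\<^sup>2"
          using sum_squares_bound[of "norm (X m t)" "norm (g n t)"]
            mult_nonneg_nonneg[OF norm_ge_zero norm_ge_zero, of "X m t" "g n t"] by linarith
        also have "\<dots> \<le> 2 * w t + (norm (g n t))\<^sup>2" using X_bound[OF True elim] by simp
        finally show ?thesis using True elim by (simp add: s_def)
      next
        case False
        have "0 \<le> w t" unfolding w_def by (rule suminf_nonneg[OF G_sum[OF elim]]) (rule v0)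
        then show ?thesis using False by (simp add: s_def)
      qed
    qed
    \<comment> \<open>Dominated convergence carries the lower bound from the signed partial sums
      over to \<open>u\<close>.\<close>
    have "(\<lambda>m. LINT t|lebesgue. s m t) \<longlonglongrightarrow> (LINT t|lebesgue. indicator {0..T} t * (u t \<bullet> g n t))"
      by (rule integral_dominated_convergence[OF u_meas s_meas dom_int _ dom]) (simp add: s_lim)
    then have "(\<lambda>m. \<bar>LINT t|lebesgue. s m t\<bar>) \<longlonglongrightarrow> \<bar>LINT t|lebesgue. indicator {0..T} t * (u t \<bullet> g n t)\<bar>"
      by (rule tendsto_rabs)
    moreover have "(4/3) ^ n / 6 \<le> \<bar>LINT t|lebesgue. s m t\<bar>" if "m \<ge> n" for m
    proof -
      have "(LINT t|lebesgue. s m t) = (LINT t|lebesgue. indicator {0..T} t * (X m t \<bullet> g n t))"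
        by (rule integral_cong_AE[OF s_meas Xg_meas]) (use AE_G in eventually_elim, simp add: s_def)
      also have "\<dots> = integral {0..T} (\<lambda>t. X m t \<bullet> g n t)"
        using LINT_continuous(2)[OF Xg[of m]] by (simp add: set_lebesgue_integral_def)
      also have "\<dots> = integral {0..T} (\<lambda>t. \<Sum>j\<le>m. \<sigma> j * (b j t \<bullet> g n t))"
        by (simp add: X_def inner_sum_left)
      also have "\<dots> = (\<Sum>j\<le>m. integral {0..T} (\<lambda>t. \<sigma> j * (b j t \<bullet> g n t)))"
        by (rule Henstock_Kurzweil_Integration.integral_sum)
          (auto intro!: integrable_continuous_real continuous_intros b g)
      also have "\<dots> = (\<Sum>j\<le>m. \<sigma> j * f n j)" by (simp add: f_def)
      finally show ?thesis using \<sigma>(2)[OF that] by simp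
    qed
    ultimately have "(4/3) ^ n / 6 \<le> \<bar>LINT t|lebesgue. indicator {0..T} t * (u t \<bullet> g n t)\<bar>"
      by (intro LIMSEQ_le_const) auto
    then show ?thesis by (simp add: set_lebesgue_integral_def)
  qed
  ultimately show thesis by (rule that)
qed


text \<open>Serves to read equality almost everywhere off a vanishing integral. In a possibly
  non-separable space measurability is checked on real-valued norms of differences of simple
  functions; completeness of the Lebesgue measure absorbs the exceptional null set.\<close>

lemma L2_fun_diff_measurable:
  fixes g d :: "real \<Rightarrow> 'a::real_normed_vector"
  assumes g: "continuous_on {0..T} g" and d: "L2_fun T d"
  shows "(\<lambda>t. indicator {0<..<T} t * (norm (g t - d t))\<^sup>2) \<in> borel_measurable lebesgue"
proof -
  obtain s where s: "\<And>i::nat. simple_function lebesgue (s i)"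
    and s_lim: "AE t in lebesgue. t \<in> {0<..<T} \<longrightarrow> (\<lambda>i. s i t) \<longlonglongrightarrow> d t"
    using d by (auto simp: L2_fun_def)
  have "\<exists>p. simple_function lebesgue p \<and> (\<forall>t\<in>{0<..<T}. norm (p t - g t) < 1 / real (Suc m))" for m
    by (rule continuous_simple_approx[OF g, of "1 / real (Suc m)"]) auto
  then have "\<exists>p. \<forall>m. simple_function lebesgue (p m) \<and>
      (\<forall>t\<in>{0<..<T}. norm (p m t - g t) < 1 / real (Suc m))"
    by (intro choice allI)
  then obtain p where p: "\<And>m. simple_function lebesgue (p m)"
    "\<And>m t. t \<in> {0<..<T} \<Longrightarrow> norm (p m t - g t) < 1 / real (Suc m)" by blast
  define F where "F i t = indicator {0<..<T} t * (norm (p i t - s i t))\<^sup>2" for i t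
  have "(\<lambda>t. norm (p i t - s i t)) \<in> borel_measurable lebesgue" for i
    by (rule borel_measurable_simple_function)
      (intro simple_function_compose1[of _ _ norm] simple_function_compose2[where h = "(-)"] p s)
  then have F_meas: "F i \<in> borel_measurable lebesgue" for i
    unfolding F_def by (intro borel_measurable_times borel_measurable_indicator borel_measurable_power) auto
  have "AE t in lebesgue. lim (\<lambda>i. F i t) = indicator {0<..<T} t * (norm (g t - d t))\<^sup>2"
    using s_lim
  proof eventually_elim
    case (elim t)
    show ?case
    proof (cases "t \<in> {0<..<T}")
      case True
      have "(\<lambda>m. p m t - g t) \<longlonglongrightarrow> 0"
        by (rule Lim_null_comparison[OF always_eventually LIMSEQ_Suc[OF lim_1_over_n]])
          (intro allI less_imp_le p(2) True)
      then have "(\<lambda>m. p m t) \<longlonglongrightarrow> g t" by (rule LIM_zero_cancel)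
      then have "(\<lambda>i. F i t) \<longlonglongrightarrow> indicator {0<..<T} t * (norm (g t - d t))\<^sup>2"
        unfolding F_def using elim True by (intro tendsto_intros) auto
      then show ?thesis by (rule limI)
    qed (simp add: F_def)
  qed
  moreover have "(\<lambda>t. lim (\<lambda>i. F i t)) \<in> borel_measurable lebesgue"
    using F_meas by (rule borel_measurable_lim_metric)
  ultimately show ?thesis by (rule borel_measurable_AE[rotated])
qed

lemma continuous_L2_fun:
  fixes g :: "real \<Rightarrow> 'a::real_normed_vector"
  assumes g: "continuous_on {0..T} g"
  shows "L2_fun T g"
proof (rule L2_fun_limit[of T "\<lambda>_. g"])
  have g2: "continuous_on {0..T} (\<lambda>t. (norm (g t))\<^sup>2)" by (intro continuous_intros g)
  have "(\<integral>\<^sup>+t\<in>{0<..<T}. ennreal ((norm (g t))\<^sup>2) \<partial>lebesgue) \<le> (\<integral>\<^sup>+t\<in>{0..T}. ennreal ((norm (g t))\<^sup>2) \<partial>lebesgue)"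
    by (intro nn_integral_mono) (auto split: split_indicator)
  also have "\<dots> < \<infinity>" by (simp add: nn_integral_continuous[OF g2])
  finally show "(\<integral>\<^sup>+t\<in>{0<..<T}. ennreal ((norm (g t))\<^sup>2) \<partial>lebesgue) < \<infinity>" .
qed (use g in auto)

section \<open>Stability of the primal and the dual equation\<close>

context control_system
begin

lemma P_0 [simp]: "P 0 \<phi> = \<phi>"
  by (rule inner_ext) (simp add: P_inner)

text \<open>The L^2 norm of the output, meant for states in \<open>D\<close>: there the output is
  continuous, so a plain integral suffices and the choice in \<open>dual_output\<close> is
  avoided.\<close>

definition output_norm where
  "output_norm T \<phi> = sqrt (integral {0..T} (\<lambda>t. (norm (Bs (P t \<phi>)))\<^sup>2))"

lemma output_sq_continuous: "\<phi> \<in> D \<Longrightarrow> continuous_on {0..T} (\<lambda>t. (norm (Bs (P t \<phi>)))\<^sup>2)"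
  by (intro continuous_intros Bs_P_continuous)

lemma output_sq_integrable: "\<phi> \<in> D \<Longrightarrow> (\<lambda>t. (norm (Bs (P t \<phi>)))\<^sup>2) integrable_on {0..T}"
  by (intro integrable_continuous_real output_sq_continuous)

lemma output_norm_sq: "\<phi> \<in> D \<Longrightarrow> (output_norm T \<phi>)\<^sup>2 = integral {0..T} (\<lambda>t. (norm (Bs (P t \<phi>)))\<^sup>2)"
  unfolding output_norm_def
  by (intro real_sqrt_pow2 Henstock_Kurzweil_Integration.integral_nonneg output_sq_integrable) auto

lemma output_norm_scale:
  assumes "\<phi> \<in> D"
  shows "output_norm T (r *\<^sub>R \<phi>) = \<bar>r\<bar> * output_norm T \<phi>"
proof -
  have "integral {0..T} (\<lambda>t. (norm (Bs (P t (r *\<^sub>R \<phi>))))\<^sup>2) =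
      integral {0..T} (\<lambda>t. r\<^sup>2 * (norm (Bs (P t \<phi>)))\<^sup>2)"
    using assms by (intro integral_cong)
      (auto simp: linear_cmul[OF bounded_linear.linear[OF P_linear]] Bs_scale P_D power_mult_distrib)
  then show ?thesis by (simp add: output_norm_def real_sqrt_mult)
qed

text \<open>The control at time s reaches the state at time \<open>T\<close> through
  \<open>S (T - s)\<close>, so \<open>admissible_estimate\<close> meets outputs run backwards in
  time.\<close>

lemma output_norm_reflect:
  "output_norm T \<phi> = sqrt (integral {0..T} (\<lambda>t. (norm (Bs (P (T - t) \<phi>)))\<^sup>2))"
proof -
  let ?f = "\<lambda>t. (norm (Bs (P t \<phi>)))\<^sup>2"
  have "integral {0..T} ?f = integral {-T..0} (\<lambda>t. ?f (- t))"
    using Henstock_Kurzweil_Integration.integral_reflect_real[of T 0 ?f] by simp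
  also have "\<dots> = integral {0..T} (\<lambda>t. ?f (T - t))"
    using integral_shift_real_ivl[of "-T" "-T" 0 "\<lambda>t. ?f (- t)"] by simp
  finally show ?thesis by (simp add: output_norm_def)
qed

text \<open>Banach-Steinhaus for the functionals \<open>u \<mapsto> \<langle>v(T), \<phi>\<rangle>\<close> on \<open>L\<^sup>2\<close>, with \<open>v\<close> the state driven
  by \<open>u\<close>: the \<open>L\<^sup>2\<close> norm of such a functional is \<open>output_norm T \<phi>\<close>.\<close>

lemma admissible_estimate:
  assumes adm: "admissible A S B" and T: "T > 0"
  obtains K where "K \<ge> 0" "\<And>\<phi>. \<phi> \<in> D \<Longrightarrow> output_norm T \<phi> \<le> K * norm \<phi>"
proof -
  have "\<exists>n::nat. \<forall>\<phi>\<in>D. output_norm T \<phi> \<le> 4 ^ n * norm \<phi>"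
  proof (rule ccontr)
    assume "\<not> ?thesis"
    then have "\<forall>n::nat. \<exists>\<phi>. \<phi> \<in> D \<and> output_norm T \<phi> > 4 ^ n * norm \<phi>" by (auto simp: not_le)
    then obtain \<phi> where \<phi>: "\<And>n::nat. \<phi> n \<in> D" "\<And>n. output_norm T (\<phi> n) > 4 ^ n * norm (\<phi> n)"
      by (auto dest!: choice)
    have "output_norm T 0 = 0" using output_norm_scale[OF D_0, of T 0] by simp
    then have nz: "\<phi> n \<noteq> 0" for n using \<phi>(2)[of n] by auto
    define \<psi> where "\<psi> n = (1 / norm (\<phi> n)) *\<^sub>R \<phi> n" for n
    have \<psi>: "\<psi> n \<in> D" "norm (\<psi> n) = 1" for n using nz[of n] by (auto simp: \<psi>_def D_scale \<phi>)
    have big: "output_norm T (\<psi> n) \<ge> 4 ^ n" for n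
      using \<phi>(2)[of n] nz[of n] by (simp add: \<psi>_def output_norm_scale[OF \<phi>(1)] field_simps)
    define g where "g n t = Bs (P (T - t) (\<psi> n))" for n t
    have g: "continuous_on {0..T} (g n)" for n
      unfolding g_def
      by (rule continuous_on_compose2[OF Bs_P_continuous[OF \<psi>(1), of T]]) (auto intro!: continuous_intros)
    obtain u where u: "L2_fun T u" "\<And>n. (4/3) ^ n / 6 \<le> \<bar>LINT t:{0..T}|lebesgue. u t \<bullet> g n t\<bar>"
    proof (rule L2_gliding_hump[OF g])
      show "4 ^ n \<le> sqrt (integral {0..T} (\<lambda>t. (norm (g n t))\<^sup>2))" for n
        using big[of n] by (simp add: g_def output_norm_reflect)
    qed blast
    obtain v where v: "\<And>t. t \<in> {0..T} \<Longrightarrow> pivot A (v t) =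
        dual_integral t (\<lambda>s. semigroup_ext A S (t - s) (B (u s)))"
      using adm T u(1) unfolding admissible_def by blast
    have "(4/3) ^ n / 6 \<le> norm (v T)" for n
    proof -
      \<comment> \<open>Duality: evaluating the convolution at \<open>\<psi> n\<close> moves
        semigroup and control operator onto it, leaving the L^2 pairing of \<open>u\<close> with the
        \<open>n\<close>-th hump. The left side is bounded in \<open>n\<close>, since the state lies
        in the pivot space.\<close>
      have "v T \<bullet> \<psi> n = (LINT s:{0..T}|lebesgue. semigroup_ext A S (T - s) (B (u s)) (\<psi> n))"
        using fun_cong[OF v[of T], of "\<psi> n"] T \<psi>(1) by (simp add: dual_integral_def)
      also have "\<dots> = (LINT s:{0..T}|lebesgue. u s \<bullet> g n s)"
        unfolding set_lebesgue_integral_def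
        by (rule Bochner_Integration.integral_cong)
          (auto split: split_indicator simp: g_def inner_Bs P_D \<psi>(1) semigroup_ext_apply B_dual)
      finally have "(4/3) ^ n / 6 \<le> \<bar>v T \<bullet> \<psi> n\<bar>" using u(2)[of n] by simp
      also have "\<dots> \<le> norm (v T)" using Cauchy_Schwarz_ineq2[of "v T" "\<psi> n"] \<psi>(2)[of n] by simp
      finally show ?thesis .
    qed
    then show False using four_thirds_unbounded[of "norm (v T)"] by (auto simp: not_less[symmetric])
  qed
  then obtain n where "\<And>\<phi>. \<phi> \<in> D \<Longrightarrow> output_norm T \<phi> \<le> 4 ^ n * norm \<phi>" by blast
  then show thesis by (intro that[of "4 ^ n"]) auto
qed

text \<open>The admissibility estimate shows that the continuous output meets the specification in
  \<open>dual_output\<close>, so the choice is not vacuous; testing the chosen function with a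
  constant sequence then identifies the two.\<close>

lemma dual_output_AE:
  assumes adm: "admissible A S B" and T: "T > 0" and \<xi>: "\<xi> \<in> D"
  shows "AE t in lebesgue. t \<in> {0<..<T} \<longrightarrow> dual_output A S B T \<xi> t = Bs (P t \<xi>)"
proof -
  obtain K where K: "K \<ge> 0" "\<And>\<phi>. \<phi> \<in> D \<Longrightarrow> output_norm T \<phi> \<le> K * norm \<phi>"
    using admissible_estimate[OF adm T] by blast
  define Q where "Q g \<longleftrightarrow> L2_fun T g \<and>
     (\<forall>\<phi>. (\<forall>n. \<phi> n \<in> D) \<longrightarrow> \<phi> \<longlonglongrightarrow> \<xi> \<longrightarrow>
        (\<lambda>n. \<integral>\<^sup>+t\<in>{0<..<T}. ennreal ((norm (Bs (P t (\<phi> n)) - g t))\<^sup>2) \<partial>lebesgue)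
        \<longlonglongrightarrow> 0)" for g
  have "Q (\<lambda>t. Bs (P t \<xi>))"
    unfolding Q_def
  proof (intro conjI allI impI)
    show "L2_fun T (\<lambda>t. Bs (P t \<xi>))" by (intro continuous_L2_fun Bs_P_continuous \<xi>)
    fix \<phi> :: "nat \<Rightarrow> 'h" assume \<phi>: "\<forall>n. \<phi> n \<in> D" "\<phi> \<longlonglongrightarrow> \<xi>"
    have le: "(\<integral>\<^sup>+t\<in>{0<..<T}. ennreal ((norm (Bs (P t (\<phi> n)) - Bs (P t \<xi>)))\<^sup>2) \<partial>lebesgue)
        \<le> ennreal ((K * norm (\<phi> n - \<xi>))\<^sup>2)" for n
    proof -
      have d: "\<phi> n - \<xi> \<in> D" using \<phi> \<xi> by (simp add: D_diff)
      have "(\<integral>\<^sup>+t\<in>{0<..<T}. ennreal ((norm (Bs (P t (\<phi> n)) - Bs (P t \<xi>)))\<^sup>2) \<partial>lebesgue) \<le>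
         (\<integral>\<^sup>+t\<in>{0..T}. ennreal ((norm (Bs (P t (\<phi> n - \<xi>))))\<^sup>2) \<partial>lebesgue)"
        using \<phi> \<xi> by (intro nn_integral_mono)
          (auto split: split_indicator simp: linear_diff[OF bounded_linear.linear[OF P_linear]] Bs_diff P_D)
      also have "\<dots> = ennreal ((output_norm T (\<phi> n - \<xi>))\<^sup>2)"
        by (simp add: nn_integral_continuous[OF output_sq_continuous[OF d]] output_norm_sq[OF d])
      also have "\<dots> \<le> ennreal ((K * norm (\<phi> n - \<xi>))\<^sup>2)"
        by (intro ennreal_leI power_mono K d)
          (auto simp: output_norm_def intro!: Henstock_Kurzweil_Integration.integral_nonneg output_sq_integrable d)
      finally show ?thesis .
    qed
    have "(\<lambda>n. ennreal ((K * norm (\<phi> n - \<xi>))\<^sup>2)) \<longlonglongrightarrow> ennreal ((K * norm (\<xi> - \<xi>))\<^sup>2)"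
      by (intro tendsto_intros \<phi>)
    then have "(\<lambda>n. ennreal ((K * norm (\<phi> n - \<xi>))\<^sup>2)) \<longlonglongrightarrow> 0" by simp
    then show "(\<lambda>n. \<integral>\<^sup>+t\<in>{0<..<T}. ennreal ((norm (Bs (P t (\<phi> n)) - Bs (P t \<xi>)))\<^sup>2) \<partial>lebesgue) \<longlonglongrightarrow> 0"
      by (rule tendsto_sandwich[OF _ _ tendsto_const, rotated 2]) (simp_all add: le)
  qed
  then have "Q (SOME g. Q g)" by (rule someI[of Q])
  then have Q: "Q (dual_output A S B T \<xi>)" unfolding dual_output_def Q_def .
  define d where "d = dual_output A S B T \<xi>"
  have d: "L2_fun T d" using Q by (simp add: Q_def d_def)
  let ?I = "\<integral>\<^sup>+t\<in>{0<..<T}. ennreal ((norm (Bs (P t \<xi>) - d t))\<^sup>2) \<partial>lebesgue"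
  \<comment> \<open>The sequence constantly \<open>\<xi>\<close> is permitted because
    \<open>\<xi>\<close> lies in \<open>D\<close>; a constant sequence tending to 0 is 0.\<close>
  have "(\<lambda>n::nat. ?I) \<longlonglongrightarrow> 0"
    using Q \<xi> unfolding Q_def d_def by (auto dest!: spec[of _ "\<lambda>_. \<xi>"])
  then have "0 = ?I" by (simp add: LIMSEQ_const_iff)
  also have "?I = (\<integral>\<^sup>+t. ennreal (indicator {0<..<T} t * (norm (Bs (P t \<xi>) - d t))\<^sup>2) \<partial>lebesgue)"
    by (intro nn_integral_cong) (auto split: split_indicator)
  finally have I0: "0 = (\<integral>\<^sup>+t. ennreal (indicator {0<..<T} t * (norm (Bs (P t \<xi>) - d t))\<^sup>2) \<partial>lebesgue)" .
  have "(\<lambda>t. indicator {0<..<T} t * (norm (Bs (P t \<xi>) - d t))\<^sup>2) \<in> borel_measurable lebesgue"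
    by (intro L2_fun_diff_measurable Bs_P_continuous \<xi> d)
  then have "AE t in lebesgue. ennreal (indicator {0<..<T} t * (norm (Bs (P t \<xi>) - d t))\<^sup>2) = 0"
    by (rule nn_integral_0_iff_AE[THEN iffD1, OF measurable_compose[OF _ measurable_ennreal] I0[symmetric]])
  then show ?thesis by eventually_elim (auto simp: d_def)
qed

lemma dual_observable_estimate:
  assumes adm: "admissible A S B" and T: "T > 0" and obs: "dual_observable A S B T"
  obtains c where "c > 0" "\<And>\<xi>. \<xi> \<in> D \<Longrightarrow> c * norm (P T \<xi>) \<le> output_norm T \<xi>"
proof -
  obtain c where c: "c > 0"
    "\<And>\<xi>. (LINT t:{0<..<T}|lebesgue. (norm (dual_output A S B T \<xi> t))\<^sup>2) \<ge> c * (norm (P T \<xi>))\<^sup>2"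
    using obs by (auto simp: dual_observable_def)
  show thesis
  proof (rule that[of "sqrt c"])
    fix \<xi> assume \<xi>: "\<xi> \<in> D"
    let ?f = "\<lambda>t. (norm (Bs (P t \<xi>)))\<^sup>2"
    have int: "set_integrable lebesgue {0<..<T} ?f"
      by (rule set_integrable_subset[OF LINT_continuous(1)[OF output_sq_continuous[OF \<xi>], of T]]) auto
    have AE: "AE t in lebesgue. indicator {0<..<T} t *\<^sub>R ?f t =
        indicator {0<..<T} t *\<^sub>R (norm (dual_output A S B T \<xi> t))\<^sup>2"
      using dual_output_AE[OF adm T \<xi>] by eventually_elim (auto split: split_indicator)
    have meas: "(\<lambda>t. indicator {0<..<T} t *\<^sub>R ?f t) \<in> borel_measurable lebesgue"
      using int by (auto simp: set_integrable_def dest: borel_measurable_integrable)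
    have "(LINT t:{0<..<T}|lebesgue. (norm (dual_output A S B T \<xi> t))\<^sup>2) = (LINT t:{0<..<T}|lebesgue. ?f t)"
      unfolding set_lebesgue_integral_def
      by (rule integral_cong_AE[symmetric, OF meas borel_measurable_AE[OF meas AE] AE])
    also have "\<dots> = integral {0<..<T} ?f" by (rule set_lebesgue_integral_eq_integral(2)[OF int])
    also have "\<dots> = (output_norm T \<xi>)\<^sup>2"
      by (simp add: integral_open_interval_real[symmetric] output_norm_sq[OF \<xi>])
    finally have "c * (norm (P T \<xi>))\<^sup>2 \<le> (output_norm T \<xi>)\<^sup>2" using c(2)[of \<xi>] by simp
    then have "sqrt (c * (norm (P T \<xi>))\<^sup>2) \<le> sqrt ((output_norm T \<xi>)\<^sup>2)" by (rule real_sqrt_le_mono)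
    moreover have "output_norm T \<xi> \<ge> 0"
      by (auto simp: output_norm_def intro!: Henstock_Kurzweil_Integration.integral_nonneg output_sq_integrable \<xi>)
    ultimately show "sqrt c * norm (P T \<xi>) \<le> output_norm T \<xi>" by (simp add: real_sqrt_mult)
  qed (use c in simp)
qed

text \<open>Integration in time gains what \<open>Bs\<close> loses: the bound involves the norm of
  \<open>\<phi>\<close> and not its graph norm. The factor \<open>sqrt T\<close> comes from
  Cauchy-Schwarz against the constant function \<open>v\<close>.\<close>

lemma output_integral_bound:
  assumes K: "\<And>\<phi>. \<phi> \<in> D \<Longrightarrow> output_norm T \<phi> \<le> K * norm \<phi>" and \<phi>: "\<phi> \<in> D" and t: "0 \<le> t" "t \<le> T"
  shows "\<bar>integral {0..t} (\<lambda>s. v \<bullet> Bs (P s \<phi>))\<bar> \<le> sqrt T * norm v * (K * norm \<phi>)"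
proof -
  have "\<bar>integral {0..t} (\<lambda>s. v \<bullet> Bs (P s \<phi>))\<bar> \<le>
    sqrt (integral {0..t} (\<lambda>s. (norm v)\<^sup>2)) * sqrt (integral {0..t} (\<lambda>s. (norm (Bs (P s \<phi>)))\<^sup>2))"
    by (intro integral_Cauchy_Schwarz continuous_on_const Bs_P_continuous \<phi>)
  also have "\<dots> \<le> (sqrt T * norm v) * (K * norm \<phi>)"
  proof (intro mult_mono)
    have "t * (norm v)\<^sup>2 \<le> T * (norm v)\<^sup>2" using t by (intro mult_right_mono) auto
    from real_sqrt_le_mono[OF this] show "sqrt (integral {0..t} (\<lambda>s. (norm v)\<^sup>2)) \<le> sqrt T * norm v"
      using t by (simp add: real_sqrt_mult)
    have "integral {0..t} (\<lambda>s. (norm (Bs (P s \<phi>)))\<^sup>2) \<le> integral {0..T} (\<lambda>s. (norm (Bs (P s \<phi>)))\<^sup>2)"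
      using t by (intro integral_subset_le output_sq_integrable \<phi>) auto
    from real_sqrt_le_mono[OF this]
    show "sqrt (integral {0..t} (\<lambda>s. (norm (Bs (P s \<phi>)))\<^sup>2)) \<le> K * norm \<phi>"
      by (rule order_trans[OF _ K[OF \<phi>, unfolded output_norm_def]])
  qed (use t in \<open>auto intro!: Henstock_Kurzweil_Integration.integral_nonneg output_sq_integrable \<phi>\<close>)
  finally show ?thesis .
qed

lemma norm_le_of_inner_le_D:
  assumes le: "\<And>\<phi>. \<phi> \<in> D \<Longrightarrow> v \<bullet> \<phi> \<le> c * norm \<phi>" and c: "c \<ge> 0"
  shows "norm v \<le> c"
proof (rule norm_le_of_inner_le[OF _ c])
  fix \<phi>
  have "(\<lambda>k. v \<bullet> R k \<phi>) \<longlonglongrightarrow> v \<bullet> \<phi>" "(\<lambda>k. c * norm (R k \<phi>)) \<longlonglongrightarrow> c * norm \<phi>"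
    by (intro tendsto_intros R_tendsto)+
  moreover have "\<exists>N. \<forall>k\<ge>N. v \<bullet> R k \<phi> \<le> c * norm (R k \<phi>)"
    using eventually_index unfolding eventually_sequentially by (blast intro: le R_D)
  ultimately show "v \<bullet> \<phi> \<le> c * norm \<phi>" by (rule LIMSEQ_le)
qed

text \<open>The argument runs with \<open>r = R k y\<close>, the vector whose output is prescribed.
  Since \<open>As r = R k (As y)\<close> lies in \<open>D\<close>, \<open>Bs_P_integral\<close> and
  the admissibility bound keep \<open>Bs (P t r)\<close> close to \<open>Bs r\<close>. Observability
  then bounds \<open>P T r\<close>, the Lipschitz estimate returns to \<open>r\<close>, and the
  resolvent identity to \<open>y\<close>.\<close>

lemma dual_stability:
  assumes adm: "admissible A S B" and T: "T > 0" and obs: "dual_observable A S B T"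
  obtains K where "K \<ge> 0"
    "\<And>k y. real k \<ge> \<omega> + 1 \<Longrightarrow> y \<in> D \<Longrightarrow> norm y \<le> K * (norm (Bs (R k y)) + norm (As y))"
proof -
  obtain K where K: "K \<ge> 0" "\<And>\<phi>. \<phi> \<in> D \<Longrightarrow> output_norm T \<phi> \<le> K * norm \<phi>"
    using admissible_estimate[OF adm T] by blast
  obtain c where c: "c > 0" "\<And>\<xi>. \<xi> \<in> D \<Longrightarrow> c * norm (P T \<xi>) \<le> output_norm T \<xi>"
    using dual_observable_estimate[OF adm T obs] by blast
  have L0: "L \<ge> 0" using L_ge_1 by simp
  \<comment> \<open>\<open>sqrt T * K\<close> is from \<open>output_integral_bound\<close>, and
    \<open>L\<close> from the bound on \<open>As r\<close> by \<open>As y\<close>; \<open>F\<close>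
    below is the Lipschitz constant over a time span \<open>T\<close>, again with
    \<open>L\<close>.\<close>
  define E where "E = sqrt T * K * L"
  have E0: "E \<ge> 0" using K L0 T by (simp add: E_def)
  define F where "F = M * exp (\<omega> * T) * T * L"
  have F0: "F \<ge> 0" using M L0 T by (simp add: F_def)
  have "norm y \<le> sqrt T / c * (norm (Bs (R k y)) + E * norm (As y)) + F * norm (As y) + L * norm (As y)"
    if k: "real k \<ge> \<omega> + 1" and y: "y \<in> D" for k y
  proof -
    define r where "r = R k y"
    have r: "r \<in> D" and Asr': "As r = R k (As y)"
      using R_D[OF k] R_As[OF k y] by (auto simp: r_def)
    have Asr: "As r \<in> D" unfolding Asr' by (rule R_D[OF k])
    have nAsr: "norm (As r) \<le> L * norm (As y)" unfolding Asr' by (rule R_norm[OF k])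
    have k1: "real k \<ge> 1" using k \<omega> by simp
    define a where "a = norm (Bs r) + E * norm (As y)"
    have a0: "a \<ge> 0" using E0 by (simp add: a_def)
    have "norm (Bs (P t r)) \<le> a" if t: "t \<in> {0..T}" for t
    proof -
      have "norm (Bs (P t r) - Bs r) \<le> E * norm (As y)"
      proof (rule norm_le_of_inner_le)
        fix v
        have "(Bs (P t r) - Bs r) \<bullet> v = integral {0..t} (\<lambda>s. v \<bullet> Bs (P s (As r)))"
          using Bs_P_integral[OF r Asr, of t v] t by (simp add: inner_commute)
        also have "\<dots> \<le> sqrt T * norm v * (K * norm (As r))"
          using output_integral_bound[OF K(2) Asr, of t v] t by auto
        also have "\<dots> \<le> sqrt T * norm v * (K * (L * norm (As y)))"
          using T K by (intro mult_left_mono nAsr) auto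
        finally show "(Bs (P t r) - Bs r) \<bullet> v \<le> E * norm (As y) * norm v"
          by (simp add: E_def algebra_simps)
      qed (use E0 in simp)
      then show ?thesis using norm_triangle_sub[of "Bs (P t r)" "Bs r"] by (simp add: a_def)
    qed
    then have "integral {0..T} (\<lambda>t. (norm (Bs (P t r)))\<^sup>2) \<le> integral {0..T} (\<lambda>t. a\<^sup>2)"
      by (intro integral_le output_sq_integrable r power_mono) auto
    then have "output_norm T r \<le> sqrt T * a"
      unfolding output_norm_def using T a0 real_sqrt_le_mono by (fastforce simp: real_sqrt_mult)
    then have "c * norm (P T r) \<le> sqrt T * a" using c(2)[OF r] by linarith
    then have 1: "norm (P T r) \<le> sqrt T / c * a" using c(1) by (simp add: field_simps)
    have "norm (P T r - P 0 r) \<le> M * exp (\<omega> * T) * norm (As r) * (T - 0)"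
      using T by (intro P_Lipschitz r) auto
    also have "\<dots> \<le> M * exp (\<omega> * T) * (L * norm (As y)) * (T - 0)"
      using T M by (intro mult_left_mono mult_right_mono nAsr) auto
    finally have 2: "norm (P T r - r) \<le> F * norm (As y)" by (simp add: F_def algebra_simps)
    \<comment> \<open>Recovers \<open>y\<close> from \<open>R k y\<close>;
      \<open>real k \<ge> 1\<close> keeps the coefficient of \<open>As r\<close> at most 1.\<close>
    have "y = r - As r /\<^sub>R real k" using As_R[OF k, of y] k1 by (simp add: r_def)
    then have "norm y \<le> norm r + norm (As r /\<^sub>R real k)" by (metis norm_triangle_ineq4)
    moreover have "norm (As r /\<^sub>R real k) \<le> norm (As r)"
      using k1 mult_right_mono[of "inverse (real k)" 1 "norm (As r)"] by (simp add: inverse_le_1_iff)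
    moreover have "norm r \<le> norm (P T r) + norm (P T r - r)"
      by (metis norm_minus_commute norm_triangle_sub)
    ultimately show ?thesis using 1 2 nAsr by (simp add: a_def r_def)
  qed
  note main = this
  show thesis
  proof (rule that[of "sqrt T / c + (sqrt T / c * E + F + L)"])
    fix k y assume k: "real k \<ge> \<omega> + 1" and y: "y \<in> D"
    have pos: "sqrt T / c \<ge> 0" "sqrt T / c * E + F + L \<ge> 0" using T c E0 F0 L0 by auto
    show "norm y \<le> (sqrt T / c + (sqrt T / c * E + F + L)) * (norm (Bs (R k y)) + norm (As y))"
      using main[OF k y] mult_nonneg_nonneg[OF pos(1) norm_ge_zero[of "As y"]]
        mult_nonneg_nonneg[OF pos(2) norm_ge_zero[of "Bs (R k y)"]]
      by (simp add: algebra_simps)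
  qed (use T c E0 F0 L0 in auto)
qed

text \<open>Under the constraint the orbit \<open>S t x\<close> moves away from \<open>x\<close> by
  at most a multiple of \<open>norm u\<close>, by admissibility. Hence \<open>C (S t x)\<close>
  stays near \<open>C x\<close>, observability bounds \<open>S T x\<close>, and the same deviation
  estimate returns to \<open>x\<close>.\<close>

lemma primal_stability:
  assumes adm: "admissible A S B" and T: "T > 0" and C: "bounded_linear C" and obs: "observable S C T"
  obtains K where "K \<ge> 0"
    "\<And>k x u. real k \<ge> \<omega> + 1 \<Longrightarrow> (\<And>\<phi>. \<phi> \<in> D \<Longrightarrow> x \<bullet> As \<phi> + u \<bullet> Bs (R k \<phi>) = 0) \<Longrightarrow>
      norm x \<le> K * (norm (C x) + norm u)"
proof -
  obtain K where K: "K \<ge> 0" "\<And>\<phi>. \<phi> \<in> D \<Longrightarrow> output_norm T \<phi> \<le> K * norm \<phi>"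
    using admissible_estimate[OF adm T] by blast
  obtain c where c: "c > 0" "\<And>\<xi>. (LINT t:{0..T}|lebesgue. (norm (C (S t \<xi>)))\<^sup>2) \<ge> c * (norm (S T \<xi>))\<^sup>2"
    using obs by (auto simp: observable_def)
  obtain N where N: "N \<ge> 0" "\<And>x. norm (C x) \<le> norm x * N"
    using bounded_linear.nonneg_bounded[OF C] by blast
  have L0: "L \<ge> 0" using L_ge_1 by simp
  define E where "E = sqrt T * K * L"
  have E0: "E \<ge> 0" using K L0 T by (simp add: E_def)
  have main: "norm x \<le> sqrt (T / c) * (norm (C x) + N * E * norm u) + E * norm u"
    if k: "real k \<ge> \<omega> + 1" and con: "\<And>\<phi>. \<phi> \<in> D \<Longrightarrow> x \<bullet> As \<phi> + u \<bullet> Bs (R k \<phi>) = 0" for k x u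
  proof -
    have diff: "norm (S t x - x) \<le> E * norm u" if t: "t \<in> {0..T}" for t
    proof (rule norm_le_of_inner_le_D)
      fix \<phi> assume \<phi>: "\<phi> \<in> D"
      have "(S t x - x) \<bullet> \<phi> = integral {0..t} (\<lambda>s. S s x \<bullet> As \<phi>)"
        using S_inner_integral[OF \<phi>, of t x] t by (simp add: inner_diff_left)
      also have "\<dots> = integral {0..t} (\<lambda>s. (- u) \<bullet> Bs (P s (R k \<phi>)))"
      proof (rule integral_cong)
        fix s assume s: "s \<in> {0..t}"
        \<comment> \<open>The semigroup is moved onto the test vector; the constraint then applies
          to \<open>P s \<phi>\<close>, which stays in \<open>D\<close>, and \<open>R k\<close>
          commutes with \<open>P s\<close>.\<close>
        have "S s x \<bullet> As \<phi> = x \<bullet> As (P s \<phi>)" using s \<phi> by (simp add: As_P P_inner)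
        also have "\<dots> = - (u \<bullet> Bs (R k (P s \<phi>)))" using con[OF P_D[OF _ \<phi>, of s]] s by simp
        finally show "S s x \<bullet> As \<phi> = (- u) \<bullet> Bs (P s (R k \<phi>))" using s k by (simp add: P_R)
      qed
      also have "\<dots> \<le> sqrt T * norm (- u) * (K * norm (R k \<phi>))"
        using output_integral_bound[OF K(2) R_D[OF k], of t "- u" \<phi>] t by auto
      also have "\<dots> \<le> sqrt T * norm (- u) * (K * (L * norm \<phi>))"
        using T K by (intro mult_left_mono R_norm k) auto
      finally show "(S t x - x) \<bullet> \<phi> \<le> E * norm u * norm \<phi>" by (simp add: E_def algebra_simps)
    qed (use E0 in simp)
    define a where "a = norm (C x) + N * E * norm u"
    have a0: "a \<ge> 0" using E0 N by (simp add: a_def)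
    have "norm (C (S t x)) \<le> a" if t: "t \<in> {0..T}" for t
    proof -
      have "C (S t x) = C x + C (S t x - x)" by (simp add: linear_diff[OF bounded_linear.linear[OF C]])
      then have "norm (C (S t x)) \<le> norm (C x) + norm (C (S t x - x))" by (metis norm_triangle_ineq)
      also have "norm (C (S t x - x)) \<le> (E * norm u) * N"
        using N(2)[of "S t x - x"] mult_right_mono[OF diff[OF t] N(1)] by linarith
      finally show ?thesis by (simp add: a_def algebra_simps)
    qed
    moreover have cont: "continuous_on {0..T} (\<lambda>t. (norm (C (S t x)))\<^sup>2)"
      by (intro continuous_intros bounded_linear.continuous_on[OF C]
          continuous_on_subset[OF S_continuous]) auto
    ultimately have "integral {0..T} (\<lambda>t. (norm (C (S t x)))\<^sup>2) \<le> integral {0..T} (\<lambda>t. a\<^sup>2)"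
      by (intro integral_le integrable_continuous_real power_mono) auto
    then have "c * (norm (S T x))\<^sup>2 \<le> T * a\<^sup>2"
      using c(2)[of x] T by (simp add: LINT_continuous(2)[OF cont])
    then have "(norm (S T x))\<^sup>2 \<le> T / c * a\<^sup>2" using c(1) by (simp add: field_simps)
    from real_sqrt_le_mono[OF this] have "norm (S T x) \<le> sqrt (T / c) * a"
      using a0 by (simp only: real_sqrt_mult) simp
    moreover have "norm x \<le> norm (S T x) + norm (S T x - x)"
      by (metis norm_minus_commute norm_triangle_sub)
    ultimately show ?thesis using diff[of T] T by (simp add: a_def)
  qed
  show thesis
  proof (rule that[of "sqrt (T / c) + (sqrt (T / c) * (N * E) + E)"])
    fix k x u assume *: "real k \<ge> \<omega> + 1" "\<And>\<phi>. \<phi> \<in> D \<Longrightarrow> x \<bullet> As \<phi> + u \<bullet> Bs (R k \<phi>) = 0"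
    have "sqrt (T / c) \<ge> 0" "sqrt (T / c) * (N * E) + E \<ge> 0" using T c E0 N by auto
    then have "0 \<le> sqrt (T / c) * norm u" "0 \<le> (sqrt (T / c) * (N * E) + E) * norm (C x)" by auto
    then show "norm x \<le> (sqrt (T / c) + (sqrt (T / c) * (N * E) + E)) * (norm (C x) + norm u)"
      using main[OF *] by (simp add: algebra_simps)
  qed (use T c E0 N in auto)
qed

end


section \<open>Convergence of the solution triples\<close>

text \<open>The errors \<open>d\<close> and \<open>e\<close> multiply different unknowns; against
  the larger unknown \<open>m\<close> both sides share a factor \<open>m\<close>, which
  cancels.\<close>

lemma energy_estimate:
  fixes a b :: real
  assumes "a \<ge> 0" "b \<ge> 0" "d \<ge> 0" "e \<ge> 0" and le: "a\<^sup>2 + b\<^sup>2 \<le> d * a + b * e"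
  shows "a \<le> d + e" "b \<le> d + e"
proof -
  define m where "m = max a b"
  have m: "a \<le> m" "b \<le> m" "m \<ge> 0" using assms by (auto simp: m_def)
  have "m * m \<le> a\<^sup>2 + b\<^sup>2" by (auto simp: m_def max_def power2_eq_square)
  also have "\<dots> \<le> d * m + m * e"
    using le mult_left_mono[OF m(1) \<open>d \<ge> 0\<close>] mult_right_mono[OF m(2) \<open>e \<ge> 0\<close>] by linarith
  finally have "m * m \<le> m * (d + e)" by (simp add: algebra_simps)
  then have "m \<le> d + e" using m(3) assms by (cases "m = 0") auto
  then show "a \<le> d + e" "b \<le> d + e" using m by auto
qed

context control_system
begin

lemma solution_tripleD:
  assumes "solution_triple A B' C z (x, u, y)"
  shows "\<phi> \<in> D \<Longrightarrow> x \<bullet> As \<phi> + u \<bullet> control_adj B' \<phi> = 0"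
    and "y \<in> D" and "As y = - adjoint C (C x - z)" and "control_adj B' y = - u"
proof -
  have *: "stationary_constraint A B' (x, u)" "y \<in> D" "- As y - adjoint C (C x - z) = 0"
    "u = - control_adj B' y"
    using assms by (auto simp: solution_triple_def is_arg_min_def)
  show "\<phi> \<in> D \<Longrightarrow> x \<bullet> As \<phi> + u \<bullet> control_adj B' \<phi> = 0"
    using *(1) by (simp add: stationary_constraint_def)
  show "y \<in> D" by (rule *(2))
  have "As y + (- As y - adjoint C (C x - z)) = As y" using *(3) by simp
  then show "As y = - adjoint C (C x - z)" by simp
  show "control_adj B' y = - u" using *(4) by simp
qed

text \<open>Testing the difference of the two constraints with the difference of the adjoint states
  gives an energy identity, in which only consistency errors of the fixed triple appear.\<close>

lemma energy_identity:
  assumes C: "bounded_linear C" and k: "real k \<ge> \<omega> + 1"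
    and bar: "solution_triple A B C z (xbar, ubar, ybar)"
    and sol: "solution_triple A (\<lambda>v. pivot A (yosida_ext A S k (B v))) C z (x, u, y)"
  shows "\<And>\<phi>. \<phi> \<in> D \<Longrightarrow> (x - yosida S k xbar) \<bullet> As \<phi> + (u - ubar) \<bullet> Bs (R k \<phi>) = 0"
    and "Bs (R k (y - ybar)) = - (u - ubar) - (Bs (R k ybar) - Bs ybar)"
    and "As (y - ybar) = - adjoint C (C (x - xbar))"
    and "(norm (C (x - xbar)))\<^sup>2 + (norm (u - ubar))\<^sup>2 =
      - (C (xbar - yosida S k xbar) \<bullet> C (x - xbar)) - (u - ubar) \<bullet> (Bs (R k ybar) - Bs ybar)"
proof -
  note bar' = solution_tripleD[OF bar] and sol' = solution_tripleD[OF sol]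
  have linC: "linear C" using C by (rule bounded_linear.linear)
  have linR: "linear (R k)" by (rule bounded_linear.linear[OF R_linear[OF k]])
  have linA: "linear (adjoint C)" by (rule bounded_linear.linear[OF hilbert_adjoint_linear[OF C]])
  show con: "(x - yosida S k xbar) \<bullet> As \<phi> + (u - ubar) \<bullet> Bs (R k \<phi>) = 0" if \<phi>: "\<phi> \<in> D" for \<phi>
  proof -
    \<comment> \<open>J_k passes to the test vector as \<open>R k\<close>, and
      \<open>R k \<phi>\<close> is itself a legitimate test vector for the limit constraint.\<close>
    have "yosida S k xbar \<bullet> As \<phi> = xbar \<bullet> As (R k \<phi>)"
      by (simp add: R_As[OF k \<phi>, symmetric] R_inner[OF k])
    then have "yosida S k xbar \<bullet> As \<phi> + ubar \<bullet> Bs (R k \<phi>) = 0"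
      using bar'(1)[OF R_D[OF k]] by simp
    moreover have "x \<bullet> As \<phi> + u \<bullet> Bs (R k \<phi>) = 0"
      using sol'(1)[OF \<phi>] by (simp add: Bs_yosida[OF k \<phi>])
    ultimately show ?thesis by (simp add: inner_diff_left)
  qed
  have dy: "y - ybar \<in> D" using sol'(2) bar'(2) by (simp add: D_diff)
  have "Bs (R k y) = - u" using sol'(4) by (simp add: Bs_yosida[OF k sol'(2)])
  then show BR: "Bs (R k (y - ybar)) = - (u - ubar) - (Bs (R k ybar) - Bs ybar)"
    using bar'(4) by (simp add: linear_diff[OF linR] Bs_diff R_D[OF k])
  have "As (y - ybar) = adjoint C (C xbar - z) - adjoint C (C x - z)"
    using sol'(2,3) bar'(2,3) by (simp add: D_diff)
  also have "\<dots> = - adjoint C (C (x - xbar))"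
    by (simp add: linear_diff[OF linA] linear_diff[OF linC])
  finally show AsE: "As (y - ybar) = - adjoint C (C (x - xbar))" .
  have "C (x - yosida S k xbar) = C (x - xbar) + C (xbar - yosida S k xbar)"
    by (simp add: linear_diff[OF linC])
  then have "(x - yosida S k xbar) \<bullet> As (y - ybar) =
      - (norm (C (x - xbar)))\<^sup>2 - C (xbar - yosida S k xbar) \<bullet> C (x - xbar)"
    by (simp add: AsE hilbert_adjoint[OF C] inner_add_left power2_norm_eq_inner)
  moreover have "(u - ubar) \<bullet> Bs (R k (y - ybar)) =
      - (norm (u - ubar))\<^sup>2 - (u - ubar) \<bullet> (Bs (R k ybar) - Bs ybar)"
    by (simp only: BR inner_diff_right inner_minus_right power2_norm_eq_inner)
  ultimately show "(norm (C (x - xbar)))\<^sup>2 + (norm (u - ubar))\<^sup>2 =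
      - (C (xbar - yosida S k xbar) \<bullet> C (x - xbar)) - (u - ubar) \<bullet> (Bs (R k ybar) - Bs ybar)"
    using con[OF dy] by simp
qed

lemma solution_triples_tendsto:
  assumes adm: "admissible A S B" and C: "bounded_linear C" and T: "T > 0"
    and obs: "observable S C T" and dobs: "dual_observable A S B T"
    and bar: "solution_triple A B C z (xbar, ubar, ybar)"
    and sol: "\<forall>\<^sub>F k in sequentially.
      solution_triple A (\<lambda>v. pivot A (yosida_ext A S k (B v))) C z (x k, u k, y k)"
  shows "x \<longlonglongrightarrow> xbar \<and> u \<longlonglongrightarrow> ubar \<and> y \<longlonglongrightarrow> ybar"
proof -
  obtain N where N: "N \<ge> 0" "\<And>x. norm (C x) \<le> norm x * N"
    using bounded_linear.nonneg_bounded[OF C] by blast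
  obtain N' where N': "N' \<ge> 0" "\<And>x. norm (adjoint C x) \<le> norm x * N'"
    using bounded_linear.nonneg_bounded[OF hilbert_adjoint_linear[OF C]] by blast
  obtain Kp where Kp: "Kp \<ge> 0"
    "\<And>k x u. real k \<ge> \<omega> + 1 \<Longrightarrow> (\<And>\<phi>. \<phi> \<in> D \<Longrightarrow> x \<bullet> As \<phi> + u \<bullet> Bs (R k \<phi>) = 0) \<Longrightarrow>
      norm x \<le> Kp * (norm (C x) + norm u)"
    using primal_stability[OF adm T C obs] by blast
  obtain Kd where Kd: "Kd \<ge> 0"
    "\<And>k y. real k \<ge> \<omega> + 1 \<Longrightarrow> y \<in> D \<Longrightarrow> norm y \<le> Kd * (norm (Bs (R k y)) + norm (As y))"
    using dual_stability[OF adm T dobs] by blast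
  have ybar: "ybar \<in> D" by (rule solution_tripleD(2)[OF bar])
  define p where "p k = norm (xbar - yosida S k xbar)" for k
  define e where "e k = norm (Bs (R k ybar) - Bs ybar)" for k
  have p0: "p \<longlonglongrightarrow> 0"
    using tendsto_norm[OF tendsto_diff[OF tendsto_const yosida_tendsto], of xbar xbar]
    by (simp add: p_def[abs_def])
  have e0: "e \<longlonglongrightarrow> 0"
  proof -
    \<comment> \<open>\<open>ybar\<close> lies in \<open>D\<close> and \<open>R k\<close> commutes
      with \<open>As\<close> there, so the convergence holds in the graph norm.\<close>
    have "(\<lambda>k. Bs (R k ybar)) \<longlonglongrightarrow> Bs ybar"
    proof (rule Bs_tendsto[OF _ eventually_index ybar R_tendsto])
      show "R k ybar \<in> D \<or> \<not> real k \<ge> \<omega> + 1" for k using R_D by blast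
      show "(\<lambda>k. As (R k ybar)) \<longlonglongrightarrow> As ybar"
        by (rule Lim_transform_eventually[OF R_tendsto[of "As ybar"]])
          (use eventually_index in eventually_elim, rule R_As[OF _ ybar])
    qed
    from tendsto_norm[OF tendsto_diff[OF this tendsto_const, of "Bs ybar"]]
    show ?thesis by (simp add: e_def[abs_def])
  qed
  \<comment> \<open>The bound \<open>d + e\<close> from \<open>energy_estimate\<close>, with state
    error \<open>p k * N\<close> and control error \<open>e k\<close>.\<close>
  define q where "q k = p k * N + e k" for k
  have q0: "q \<longlonglongrightarrow> 0"
    using tendsto_add[OF tendsto_mult_left_zero[OF p0, of N] e0] by (simp add: q_def[abs_def])
  have ev: "\<forall>\<^sub>F k in sequentially. real k \<ge> \<omega> + 1 \<and>
      solution_triple A (\<lambda>v. pivot A (yosida_ext A S k (B v))) C z (x k, u k, y k)"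
    using eventually_index sol by eventually_elim simp
  have ests: "norm (u k - ubar) \<le> q k \<and> norm (x k - xbar) \<le> Kp * (p k * N + 2 * q k) + p k \<and>
      norm (y k - ybar) \<le> Kd * (q k + e k + q k * N')"
    if *: "real k \<ge> \<omega> + 1 \<and>
      solution_triple A (\<lambda>v. pivot A (yosida_ext A S k (B v))) C z (x k, u k, y k)" for k
  proof -
    note k = conjunct1[OF *] and I = energy_identity[OF C conjunct1[OF *] bar conjunct2[OF *]]
    have Cp: "norm (C (xbar - yosida S k xbar)) \<le> p k * N" using N(2) by (simp add: p_def)
    have "(norm (C (x k - xbar)))\<^sup>2 + (norm (u k - ubar))\<^sup>2 \<le>
        norm (C (xbar - yosida S k xbar)) * norm (C (x k - xbar)) + norm (u k - ubar) * e k"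
      unfolding I(4) e_def
      using Cauchy_Schwarz_ineq2[of "C (xbar - yosida S k xbar)" "C (x k - xbar)"]
        Cauchy_Schwarz_ineq2[of "u k - ubar" "Bs (R k ybar) - Bs ybar"] by linarith
    also have "\<dots> \<le> p k * N * norm (C (x k - xbar)) + norm (u k - ubar) * e k"
      using Cp by (intro add_mono mult_right_mono) (auto simp: e_def)
    finally have "norm (C (x k - xbar)) \<le> p k * N + e k" "norm (u k - ubar) \<le> p k * N + e k"
      using energy_estimate[of "norm (C (x k - xbar))" "norm (u k - ubar)" "p k * N" "e k"] N
      by (auto simp: p_def e_def)
    then have Cx: "norm (C (x k - xbar)) \<le> q k" and du: "norm (u k - ubar) \<le> q k"
      by (simp_all add: q_def)
    have "C (x k - yosida S k xbar) = C (x k - xbar) + C (xbar - yosida S k xbar)"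
      by (simp add: linear_diff[OF bounded_linear.linear[OF C]])
    then have "norm (C (x k - yosida S k xbar)) \<le> q k + p k * N"
      using norm_triangle_ineq[of "C (x k - xbar)" "C (xbar - yosida S k xbar)"] Cx Cp by simp
    then have "Kp * (norm (C (x k - yosida S k xbar)) + norm (u k - ubar)) \<le> Kp * (p k * N + 2 * q k)"
      using du Kp(1) by (intro mult_left_mono) auto
    moreover have "norm (x k - yosida S k xbar) \<le> Kp * (norm (C (x k - yosida S k xbar)) + norm (u k - ubar))"
      by (rule Kp(2)[OF k I(1)])
    moreover have "norm (x k - xbar) \<le> norm (x k - yosida S k xbar) + p k"
      using norm_triangle_ineq4[of "x k - yosida S k xbar" "xbar - yosida S k xbar"] by (simp add: p_def)
    ultimately have "norm (x k - xbar) \<le> Kp * (p k * N + 2 * q k) + p k" by linarith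
    moreover have "norm (y k - ybar) \<le> Kd * (norm (Bs (R k (y k - ybar))) + norm (As (y k - ybar)))"
      using solution_tripleD(2)[OF conjunct2[OF *]] ybar by (intro Kd(2)[OF k]) (simp add: D_diff)
    moreover have "\<dots> \<le> Kd * (q k + e k + q k * N')"
    proof (intro mult_left_mono add_mono Kd(1))
      show "norm (Bs (R k (y k - ybar))) \<le> q k + e k"
        unfolding I(2) e_def using norm_triangle_ineq4[of "- (u k - ubar)" "Bs (R k ybar) - Bs ybar"] du
        by (simp add: norm_minus_commute)
      have "norm (adjoint C (C (x k - xbar))) \<le> norm (C (x k - xbar)) * N'" by (rule N'(2))
      also have "\<dots> \<le> q k * N'" by (intro mult_right_mono Cx N'(1))
      finally show "norm (As (y k - ybar)) \<le> q k * N'" by (simp add: I(3))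
    qed
    ultimately show ?thesis using du by linarith
  qed
  have "(\<lambda>k. Kp * (p k * N + 2 * q k) + p k) \<longlonglongrightarrow> Kp * (0 * N + 2 * 0) + 0"
    by (intro tendsto_intros p0 q0)
  then have limx: "(\<lambda>k. Kp * (p k * N + 2 * q k) + p k) \<longlonglongrightarrow> 0" by simp
  have "(\<lambda>k. Kd * (q k + e k + q k * N')) \<longlonglongrightarrow> Kd * (0 + 0 + 0 * N')"
    by (intro tendsto_intros q0 e0)
  then have limy: "(\<lambda>k. Kd * (q k + e k + q k * N')) \<longlonglongrightarrow> 0" by simp
  have close: "X \<longlonglongrightarrow> l" if "r \<longlonglongrightarrow> 0" "\<forall>\<^sub>F k in sequentially. norm (X k - l) \<le> r k"
    for X :: "nat \<Rightarrow> 'a::real_normed_vector" and l r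
    using that by (rule LIM_zero_cancel[OF Lim_null_comparison, rotated])
  show ?thesis
    by (intro conjI close[OF limx] close[OF q0] close[OF limy];
        rule eventually_mono[OF ev], drule ests, elim conjE, assumption)
qed

end

theorem lemma3p1:
  fixes A :: "'h::{real_inner, complete_space} unb_op"
    and S :: "real \<Rightarrow> 'h \<Rightarrow> 'h"
    and B :: "'u::{real_inner, complete_space} \<Rightarrow> ('h \<Rightarrow> real)"
    and C :: "'h \<Rightarrow> 'h"
    and z :: 'h
    and T\<^sub>0 :: real
    and xbar :: 'h and ubar :: 'u and ybar :: 'h
    and x :: "nat \<Rightarrow> 'h" and u :: "nat \<Rightarrow> 'u" and y :: "nat \<Rightarrow> 'h"
  assumes "generates A S"
    and "control_op A B"
    and "admissible A S B"
    and "bounded_linear C"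
    and "T\<^sub>0 > 0"
    and "observable S C T\<^sub>0"
    and "dual_observable A S B T\<^sub>0"
    and "{\<xi>\<in>op_dom A. op_app A \<xi> = 0} \<inter> {\<xi>. C \<xi> = 0} = {0}"
    and "{\<phi>\<in>op_dom (adj_op A). op_app (adj_op A) \<phi> = 0} \<inter>
         {\<phi>\<in>op_dom (adj_op A). control_adj B \<phi> = 0} = {0}"
    and "solution_triple A B C z (xbar, ubar, ybar)"
    and "\<forall>\<^sub>F k in sequentially.
           solution_triple A (\<lambda>v. pivot A (yosida_ext A S k (B v))) C z (x k, u k, y k)"
  shows "x \<longlonglongrightarrow> xbar \<and> u \<longlonglongrightarrow> ubar \<and> y \<longlonglongrightarrow> ybar"
proof -
  have "c0_semigroup S" using assms(1) by (simp add: generates_def)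
  then obtain M \<omega> where "M \<ge> 1" "\<omega> \<ge> 0" "\<And>t x. t \<ge> 0 \<Longrightarrow> norm (S t x) \<le> M * exp (\<omega> * t) * norm x"
    using c0_semigroup_bound by blast
  then interpret control_system A S M \<omega> B
    using assms(1,2) by unfold_locales
  show ?thesis
    using assms by (intro solution_triples_tendsto)
qed

end
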